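(* Let $G$ be a finite metric graph and let $B=\{v_1,\dots,v_m\}\subset V$ be a set of vertices containing all boundary vertices and all proper core vertices of $G$. Let $\lambda>0$, let $G_\lambda$ be the subgraph of $G$ consisting of all edges whose lengths are natural multiples of $\pi/\sqrt{\lambda}$, and let $\beta_0^{\rm odd}(G_\lambda)$ be the number of connected components of $G_\lambda$ containing a cycle with odd length with respect to $\pi/\sqrt\lambda$. Then: (i) If $\beta_1(G_\lambda)=\beta_0^{\rm odd}(G_\lambda)$, then $\lambda$ is an eigenvalue of $-\Delta_G$ if and only if $\lambda$ is a pole of $M_B$, and $\dim\ker(-\Delta_G-\lambda)=\operatorname{rank}\operatorname{Res}_\lambda M_B$. (ii) If $\beta_1(G_\lambda)>\beta_0^{\rm odd}(G_\lambda)$, then $\lambda$ is an eigenvalue of $-\Delta_G$ and $$\dim\ker(-\Delta_G-\lambda)=\operatorname{rank}\operatorname{Res}_\lambda M_B+\beta_1(G_\lambda)-\beta_0^{\rm odd}(G_\lambda).$$ In particular, in this case $\lambda$ is a pole of $M_B$ if and only if $\dim\ker(-\Delta_G-\lambda)>\beta_1(G_\lambda)-\beta_0^{\rm odd}(G_\lambda)$.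
   Context: A finite metric graph $G$ has finite vertex set $V$ and finite edge set $E$ (loops and multiple edges allowed) with lengths $L:E\to(0,\infty)$, each edge $e$ identified with $[0,L(e)]$, whose endpoints are identified with the vertices $o(e)$ and $t(e)$. For edgewise-$H^2$ functions $f$ continuous at each vertex (common value $f(v)$), set $\partial_\nu f(v)=\sum_{t(e)=v} f_e'(L(e)) - \sum_{o(e)=v} f_e'(0)$. The Kirchhoff Laplacian $-\Delta_G$ in $L^2(G)$ acts as $-f_e''$ on each edge with domain the edgewise-$H^2$ functions continuous at each vertex with $\partial_\nu f(v)=0$ for all $v\in V$; it is self-adjoint with discrete spectrum $\sigma(-\Delta_G)$. Titchmarsh–Weyl matrix: for $\mu\in\mathbb{C}\setminus\sigma(-\Delta_G)$ and $l=1,\dots,m$, let $f^{(l)}$ be the (unique) edgewise-$H^2$ function continuous at all vertices with $-f_e^{(l)\prime\prime}=\mu f_e^{(l)}$ on every edge, $\partial_\nu f^{(l)}(v_l)=1$ and $\partial_\nu f^{(l)}(v)=0$ for $v\in V\setminus\{v_l\}$; then $M_B(\mu)\in\mathbb{C}^{m\times m}$ has entries $(M_B(\mu))_{k,l}=f^{(l)}(v_k)$. The function $\mu\mapsto M_B(\mu)$ is meromorphic on $\mathbb{C}$. For such a matrix function $R$, $\operatorname{Res}_\lambda R=\frac{1}{2\pi i}\int_\Gamma R(\mu)\,d\mu$ for a small closed Jordan curve $\Gamma$ surrounding $\lambda$ and no other singularity; $\lambda$ is a pole of $R$ iff $\operatorname{rank}\operatorname{Res}_\lambda R>0$ (poles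 of $M_B$ are of order one). The core of $G$ is its largest subgraph without vertices of degree one; a boundary vertex is a vertex of degree one; a proper core vertex is a vertex all of whose attached edges belong to the core. For a finite graph $H$, $\beta_1(H)=|E(H)|-|V(H)|+\beta_0(H)$, $\beta_0(H)$ being the number of connected components. A cycle has odd length with respect to $x>0$ if its total length is an odd multiple of $x$. *)

theory Defs
  imports "HOL-Analysis.Analysis" "HOL-Library.Function_Algebras" "Jordan_Normal_Form.DL_Rank"
begin

text \<open>A finite metric graph is given by a vertex set V, an edge set E, origin and terminal
maps org, trm (loops and multiple edges allowed) and edge lengths L.
Functions on the graph are represented as f :: 'e => real => complex, f e being the
function on edge e identified with [0, L e]; they are required to vanish outside the
edges (so that they are genuine elements of the function space on G).\<close>

definition metric_graph :: "'v set \<Rightarrow> 'e set \<Rightarrow> ('e \<Rightarrow> 'v) \<Rightarrow> ('e \<Rightarrow> 'v) \<Rightarrow> ('e \<Rightarrow> real) \<Rightarrow> bool" where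
  "metric_graph V E org trm L \<longleftrightarrow> finite V \<and> finite E \<and>
     (\<forall>e\<in>E. org e \<in> V \<and> trm e \<in> V \<and> L e > 0)"

definition supported_on_graph :: "'e set \<Rightarrow> ('e \<Rightarrow> real) \<Rightarrow> ('e \<Rightarrow> real \<Rightarrow> complex) \<Rightarrow> bool" where
  "supported_on_graph E L f \<longleftrightarrow> (\<forall>e x. (e \<notin> E \<or> x \<notin> {0..L e}) \<longrightarrow> f e x = 0)"

definition edge_solution :: "real \<Rightarrow> complex \<Rightarrow> (real \<Rightarrow> complex) \<Rightarrow> bool" where
  "edge_solution l mu u \<longleftrightarrow> (\<exists>u1 u2. \<forall>x\<in>{0..l}.
      (u has_vector_derivative u1 x) (at x within {0..l}) \<and>
      (u1 has_vector_derivative u2 x) (at x within {0..l}) \<and>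
      - u2 x = mu * u x)"

definition continuous_at_vertices :: "'e set \<Rightarrow> ('e \<Rightarrow> 'v) \<Rightarrow> ('e \<Rightarrow> 'v) \<Rightarrow> ('e \<Rightarrow> real) \<Rightarrow> ('e \<Rightarrow> real \<Rightarrow> complex) \<Rightarrow> bool" where
  "continuous_at_vertices E org trm L f \<longleftrightarrow>
     (\<exists>phi. \<forall>e\<in>E. f e 0 = phi (org e) \<and> f e (L e) = phi (trm e))"

text \<open>The common value f(v) at a vertex v (meaningful for continuous f and v incident to an edge).\<close>
definition vertex_value :: "'e set \<Rightarrow> ('e \<Rightarrow> 'v) \<Rightarrow> ('e \<Rightarrow> 'v) \<Rightarrow> ('e \<Rightarrow> real) \<Rightarrow> ('e \<Rightarrow> real \<Rightarrow> complex) \<Rightarrow> 'v \<Rightarrow> complex" where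
  "vertex_value E org trm L f v =
     (THE c. \<forall>e\<in>E. (org e = v \<longrightarrow> f e 0 = c) \<and> (trm e = v \<longrightarrow> f e (L e) = c))"

definition normal_derivative :: "'e set \<Rightarrow> ('e \<Rightarrow> 'v) \<Rightarrow> ('e \<Rightarrow> 'v) \<Rightarrow> ('e \<Rightarrow> real) \<Rightarrow> ('e \<Rightarrow> real \<Rightarrow> complex) \<Rightarrow> 'v \<Rightarrow> complex" where
  "normal_derivative E org trm L f v =
     (\<Sum>e\<in>{e\<in>E. trm e = v}. vector_derivative (f e) (at (L e) within {0..L e}))
   - (\<Sum>e\<in>{e\<in>E. org e = v}. vector_derivative (f e) (at 0 within {0..L e}))"

definition graph_solutions :: "'v set \<Rightarrow> 'e set \<Rightarrow> ('e \<Rightarrow> 'v) \<Rightarrow> ('e \<Rightarrow> 'v) \<Rightarrow> ('e \<Rightarrow> real) \<Rightarrow> complex \<Rightarrow> ('e \<Rightarrow> real \<Rightarrow> complex) set" where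
  "graph_solutions V E org trm L mu =
     {f. supported_on_graph E L f \<and> (\<forall>e\<in>E. edge_solution (L e) mu (f e)) \<and>
         continuous_at_vertices E org trm L f}"

definition kirchhoff_eigenspace :: "'v set \<Rightarrow> 'e set \<Rightarrow> ('e \<Rightarrow> 'v) \<Rightarrow> ('e \<Rightarrow> 'v) \<Rightarrow> ('e \<Rightarrow> real) \<Rightarrow> complex \<Rightarrow> ('e \<Rightarrow> real \<Rightarrow> complex) set" where
  "kirchhoff_eigenspace V E org trm L mu =
     {f \<in> graph_solutions V E org trm L mu. \<forall>v\<in>V. normal_derivative E org trm L f v = 0}"

definition is_kirchhoff_eigenvalue :: "'v set \<Rightarrow> 'e set \<Rightarrow> ('e \<Rightarrow> 'v) \<Rightarrow> ('e \<Rightarrow> 'v) \<Rightarrow> ('e \<Rightarrow> real) \<Rightarrow> complex \<Rightarrow> bool" where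
  "is_kirchhoff_eigenvalue V E org trm L mu \<longleftrightarrow>
     (\<exists>f\<in>kirchhoff_eigenspace V E org trm L mu. f \<noteq> 0)"

definition cdim :: "('e \<Rightarrow> real \<Rightarrow> complex) set \<Rightarrow> nat" where
  "cdim S = vector_space.dim (\<lambda>(c::complex) f. (\<lambda>e x. c * f e x)) S"

definition tw_solution :: "'v set \<Rightarrow> 'e set \<Rightarrow> ('e \<Rightarrow> 'v) \<Rightarrow> ('e \<Rightarrow> 'v) \<Rightarrow> ('e \<Rightarrow> real) \<Rightarrow> 'v \<Rightarrow> complex \<Rightarrow> ('e \<Rightarrow> real \<Rightarrow> complex) \<Rightarrow> bool" where
  "tw_solution V E org trm L w mu f \<longleftrightarrow> f \<in> graph_solutions V E org trm L mu \<and>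
     normal_derivative E org trm L f w = 1 \<and>
     (\<forall>v\<in>V - {w}. normal_derivative E org trm L f v = 0)"

definition tw_matrix :: "'v set \<Rightarrow> 'e set \<Rightarrow> ('e \<Rightarrow> 'v) \<Rightarrow> ('e \<Rightarrow> 'v) \<Rightarrow> ('e \<Rightarrow> real) \<Rightarrow> 'v list \<Rightarrow> complex \<Rightarrow> complex mat" where
  "tw_matrix V E org trm L vs mu = mat (length vs) (length vs)
     (\<lambda>(k, l). vertex_value E org trm L (THE f. tw_solution V E org trm L (vs ! l) mu f) (vs ! k))"

text \<open>Residue via the contour integral over a small circle around lam:
  (1/(2 pi i)) \<integral>_{|mu - lam| = r} R(mu) dmu, computed entrywise with the parametrisation
  mu = lam + r exp(2 pi i s), s \<in> [0,1], for a radius r such that R is holomorphic on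
  a punctured disc around lam containing the circle.\<close>
definition circle_residue :: "(complex \<Rightarrow> complex) \<Rightarrow> complex \<Rightarrow> real \<Rightarrow> complex" where
  "circle_residue g lam r = integral {0..1::real}
     (\<lambda>s. g (lam + complex_of_real r * exp (2 * pi * \<i> * complex_of_real s)) *
          complex_of_real r * exp (2 * pi * \<i> * complex_of_real s))"

definition mat_residue :: "nat \<Rightarrow> complex \<Rightarrow> (complex \<Rightarrow> complex mat) \<Rightarrow> complex mat" where
  "mat_residue m lam R = (THE A. A \<in> carrier_mat m m \<and> (\<exists>r r'. 0 < r \<and> r < r' \<and>
      (\<forall>k<m. \<forall>l<m. (\<lambda>mu. R mu $$ (k, l)) holomorphic_on (ball lam r' - {lam})) \<and>
      (\<forall>k<m. \<forall>l<m. A $$ (k, l) = circle_residue (\<lambda>mu. R mu $$ (k, l)) lam r)))"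

definition mat_rank :: "complex mat \<Rightarrow> nat" where
  "mat_rank A = vec_space.rank (dim_row A) A"

definition mat_is_pole :: "nat \<Rightarrow> complex \<Rightarrow> (complex \<Rightarrow> complex mat) \<Rightarrow> bool" where
  "mat_is_pole m lam R \<longleftrightarrow> (\<exists>k<m. \<exists>l<m. filterlim (\<lambda>mu. R mu $$ (k, l)) at_infinity (at lam))"

definition connects :: "('e \<Rightarrow> 'v) \<Rightarrow> ('e \<Rightarrow> 'v) \<Rightarrow> 'e \<Rightarrow> 'v \<Rightarrow> 'v \<Rightarrow> bool" where
  "connects org trm e a b \<longleftrightarrow> (org e = a \<and> trm e = b) \<or> (org e = b \<and> trm e = a)"

definition degree :: "'e set \<Rightarrow> ('e \<Rightarrow> 'v) \<Rightarrow> ('e \<Rightarrow> 'v) \<Rightarrow> 'v \<Rightarrow> nat" where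
  "degree F org trm v = card {e\<in>F. org e = v} + card {e\<in>F. trm e = v}"

text \<open>Edges of the core: union of all edge sets F \<subseteq> E whose spanned subgraph has no vertex of degree one
  (this union is itself such, hence the largest one).\<close>
definition core_edges :: "'e set \<Rightarrow> ('e \<Rightarrow> 'v) \<Rightarrow> ('e \<Rightarrow> 'v) \<Rightarrow> 'e set" where
  "core_edges E org trm = \<Union>{F. F \<subseteq> E \<and> (\<forall>v. degree F org trm v \<noteq> 1)}"

definition boundary_vertices :: "'v set \<Rightarrow> 'e set \<Rightarrow> ('e \<Rightarrow> 'v) \<Rightarrow> ('e \<Rightarrow> 'v) \<Rightarrow> 'v set" where
  "boundary_vertices V E org trm = {v\<in>V. degree E org trm v = 1}"

definition proper_core_vertices :: "'v set \<Rightarrow> 'e set \<Rightarrow> ('e \<Rightarrow> 'v) \<Rightarrow> ('e \<Rightarrow> 'v) \<Rightarrow> 'v set" where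
  "proper_core_vertices V E org trm =
     {v\<in>V. (\<exists>e\<in>core_edges E org trm. org e = v \<or> trm e = v) \<and>
           (\<forall>e\<in>E. (org e = v \<or> trm e = v) \<longrightarrow> e \<in> core_edges E org trm)}"

definition span_vertices :: "'e set \<Rightarrow> ('e \<Rightarrow> 'v) \<Rightarrow> ('e \<Rightarrow> 'v) \<Rightarrow> 'v set" where
  "span_vertices F org trm = org ` F \<union> trm ` F"

definition adj_rel :: "'e set \<Rightarrow> ('e \<Rightarrow> 'v) \<Rightarrow> ('e \<Rightarrow> 'v) \<Rightarrow> ('v \<times> 'v) set" where
  "adj_rel F org trm = {(a, b). \<exists>e\<in>F. connects org trm e a b}"

definition components :: "'v set \<Rightarrow> 'e set \<Rightarrow> ('e \<Rightarrow> 'v) \<Rightarrow> ('e \<Rightarrow> 'v) \<Rightarrow> 'v set set" where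
  "components W F org trm = W // (Id_on W \<union> (adj_rel F org trm)\<^sup>+)"

definition beta0 :: "'v set \<Rightarrow> 'e set \<Rightarrow> ('e \<Rightarrow> 'v) \<Rightarrow> ('e \<Rightarrow> 'v) \<Rightarrow> nat" where
  "beta0 W F org trm = card (components W F org trm)"

definition beta1 :: "'v set \<Rightarrow> 'e set \<Rightarrow> ('e \<Rightarrow> 'v) \<Rightarrow> ('e \<Rightarrow> 'v) \<Rightarrow> int" where
  "beta1 W F org trm = int (card F) - int (card W) + int (beta0 W F org trm)"

definition is_cycle :: "'e set \<Rightarrow> ('e \<Rightarrow> 'v) \<Rightarrow> ('e \<Rightarrow> 'v) \<Rightarrow> 'e list \<Rightarrow> 'v list \<Rightarrow> bool" where
  "is_cycle F org trm es ws \<longleftrightarrow> es \<noteq> [] \<and> length ws = length es \<and> distinct es \<and> distinct ws \<and>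
     set es \<subseteq> F \<and>
     (\<forall>i<length es. connects org trm (es ! i) (ws ! i) (ws ! ((i + 1) mod length es)))"

definition cycle_length :: "('e \<Rightarrow> real) \<Rightarrow> 'e list \<Rightarrow> real" where
  "cycle_length L es = (\<Sum>e\<leftarrow>es. L e)"

definition odd_length :: "real \<Rightarrow> real \<Rightarrow> bool" where
  "odd_length x len \<longleftrightarrow> (\<exists>k::nat. odd k \<and> len = real k * x)"

definition beta0_odd :: "'v set \<Rightarrow> 'e set \<Rightarrow> ('e \<Rightarrow> 'v) \<Rightarrow> ('e \<Rightarrow> 'v) \<Rightarrow> ('e \<Rightarrow> real) \<Rightarrow> real \<Rightarrow> nat" where
  "beta0_odd W F org trm L x = card {C \<in> components W F org trm.
      \<exists>es ws. is_cycle F org trm es ws \<and> set ws \<subseteq> C \<and> odd_length x (cycle_length L es)}"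

definition lambda_edges :: "'e set \<Rightarrow> ('e \<Rightarrow> real) \<Rightarrow> real \<Rightarrow> 'e set" where
  "lambda_edges E L lam = {e\<in>E. \<exists>k::nat. L e = real k * (pi / sqrt lam)}"

end

(* Near lam the Titchmarsh-Weyl matrix has a simple pole whose residue is minus the Gram matrix
   of the evaluations at the vertices of B on the eigenspace, so its rank is the codimension in
   the eigenspace of the eigenfunctions vanishing on B. Simplicity of the pole and the Gram
   structure come from Green's identity, which pairs a solution at mu with an eigenfunction at lam.
   An eigenfunction vanishing on B is zero on every edge outside the core (a vertex of degree
   one in the set of edges where it is nonzero is ruled out), hence at all vertices; so it is a
   multiple c e * sin (sqrt lam * x) on each edge of G_lam, and the Kirchhoff conditions say that
   c lies in the kernel of the incidence matrix of G_lam with signs cos (sqrt lam * L e). The left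
   kernel of this matrix has one dimension for each component in which every cycle has even length. *)
theory Submission
  imports Defs "HOL-Complex_Analysis.Complex_Analysis"
begin

text \<open>Both dimension counts come from one fact, that the left and right ranks of a bilinear
  pairing agree (\<open>bilinear_rank_eq\<close>): once for eigenfunctions against coefficient
  vectors on independent columns of the residue, once for edgewise sines against vertex functions.
  Solutions at mu are encoded by finitely many numbers, so the boundary value problem becomes a
  square linear system, holomorphic for Re mu > 0; this half plane avoids the branch cut of the
  square root and is stable under conjugation. Green's identity makes the system injective at
  nonreal mu, so its determinant is not identically zero and a zero at lam has finite order.
  Cramer's rule bounds the order of the pole only by the order of that zero; but as long as the
  order exceeds one, the leading coefficient is an eigenfunction that pairs to zero with every
  eigenfunction, in particular with its own conjugate, and hence vanishes. An edge of G_lam gets the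
  sign 1 or -1 by the parity of its length in units of pi / sqrt lam, so odd cycles are the cycles
  of sign -1 in a signed graph.\<close>

unbundle no vec_syntax

subsection \<open>Ranks of bilinear pairings\<close>

context vector_space
begin

lemma finite_basis_exists:
  assumes "finite B" "S \<subseteq> span B"
  obtains C where "C \<subseteq> S" "independent C" "S \<subseteq> span C" "card C = dim S" "finite C"
proof -
  obtain C where C: "C \<subseteq> S" "independent C" "S \<subseteq> span C" "card C = dim S"
    using basis_exists[of S] by metis
  have "finite C"
    using independent_span_bound[OF assms(1) C(2)] C(1) assms(2) by blast
  with C that show ?thesis by blast
qed

text \<open>A vector outside the kernel and a basis of the kernel together span S. Linearity is
  asked only on S, because the functionals met later are built from \<open>vertex_value\<close> and
  derivatives and are shown to be linear only on solutions.\<close>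

lemma dim_kernel_functional:
  assumes S: "subspace S" and B: "finite B" "S \<subseteq> span B"
    and add: "\<And>x y. x \<in> S \<Longrightarrow> y \<in> S \<Longrightarrow> f (x + y) = f x + f y"
    and scl: "\<And>c x. x \<in> S \<Longrightarrow> f (scale c x) = c * f x"
  shows "dim S \<le> dim {x \<in> S. f x = 0} + 1"
proof -
  let ?N = "{x \<in> S. f x = 0}"
  obtain C where C: "C \<subseteq> ?N" "independent C" "?N \<subseteq> span C" "card C = dim ?N" "finite C"
    using finite_basis_exists[of B ?N] B by blast
  show ?thesis
  proof (cases "\<exists>s\<in>S. f s \<noteq> 0")
    case False
    then have "?N = S" by auto
    then show ?thesis by simp
  next
    case True
    then obtain s where s: "s \<in> S" "f s \<noteq> 0" by blast
    have "S \<subseteq> span (insert s C)"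
    proof
      fix x assume x: "x \<in> S"
      \<comment> \<open>This multiple of s moves x into the kernel of f.\<close>
      define k where "k = - (f x / f s)"
      have "scale k s \<in> S" using S s(1) by (rule subspace_scale)
      then have "x + scale k s \<in> ?N"
        using subspace_add[OF S x] add[OF x, of "scale k s"] scl[OF s(1), of k] s(2)
        by (simp add: k_def del: scale_minus_left)
      then have "x + scale k s \<in> span (insert s C)"
        using C(3) span_mono[of C "insert s C"] by blast
      moreover have "scale k s \<in> span (insert s C)"
        by (intro span_scale span_base) simp
      ultimately have "(x + scale k s) - scale k s \<in> span (insert s C)"
        by (rule span_diff)
      then show "x \<in> span (insert s C)" by simp
    qed
    then have "dim S \<le> card (insert s C)"
      using C(5) by (intro dim_le_card) auto
    also have "\<dots> \<le> card C + 1" using C(5) by (simp add: card_insert_if)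
    finally show ?thesis using C(4) by simp
  qed
qed

lemma dim_common_kernel:
  assumes S: "subspace S" and B: "finite B" "S \<subseteq> span B"
    and add: "\<And>q x y. q \<in> Q \<Longrightarrow> x \<in> S \<Longrightarrow> y \<in> S \<Longrightarrow> f q (x + y) = f q x + f q y"
    and scl: "\<And>q c x. q \<in> Q \<Longrightarrow> x \<in> S \<Longrightarrow> f q (scale c x) = c * f q x"
    and "finite Q"
  shows "dim S \<le> dim {x \<in> S. \<forall>q\<in>Q. f q x = 0} + card Q"
  using \<open>finite Q\<close> add scl
proof (induction Q)
  case empty
  then show ?case by simp
next
  case (insert q Q)
  let ?N = "{x \<in> S. \<forall>q\<in>Q. f q x = 0}"
  have zero: "f p 0 = 0" if "p \<in> insert q Q" for p
    using insert.prems(2)[OF that, of 0 0] S by (simp add: subspace_0)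
  have N: "subspace ?N"
    using S zero insert.prems unfolding subspace_def by simp
  have "dim ?N \<le> dim {x \<in> ?N. f q x = 0} + 1"
    using insert.prems B by (intro dim_kernel_functional[OF N B(1)]) auto
  moreover have "{x \<in> ?N. f q x = 0} = {x \<in> S. \<forall>p\<in>insert q Q. f p x = 0}" by auto
  moreover have "dim S \<le> dim ?N + card Q"
    using insert.prems by (intro insert.IH) auto
  ultimately show ?case using insert.hyps by simp
qed

lemma independent_family:
  assumes I: "finite I"
    and ind: "\<And>c i. (\<Sum>i\<in>I. scale (c i) (u i)) = 0 \<Longrightarrow> i \<in> I \<Longrightarrow> c i = 0"
  shows "inj_on u I" "independent (u ` I)"
proof -
  show inj: "inj_on u I"
  proof (rule inj_onI)
    fix i j assume ij: "i \<in> I" "j \<in> I" "u i = u j"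
    show "i = j"
    proof (rule ccontr)
      assume ne: "i \<noteq> j"
      \<comment> \<open>If u i = u j, the relation u i - u j = 0 contradicts the hypothesis;
        injectivity is thus part of the independence of a family.\<close>
      define c where "c = (\<lambda>k. if k = i then 1 else if k = j then - 1 else (0::'a))"
      have "(\<Sum>k\<in>I. scale (c k) (u k)) = (\<Sum>k\<in>{i, j}. scale (c k) (u k))"
        using ij I by (intro sum.mono_neutral_right) (auto simp: c_def)
      also have "\<dots> = 0" using ne ij by (simp add: c_def)
      finally have "c i = 0" using ind ij by blast
      then show False by (simp add: c_def)
    qed
  qed
  show "independent (u ` I)"
  proof (rule independent_if_scalars_zero)
    fix f x assume *: "(\<Sum>x\<in>u ` I. scale (f x) x) = 0" "x \<in> u ` I"
    then obtain i where "i \<in> I" "x = u i" by blast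
    moreover have "(\<Sum>i\<in>I. scale (f (u i)) (u i)) = 0"
      using *(1) inj by (simp add: sum.reindex)
    ultimately show "f x = 0" using ind[of "\<lambda>i. f (u i)"] by blast
  qed (use I in simp)
qed

lemma span_family:
  assumes I: "finite I"
  shows "(\<Sum>i\<in>I. scale (c i) (u i)) \<in> span (u ` I)"
  by (intro span_sum span_scale span_base) simp

lemma subspace_family: "subspace {\<Sum>i\<in>I. scale (c i) (u i) | c. True}"
  unfolding subspace_def
proof (intro conjI ballI allI)
  show "0 \<in> {\<Sum>i\<in>I. scale (c i) (u i) | c. True}"
    by (auto intro!: exI[of _ "\<lambda>_. 0"])
next
  fix x y assume "x \<in> {\<Sum>i\<in>I. scale (c i) (u i) | c. True}" "y \<in> {\<Sum>i\<in>I. scale (c i) (u i) | c. True}"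
  then obtain c d where "x = (\<Sum>i\<in>I. scale (c i) (u i))" "y = (\<Sum>i\<in>I. scale (d i) (u i))" by blast
  then have "x + y = (\<Sum>i\<in>I. scale (c i + d i) (u i))"
    by (simp add: scale_left_distrib sum.distrib)
  then show "x + y \<in> {\<Sum>i\<in>I. scale (c i) (u i) | c. True}"
    by (intro CollectI exI[of _ "\<lambda>i. c i + d i"]) simp
next
  fix k x assume "x \<in> {\<Sum>i\<in>I. scale (c i) (u i) | c. True}"
  then obtain c where "x = (\<Sum>i\<in>I. scale (c i) (u i))" by blast
  then have "scale k x = (\<Sum>i\<in>I. scale (k * c i) (u i))"
    by (simp add: scale_sum_right)
  then show "scale k x \<in> {\<Sum>i\<in>I. scale (c i) (u i) | c. True}"
    by (intro CollectI exI[of _ "\<lambda>i. k * c i"]) simp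
qed

lemma dim_family:
  assumes I: "finite I"
    and ind: "\<And>c i. (\<Sum>i\<in>I. scale (c i) (u i)) = 0 \<Longrightarrow> i \<in> I \<Longrightarrow> c i = 0"
  shows "dim {\<Sum>i\<in>I. scale (c i) (u i) | c. True} = card I"
proof -
  have *: "inj_on u I" "independent (u ` I)"
    using independent_family[of I u] assms by blast+
  have "u i \<in> {\<Sum>i\<in>I. scale (c i) (u i) | c. True}" if "i \<in> I" for i
  proof -
    have "(\<Sum>j\<in>I. scale (if j = i then 1 else 0) (u j)) = (\<Sum>j\<in>{i}. u j)"
      using I that by (intro sum.mono_neutral_cong_right) auto
    then have "u i = (\<Sum>j\<in>I. scale (if j = i then 1 else 0) (u j))" by simp
    then show ?thesis by (intro CollectI exI[of _ "\<lambda>j. if j = i then 1 else 0"]) simp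
  qed
  moreover have "{\<Sum>i\<in>I. scale (c i) (u i) | c. True} \<subseteq> span (u ` I)"
    using span_family[OF I] by auto
  ultimately have "card (u ` I) = dim {\<Sum>i\<in>I. scale (c i) (u i) | c. True}"
    using *(2) by (intro basis_card_eq_dim) auto
  then show ?thesis using card_image[OF *(1)] by simp
qed

end

context vector_space_pair
begin

text \<open>Extend a basis C0 of the right kernel to a basis C1 of Y. The vectors of C0 put no
  condition on X, so the left kernel is cut out by the functionals from C1 - C0, each of which
  lowers the dimension by at most one.\<close>

lemma bilinear_rank_le:
  assumes X: "vs1.subspace X" "finite B" "X \<subseteq> vs1.span B"
    and Y: "vs2.subspace Y" "finite C" "Y \<subseteq> vs2.span C"
    and addl: "\<And>x x' y. x \<in> X \<Longrightarrow> x' \<in> X \<Longrightarrow> y \<in> Y \<Longrightarrow> b (x + x') y = b x y + b x' y"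
    and scll: "\<And>k x y. x \<in> X \<Longrightarrow> y \<in> Y \<Longrightarrow> b (s1 k x) y = k * b x y"
    and addr: "\<And>x y y'. x \<in> X \<Longrightarrow> y \<in> Y \<Longrightarrow> y' \<in> Y \<Longrightarrow> b x (y + y') = b x y + b x y'"
    and sclr: "\<And>k x y. x \<in> X \<Longrightarrow> y \<in> Y \<Longrightarrow> b x (s2 k y) = k * b x y"
  shows "vs1.dim X + vs2.dim {y \<in> Y. \<forall>x\<in>X. b x y = 0}
    \<le> vs2.dim Y + vs1.dim {x \<in> X. \<forall>y\<in>Y. b x y = 0}"
proof -
  let ?Y0 = "{y \<in> Y. \<forall>x\<in>X. b x y = 0}"
  obtain C0 where C0: "C0 \<subseteq> ?Y0" "vs2.independent C0" "?Y0 \<subseteq> vs2.span C0"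
    "card C0 = vs2.dim ?Y0" "finite C0"
    using vs2.finite_basis_exists[of C ?Y0] Y by blast
  obtain C1 where C1: "C0 \<subseteq> C1" "C1 \<subseteq> Y" "vs2.independent C1" "Y \<subseteq> vs2.span C1"
    using vs2.maximal_independent_subset_extend[of C0 Y] C0(1,2) by blast
  have fin1: "finite C1"
    using vs2.independent_span_bound[OF Y(2) C1(3)] C1(2) Y(3) by blast
  have card1: "card C1 = vs2.dim Y"
    using C1 by (intro vs2.basis_card_eq_dim) auto
  have "{x \<in> X. \<forall>q\<in>C1 - C0. b x q = 0} = {x \<in> X. \<forall>y\<in>Y. b x y = 0}"
  proof (intro Collect_cong conj_cong refl iffI)
    fix x assume x: "x \<in> X" and q: "\<forall>q\<in>C1 - C0. b x q = 0"
    have z: "b x 0 = 0" using sclr[OF x vs2.subspace_0[OF Y(1)], of 0] by simp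
    have "vs2.subspace {y \<in> Y. b x y = 0}"
      using Y(1) x addr sclr z unfolding vs2.subspace_def by simp
    moreover have "C1 \<subseteq> {y \<in> Y. b x y = 0}" using q C0(1) C1(2) x by auto
    ultimately have "vs2.span C1 \<subseteq> {y \<in> Y. b x y = 0}" by (intro vs2.span_minimal)
    then show "\<forall>y\<in>Y. b x y = 0" using C1(4) by auto
  qed (use C1 in auto)
  moreover have "vs1.dim X \<le> vs1.dim {x \<in> X. \<forall>q\<in>C1 - C0. b x q = 0} + card (C1 - C0)"
    using C1(2) addl scll fin1
    by (intro vs1.dim_common_kernel[OF X(1-3), where f = "\<lambda>q x. b x q"]) auto
  moreover have "card (C1 - C0) + card C0 = card C1"
    using C1(1) fin1 by (metis card_Diff_subset card_mono finite_subset le_add_diff_inverse2)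
  ultimately show ?thesis using card1 C0(4) by simp
qed

end

text \<open>Exchanging the two spaces gives the reverse inequality. Equivalently, dim X minus the
  dimension of the left kernel and dim Y minus that of the right kernel agree, both being the rank
  of b.\<close>

lemma (in vector_space_pair) bilinear_rank_eq:
  assumes X: "vs1.subspace X" "finite B" "X \<subseteq> vs1.span B"
    and Y: "vs2.subspace Y" "finite C" "Y \<subseteq> vs2.span C"
    and addl: "\<And>x x' y. x \<in> X \<Longrightarrow> x' \<in> X \<Longrightarrow> y \<in> Y \<Longrightarrow> b (x + x') y = b x y + b x' y"
    and scll: "\<And>k x y. x \<in> X \<Longrightarrow> y \<in> Y \<Longrightarrow> b (s1 k x) y = k * b x y"
    and addr: "\<And>x y y'. x \<in> X \<Longrightarrow> y \<in> Y \<Longrightarrow> y' \<in> Y \<Longrightarrow> b x (y + y') = b x y + b x y'"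
    and sclr: "\<And>k x y. x \<in> X \<Longrightarrow> y \<in> Y \<Longrightarrow> b x (s2 k y) = k * b x y"
  shows "vs1.dim X + vs2.dim {y \<in> Y. \<forall>x\<in>X. b x y = 0}
    = vs2.dim Y + vs1.dim {x \<in> X. \<forall>y\<in>Y. b x y = 0}"
proof (rule antisym)
  interpret swap: vector_space_pair s2 s1 by unfold_locales
  show "vs2.dim Y + vs1.dim {x \<in> X. \<forall>y\<in>Y. b x y = 0}
    \<le> vs1.dim X + vs2.dim {y \<in> Y. \<forall>x\<in>X. b x y = 0}"
    using assms by (intro swap.bilinear_rank_le[of Y C X B "\<lambda>y x. b x y"]) auto
qed (rule bilinear_rank_le[of X B Y C b]; use assms in auto)

subsection \<open>Column rank\<close>

text \<open>Replaces the rank by a set J of column indices whose columns form a basis of the column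
  space. The last two conclusions are independence and spanning, phrased with entries so that later
  arguments use plain sums.\<close>

lemma mat_rank_columns:
  assumes A: "A \<in> carrier_mat n m"
  obtains J where "J \<subseteq> {..<m}" "mat_rank A = card J"
    "\<And>y j. \<forall>i<n. (\<Sum>j\<in>J. A $$ (i, j) * y j) = 0 \<Longrightarrow> j \<in> J \<Longrightarrow> y j = 0"
    "\<And>l. l < m \<Longrightarrow> \<exists>a. \<forall>i<n. A $$ (i, l) = (\<Sum>j\<in>J. A $$ (i, j) * a j)"
proof -
  interpret vec_space "TYPE(complex)" n .
  have cols: "set (cols A) \<subseteq> carrier_vec n" using cols_dim A by blast
  obtain S where S: "finite S" "maximal S (\<lambda>T. T \<subseteq> set (cols A) \<and> lin_indpt T)"
    using maximal_exists_superset[of "set (cols A)" "\<lambda>T. T \<subseteq> set (cols A) \<and> lin_indpt T" "{}"]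
      finite_lin_indpt2[of "{}"] by auto
  have S_sub: "S \<subseteq> set (cols A)" and S_ind: "lin_indpt S"
    using S(2) unfolding maximal_def by auto
  \<comment> \<open>Equal columns are one element of \<open>set (cols A)\<close>, so J picks one
    index for each vector of the maximal independent set S.\<close>
  have "S \<subseteq> col A ` {..<m}" using S_sub A by (auto simp: cols_def)
  then obtain J where J: "J \<subseteq> {..<m}" "inj_on (col A) J" "col A ` J = S"
    by (metis subset_image_inj)
  have entry: "col A j $ i = A $$ (i, j)" if "i < n" "j < m" for i j
    using that A by simp
  have lc: "lincomb f S $ i = (\<Sum>j\<in>J. A $$ (i, j) * f (col A j))" if "i < n" for f i
  proof -
    have "lincomb f S $ i = (\<Sum>x\<in>S. f x * x $ i)"
      using S_sub cols that by (intro lincomb_index) auto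
    also have "\<dots> = (\<Sum>j\<in>J. f (col A j) * col A j $ i)"
      using J by (metis (no_types, lifting) sum.reindex_cong)
    also have "\<dots> = (\<Sum>j\<in>J. A $$ (i, j) * f (col A j))"
      using J(1) that A by (intro sum.cong) (auto simp: mult.commute)
    finally show ?thesis .
  qed
  have carr: "S \<subseteq> carrier_vec n" using S_sub cols by blast
  show ?thesis
  proof (rule that[OF J(1)])
    show "mat_rank A = card J"
      using rank_card_indpt[OF A S(2)] card_image[OF J(2)] J(3) A
      by (simp add: mat_rank_def)
  next
    fix y j assume y: "\<forall>i<n. (\<Sum>j\<in>J. A $$ (i, j) * y j) = 0" and j: "j \<in> J"
    define f where "f = (\<lambda>x. y (the_inv_into J (col A) x))"
    have f: "f (col A j) = y j" if "j \<in> J" for j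
      using that J(2) by (simp add: f_def the_inv_into_f_f)
    have "lincomb f S = 0\<^sub>v n"
    proof (rule eq_vecI)
      show "dim_vec (lincomb f S) = dim_vec (0\<^sub>v n)"
        using lincomb_dim[OF S(1) carr] by simp
      fix i assume "i < dim_vec (0\<^sub>v n)"
      then have i: "i < n" by simp
      have "lincomb f S $ i = (\<Sum>j\<in>J. A $$ (i, j) * y j)"
        unfolding lc[OF i] by (intro sum.cong) (auto simp: f)
      then show "lincomb f S $ i = 0\<^sub>v n $ i" using y i by simp
    qed
    then have "f \<in> S \<rightarrow> {0}"
      using not_lindepD[OF S_ind S(1) subset_refl, of f] by auto
    moreover have "col A j \<in> S" using j J(3) by blast
    ultimately have "f (col A j) = 0" by (simp add: Pi_def)
    then show "y j = 0" using f[OF j] by simp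
  next
    fix l assume l: "l < m"
    show "\<exists>a. \<forall>i<n. A $$ (i, l) = (\<Sum>j\<in>J. A $$ (i, j) * a j)"
    proof (cases "col A l \<in> S")
      case True
      then obtain j where j: "j \<in> J" "col A j = col A l" using J(3) by (metis imageE)
      have "A $$ (i, l) = (\<Sum>k\<in>J. A $$ (i, k) * (if k = j then 1 else 0))" if "i < n" for i
      proof -
        have "(\<Sum>k\<in>J. A $$ (i, k) * (if k = j then 1 else 0)) = (\<Sum>k\<in>{j}. A $$ (i, k))"
          using j J(1) finite_subset[OF J(1)] by (intro sum.mono_neutral_cong_right) auto
        then show ?thesis using entry[OF that l] entry[OF that, of j] j J(1) by auto
      qed
      then show ?thesis by (intro exI[of _ "\<lambda>k. if k = j then 1 else 0"]) simp
    next
      case False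
      have cl: "col A l \<in> set (cols A)" using l A by (simp add: cols_def)
      have "lin_dep (S \<union> {col A l})"
      proof (rule ccontr)
        assume "\<not> ?thesis"
        then have "S \<union> {col A l} = S"
          using S(2) S_sub cl unfolding maximal_def by blast
        then show False using False by blast
      qed
      then have "col A l \<in> span S"
        using lin_dep_iff_in_span[of S "col A l"] carr S_ind False cl cols by auto
      then obtain f where "col A l = lincomb f S"
        using finite_span[OF S(1)] carr by auto
      then have "\<forall>i<n. A $$ (i, l) = (\<Sum>j\<in>J. A $$ (i, j) * f (col A j))"
        using lc entry l by metis
      then show ?thesis by (intro exI[of _ "\<lambda>j. f (col A j)"]) simp
    qed
  qed
qed

subsection \<open>Potentials on signed graphs\<close>

definition simple_path :: "'e set \<Rightarrow> ('e \<Rightarrow> 'v) \<Rightarrow> ('e \<Rightarrow> 'v) \<Rightarrow> 'e list \<Rightarrow> 'v list \<Rightarrow> bool" where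
  "simple_path F org trm es ws \<longleftrightarrow> length ws = Suc (length es) \<and> distinct ws \<and> set es \<subseteq> F \<and>
     (\<forall>i<length es. connects org trm (es ! i) (ws ! i) (ws ! Suc i))"

text \<open>Induct along the walk; if the next vertex already lies on the path, cut the path there,
  which keeps the vertices distinct.\<close>

lemma simple_path_exists:
  assumes "(a, b) \<in> (adj_rel F org trm)\<^sup>*"
  shows "\<exists>es ws. simple_path F org trm es ws \<and> ws ! 0 = a \<and> ws ! length es = b"
  using assms
proof (induction rule: rtrancl_induct)
  case base
  have "simple_path F org trm [] [a]" by (simp add: simple_path_def)
  then show ?case by (metis list.size(3) nth_Cons_0)
next
  case (step b c)
  then obtain es ws where p: "simple_path F org trm es ws" "ws ! 0 = a" "ws ! length es = b" by blast
  obtain e where e: "e \<in> F" "connects org trm e b c" using step.hyps by (auto simp: adj_rel_def)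
  show ?case
  proof (cases "c \<in> set ws")
    case False
    have "simple_path F org trm (es @ [e]) (ws @ [c])"
      using p e False by (auto simp: simple_path_def nth_append less_Suc_eq)
    moreover have "(ws @ [c]) ! 0 = a" "(ws @ [c]) ! length (es @ [e]) = c"
      using p by (auto simp: simple_path_def nth_append)
    ultimately show ?thesis by blast
  next
    case True
    then obtain k where k: "k < length ws" "ws ! k = c" by (metis in_set_conv_nth)
    have "simple_path F org trm (take k es) (take (Suc k) ws)"
      using p k by (auto simp: simple_path_def dest: in_set_takeD)
    moreover have "take (Suc k) ws ! 0 = a" "take (Suc k) ws ! length (take k es) = c"
      using p k by (auto simp: simple_path_def)
    ultimately show ?thesis by blast
  qed
qed

text \<open>Two occurrences of one edge would have the same pair of end vertices, which is
  impossible at different positions of a list of distinct vertices.\<close>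

lemma simple_path_distinct_edges:
  assumes "simple_path F org trm es ws"
  shows "distinct es"
  unfolding distinct_conv_nth
proof (intro allI impI)
  fix i j assume ij: "i < length es" "j < length es" "i \<noteq> j"
  show "es ! i \<noteq> es ! j"
  proof
    assume eq: "es ! i = es ! j"
    have "connects org trm (es ! i) (ws ! i) (ws ! Suc i)"
      "connects org trm (es ! i) (ws ! j) (ws ! Suc j)"
      using assms ij eq by (auto simp: simple_path_def)
    then have "ws ! i = ws ! j \<or> (ws ! i = ws ! Suc j \<and> ws ! Suc i = ws ! j)"
      by (auto simp: connects_def)
    moreover have "distinct ws" "length ws = Suc (length es)" using assms by (auto simp: simple_path_def)
    ultimately show False using ij by (auto simp: nth_eq_iff_index_eq)
  qed
qed

lemma adj_rel_sym: "sym (adj_rel F org trm)"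
  by (auto simp: sym_def adj_rel_def connects_def)

locale signed_graph =
  fixes org trm :: "'e \<Rightarrow> 'v" and s :: "'e \<Rightarrow> complex"
  assumes sign: "s e = 1 \<or> s e = - 1"
begin

text \<open>This is the left kernel of the signed incidence matrix, whose column for e has -1 at
  \<open>org e\<close> and \<open>s e\<close> at \<open>trm e\<close>, added up if e is a
  loop.\<close>

definition potential :: "'e set \<Rightarrow> ('v \<Rightarrow> complex) \<Rightarrow> bool" where
  "potential F y \<longleftrightarrow> (\<forall>e\<in>F. y (org e) = s e * y (trm e))"

lemma sign_sq [simp]: "s e * s e = 1"
  using sign[of e] by auto

lemma sign_cancel [simp]: "s e * (s e * z) = z"
  by (metis mult.assoc mult_1 sign_sq)

lemma prod_sign: "prod_list (map s es) = 1 \<or> prod_list (map s es) = - 1"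
proof (induction es)
  case (Cons e es)
  then show ?case using sign[of e] by auto
qed simp

text \<open>Since \<open>s e\<close> is its own inverse, the relation does not depend on the
  orientation of e.\<close>

lemma potential_connects:
  assumes "potential F y" "e \<in> F" "connects org trm e a b"
  shows "y a = s e * y b"
  using assms by (auto simp: potential_def connects_def)

text \<open>The walk is a function of its index rather than a list, so that closed walks can use
  indices modulo the length.\<close>

lemma potential_walk:
  assumes y: "potential F y" and es: "set es \<subseteq> F"
    and w: "\<And>i. i < length es \<Longrightarrow> connects org trm (es ! i) (w i) (w (Suc i))"
    and n: "n \<le> length es"
  shows "y (w 0) = prod_list (map s (take n es)) * y (w n)"
  using n
proof (induction n)
  case (Suc n)
  have "y (w n) = s (es ! n) * y (w (Suc n))"
    using Suc.prems es w by (intro potential_connects[OF y]) auto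
  then show ?case using Suc by (simp add: take_Suc_conv_app_nth)
qed simp

text \<open>Going once round the cycle multiplies the value by -1.\<close>

lemma potential_odd_cycle:
  assumes y: "potential F y" and cyc: "is_cycle F org trm es ws" and odd: "prod_list (map s es) = - 1"
  shows "y (ws ! 0) = 0"
proof -
  let ?w = "\<lambda>i. ws ! (i mod length es)"
  have "y (?w 0) = prod_list (map s (take (length es) es)) * y (?w (length es))"
    using cyc by (intro potential_walk[OF y]) (auto simp: is_cycle_def)
  then show ?thesis using odd by simp
qed

text \<open>Add the edges one by one. If the ends of the new edge e are already connected, the path
  between them closes to a cycle, whose sign 1 yields the missing equation; otherwise the potential
  may be rescaled on the component of \<open>trm e\<close> alone.\<close>

lemma potential_exists:
  assumes "finite F"
    and "\<And>es ws. is_cycle F org trm es ws \<Longrightarrow> prod_list (map s es) = 1"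
  shows "\<exists>y. (\<forall>v. y v = 1 \<or> y v = - 1) \<and> potential F y"
  using assms
proof (induction F)
  case empty
  show ?case by (intro exI[of _ "\<lambda>_. 1"]) (simp add: potential_def)
next
  case (insert e F)
  have "is_cycle (insert e F) org trm es ws" if "is_cycle F org trm es ws" for es ws
    using that by (auto simp: is_cycle_def)
  then obtain y where y: "\<And>v. y v = 1 \<or> y v = - 1" "potential F y"
    using insert.IH insert.prems by metis
  let ?R = "adj_rel F org trm"
  show ?case
  proof (cases "(trm e, org e) \<in> ?R\<^sup>*")
    case True
    then obtain es ws where p: "simple_path F org trm es ws" "ws ! 0 = trm e" "ws ! length es = org e"
      using simple_path_exists by metis
    have "Suc i mod Suc (length es) = Suc i" if "i < length es" for i
      using that by simp
    \<comment> \<open>The path runs from \<open>trm e\<close> to \<open>org e\<close>, so e as last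
      edge leads back to its start. For a loop the path is empty and the cycle has length
      one.\<close>
    then have "is_cycle (insert e F) org trm (es @ [e]) ws"
      using p simple_path_distinct_edges[OF p(1)] insert.hyps(2)
      by (auto simp: is_cycle_def simple_path_def nth_append connects_def less_Suc_eq)
    then have 1: "prod_list (map s es) * s e = 1"
      using insert.prems by force
    have "y (ws ! 0) = prod_list (map s (take (length es) es)) * y (ws ! length es)"
      using p(1) by (intro potential_walk[OF y(2)]) (auto simp: simple_path_def)
    then have "y (trm e) = prod_list (map s es) * y (org e)" using p by simp
    then have "s e * y (trm e) = (prod_list (map s es) * s e) * y (org e)" by simp
    then have "y (org e) = s e * y (trm e)" using 1 by simp
    then have "potential (insert e F) y" using y(2) by (auto simp: potential_def)
    then show ?thesis using y(1) by blast
  next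
    case False
    \<comment> \<open>With this factor the rescaled value t * y (trm e) equals s e * y (org e),
      because y (trm e) squares to 1.\<close>
    define t where "t = s e * y (org e) * y (trm e)"
    define z where "z = (\<lambda>v. if (trm e, v) \<in> ?R\<^sup>* then t * y v else y v)"
    have "y v * y v = 1" for v using y(1)[of v] by auto
    then have ez: "z (org e) = s e * z (trm e)"
      using False by (simp add: z_def t_def mult_ac)
    have "z (org f) = s f * z (trm f)" if f: "f \<in> F" for f
    proof -
      have "(org f, trm f) \<in> ?R" "(trm f, org f) \<in> ?R" using f by (auto simp: adj_rel_def connects_def)
      then have "(trm e, org f) \<in> ?R\<^sup>* \<longleftrightarrow> (trm e, trm f) \<in> ?R\<^sup>*"
        by (meson rtrancl.rtrancl_into_rtrancl)
      then show ?thesis using y(2) f by (simp add: z_def potential_def)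
    qed
    then have "potential (insert e F) z" using ez by (auto simp: potential_def)
    moreover have "z v = 1 \<or> z v = - 1" for v
      using y(1)[of v] y(1)[of "org e"] y(1)[of "trm e"] sign[of e] by (auto simp: z_def t_def)
    ultimately show ?thesis by blast
  qed
qed

lemma potential_reachable:
  assumes "potential F y" "(a, b) \<in> (adj_rel F org trm)\<^sup>*"
  shows "y a = 0 \<longleftrightarrow> y b = 0"
  using assms(2)
proof (induction rule: rtrancl_induct)
  case (step b c)
  then obtain e where "e \<in> F" "connects org trm e b c" by (auto simp: adj_rel_def)
  then have "y b = s e * y c" by (rule potential_connects[OF assms(1)])
  then show ?case using step sign[of e] by auto
qed simp

text \<open>Balance in the sense of signed graphs, for the cycles inside C. Signs of cycles being 1
  or -1, its failure means a cycle of sign -1.\<close>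

definition balanced :: "'e set \<Rightarrow> 'v set \<Rightarrow> bool" where
  "balanced F C \<longleftrightarrow> (\<forall>es ws. is_cycle F org trm es ws \<and> set ws \<subseteq> C \<longrightarrow> prod_list (map s es) = 1)"

end

lemma equiv_components:
  "equiv (span_vertices F org trm) (Id_on (span_vertices F org trm) \<union> (adj_rel F org trm)\<^sup>+)"
proof (rule equivI)
  let ?W = "span_vertices F org trm"
  have sub: "adj_rel F org trm \<subseteq> ?W \<times> ?W"
    by (auto simp: adj_rel_def connects_def span_vertices_def)
  show "Id_on ?W \<union> (adj_rel F org trm)\<^sup>+ \<subseteq> ?W \<times> ?W"
    using trancl_subset_Sigma[OF sub] by auto
  show "refl_on ?W (Id_on ?W \<union> (adj_rel F org trm)\<^sup>+)"
    by (auto simp: refl_on_def)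
  show "sym (Id_on ?W \<union> (adj_rel F org trm)\<^sup>+)"
    by (intro sym_Un sym_Id_on sym_trancl adj_rel_sym)
  show "trans (Id_on ?W \<union> (adj_rel F org trm)\<^sup>+)"
    by (auto simp: trans_def intro: trancl_trans)
qed

lemma vector_space_fun: "vector_space (\<lambda>(c::complex) y v. c * y v)"
  by unfold_locales (auto simp: algebra_simps fun_eq_iff)

context signed_graph
begin

text \<open>On a component a potential is determined by its value at one vertex. An unbalanced
  component forces it to vanish; a balanced one carries a potential with values 1 and -1, and these,
  extended by zero, form a basis.\<close>

lemma dim_potentials:
  assumes F: "finite F"
  defines "W \<equiv> span_vertices F org trm"
  shows "vector_space.dim (\<lambda>(c::complex) y v. c * y v) {y. (\<forall>v. v \<notin> W \<longrightarrow> y v = 0) \<and> potential F y}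
    = card {C \<in> components W F org trm. balanced F C}"
proof -
  interpret vector_space "\<lambda>(c::complex) (y :: 'v \<Rightarrow> complex) v. c * y v"
    by (rule vector_space_fun)
  let ?R = "adj_rel F org trm"
  define \<rho> where "\<rho> = Id_on W \<union> ?R\<^sup>+"
  have eq: "equiv W \<rho>" unfolding \<rho>_def W_def by (rule equiv_components)
  have comps: "components W F org trm = W // \<rho>" by (simp add: components_def \<rho>_def)
  have W: "finite W" using F by (simp add: W_def span_vertices_def)
  have "\<rho> \<subseteq> W \<times> W" using eq by (simp add: equiv_def)
  then have fin: "finite (W // \<rho>)" by (rule finite_quotient[OF W])
  have reach: "(a, b) \<in> ?R\<^sup>*" if "C \<in> W // \<rho>" "a \<in> C" "b \<in> C" for a b C
    using quotient_eq_iff[OF eq that(1) that(1) that(2,3)] by (auto simp: \<rho>_def dest: trancl_into_rtrancl)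
  have closed: "org e \<in> C \<longleftrightarrow> trm e \<in> C" if "C \<in> W // \<rho>" "e \<in> F" for e C
  proof -
    have "(org e, trm e) \<in> \<rho>" using that(2) by (auto simp: \<rho>_def adj_rel_def connects_def)
    then show ?thesis
      using in_quotient_imp_closed[OF eq that(1)] eq unfolding equiv_def sym_def by metis
  qed
  have sub: "C \<subseteq> W" if "C \<in> W // \<rho>" for C
    using that in_quotient_imp_subset[OF eq] by blast
  define bal where "bal = {C \<in> W // \<rho>. balanced F C}"
  \<comment> \<open>Only the edges of C may be used here, since only cycles inside C are known to
    have sign 1.\<close>
  have "\<exists>y. (\<forall>v. y v = 1 \<or> y v = - 1) \<and> potential {e \<in> F. org e \<in> C} y" if C: "C \<in> bal" for C
  proof (rule potential_exists)
    fix es ws assume cyc: "is_cycle {e \<in> F. org e \<in> C} org trm es ws"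
    then have "is_cycle F org trm es ws" by (auto simp: is_cycle_def)
    moreover have "set ws \<subseteq> C"
    proof
      fix v assume "v \<in> set ws"
      then obtain i where i: "i < length ws" "v = ws ! i" by (metis in_set_conv_nth)
      then have len: "i < length es" using cyc by (simp add: is_cycle_def)
      have "es ! i \<in> {e \<in> F. org e \<in> C}"
        using cyc nth_mem[OF len] unfolding is_cycle_def by blast
      moreover have "connects org trm (es ! i) v (ws ! ((i + 1) mod length es))"
        using cyc len i(2) unfolding is_cycle_def by blast
      ultimately show "v \<in> C" using closed[of C "es ! i"] C by (auto simp: connects_def bal_def)
    qed
    ultimately show "prod_list (map s es) = 1" using C by (auto simp: bal_def balanced_def)
  qed (use F in simp)
  then obtain \<sigma> where \<sigma>: "\<And>C v. C \<in> bal \<Longrightarrow> \<sigma> C v = 1 \<or> \<sigma> C v = - 1"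
    "\<And>C. C \<in> bal \<Longrightarrow> potential {e \<in> F. org e \<in> C} (\<sigma> C)" by metis
  define u where "u = (\<lambda>C v. if v \<in> C then \<sigma> C v else 0)"
  have app: "(\<Sum>C\<in>bal. (\<lambda>v. c C * u C v)) v = (\<Sum>C\<in>bal. c C * u C v)" for c v
    by (induction bal rule: infinite_finite_induct) auto
  have fin_bal: "finite bal" using fin by (simp add: bal_def)
  have disj: "C = D" if "C \<in> W // \<rho>" "D \<in> W // \<rho>" "v \<in> C" "v \<in> D" for C D v
    using quotient_disj[OF eq that(1,2)] that(3,4) by blast
  have single: "(\<Sum>D\<in>bal. c D * u D v) = c C * \<sigma> C v" if "C \<in> bal" "v \<in> C" for c C v
  proof -
    have "(\<Sum>D\<in>bal. c D * u D v) = (\<Sum>D\<in>{C}. c D * \<sigma> D v)"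
      using that disj fin_bal by (intro sum.mono_neutral_cong_right) (auto simp: u_def bal_def)
    then show ?thesis by simp
  qed
  have "{y. (\<forall>v. v \<notin> W \<longrightarrow> y v = 0) \<and> potential F y} = {\<Sum>C\<in>bal. (\<lambda>v. c C * u C v) | c. True}"
  proof (intro equalityI subsetI)
    fix y assume "y \<in> {y. (\<forall>v. v \<notin> W \<longrightarrow> y v = 0) \<and> potential F y}"
    then have y: "\<And>v. v \<notin> W \<Longrightarrow> y v = 0" "potential F y" by auto
    define r where "r = (\<lambda>C. SOME v. v \<in> (C :: 'v set))"
    have r: "r C \<in> C" if "C \<in> bal" for C
      using that in_quotient_imp_non_empty[OF eq, of C] unfolding r_def bal_def
      by (metis (mono_tags, lifting) mem_Collect_eq some_in_eq)
    \<comment> \<open>\<open>\<sigma> C (r C)\<close> is 1 or -1, hence its own inverse, so c C is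
      the ratio of y to \<open>\<sigma> C\<close> at the representative r C. This ratio is the same
      at all vertices of C.\<close>
    define c where "c = (\<lambda>C. y (r C) * \<sigma> C (r C))"
    have "y v = (\<Sum>C\<in>bal. c C * u C v)" for v
    proof (cases "v \<in> W")
      case False
      then have "u C v = 0" if "C \<in> bal" for C using sub that by (auto simp: u_def bal_def)
      then show ?thesis using y(1)[OF False] by simp
    next
      case True
      then obtain C where C: "C \<in> W // \<rho>" "v \<in> C"
        using eq by (metis Union_iff Union_quotient)
      show ?thesis
      proof (cases "C \<in> bal")
        case True
        have "v \<in> C \<and> y v * \<sigma> C v = y (r C) * \<sigma> C (r C)"
          using reach[OF C(1) r[OF True] C(2)]
        proof (induction rule: rtrancl_induct)
          case base
          then show ?case using r[OF True] by simp
        next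
          case (step b d)
          then obtain e where e: "e \<in> F" "connects org trm e b d" by (auto simp: adj_rel_def)
          then have "org e \<in> C" "d \<in> C"
            using step.IH closed[OF C(1) e(1)] by (auto simp: connects_def)
          then have "\<sigma> C b = s e * \<sigma> C d"
            using e by (intro potential_connects[OF \<sigma>(2)[OF True]]) auto
          moreover have "y b = s e * y d" using e by (intro potential_connects[OF y(2)])
          ultimately show ?case using step.IH \<open>d \<in> C\<close> by (simp add: mult_ac)
        qed
        moreover have "\<sigma> C v * \<sigma> C v = 1" using \<sigma>(1)[OF True, of v] by auto
        ultimately have "y v = y (r C) * \<sigma> C (r C) * \<sigma> C v" by (metis mult.assoc mult.right_neutral)
        then show ?thesis using single[OF True C(2)] by (simp add: c_def)
      next
        case False
        then obtain es ws where cyc: "is_cycle F org trm es ws" "set ws \<subseteq> C" "prod_list (map s es) \<noteq> 1"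
          using C(1) by (auto simp: bal_def balanced_def)
        then have "y (ws ! 0) = 0" using prod_sign potential_odd_cycle[OF y(2)] by blast
        moreover have "ws ! 0 \<in> C" using cyc by (force simp: is_cycle_def)
        ultimately have "y v = 0"
          using potential_reachable[OF y(2)] reach[OF C(1)] C(2) by blast
        moreover have "u D v = 0" if "D \<in> bal" for D
          using that disj[OF C(1) _ C(2)] False by (auto simp: u_def bal_def)
        ultimately show ?thesis by simp
      qed
    qed
    then have "y = (\<Sum>C\<in>bal. (\<lambda>v. c C * u C v))" using app by (auto simp: fun_eq_iff)
    then show "y \<in> {\<Sum>C\<in>bal. (\<lambda>v. c C * u C v) | c. True}" by blast
  next
    fix y assume "y \<in> {\<Sum>C\<in>bal. (\<lambda>v. c C * u C v) | c. True}"
    then obtain c where y: "\<And>v. y v = (\<Sum>C\<in>bal. c C * u C v)" using app by auto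
    have "y v = 0" if "v \<notin> W" for v
      unfolding y using sub that by (intro sum.neutral) (auto simp: u_def bal_def)
    moreover have "potential F y"
      unfolding potential_def y sum_distrib_left
    proof (intro ballI sum.cong refl)
      fix e C assume e: "e \<in> F" and C: "C \<in> bal"
      show "c C * u C (org e) = s e * (c C * u C (trm e))"
        using \<sigma>(2)[OF C] e closed[of C e] C by (auto simp: u_def bal_def potential_def)
    qed
    ultimately show "y \<in> {y. (\<forall>v. v \<notin> W \<longrightarrow> y v = 0) \<and> potential F y}" by simp
  qed
  moreover have "dim {\<Sum>C\<in>bal. (\<lambda>v. c C * u C v) | c. True} = card bal"
  proof (rule dim_family[OF fin_bal])
    fix c C assume 0: "(\<Sum>C\<in>bal. (\<lambda>v. c C * u C v)) = 0" and C: "C \<in> bal"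
    obtain v where "v \<in> C" using C in_quotient_imp_non_empty[OF eq] by (auto simp: bal_def)
    then have "c C * \<sigma> C v = 0"
      using single[OF C] app[of c v] 0 by simp
    then show "c C = 0" using \<sigma>(1)[OF C, of v] by auto
  qed
  ultimately show ?thesis using comps by (simp add: bal_def)
qed

end

subsection \<open>Solutions on a single edge\<close>

text \<open>Fundamental system at 0: for nonzero mu, \<open>cos_sol\<close> has value 1 and slope 0
  there, \<open>sin_sol\<close> value 0 and slope 1. Hence the coefficients a and b of
  \<open>edge_fun\<close> are its initial value and slope.\<close>

definition cos_sol :: "complex \<Rightarrow> real \<Rightarrow> complex" where
  "cos_sol \<mu> x = cos (csqrt \<mu> * of_real x)"

definition sin_sol :: "complex \<Rightarrow> real \<Rightarrow> complex" where
  "sin_sol \<mu> x = sin (csqrt \<mu> * of_real x) / csqrt \<mu>"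

definition edge_fun :: "complex \<Rightarrow> complex \<Rightarrow> complex \<Rightarrow> real \<Rightarrow> complex" where
  "edge_fun \<mu> a b x = a * cos_sol \<mu> x + b * sin_sol \<mu> x"

definition edge_deriv :: "complex \<Rightarrow> complex \<Rightarrow> complex \<Rightarrow> real \<Rightarrow> complex" where
  "edge_deriv \<mu> a b x = b * cos_sol \<mu> x - \<mu> * a * sin_sol \<mu> x"

lemma csqrt_mult_self: "csqrt \<mu> * csqrt \<mu> = \<mu>"
  by (metis power2_csqrt power2_eq_square)

lemma cos_sol_0 [simp]: "cos_sol \<mu> 0 = 1" and sin_sol_0 [simp]: "sin_sol \<mu> 0 = 0"
  by (simp_all add: cos_sol_def sin_sol_def)

lemma edge_fun_0 [simp]: "edge_fun \<mu> a b 0 = a" and edge_deriv_0 [simp]: "edge_deriv \<mu> a b 0 = b"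
  by (simp_all add: edge_fun_def edge_deriv_def)

text \<open>The left side is the Wronskian of the fundamental system.\<close>

lemma cos_sin_sol_sq:
  assumes "\<mu> \<noteq> 0"
  shows "cos_sol \<mu> x * cos_sol \<mu> x + \<mu> * (sin_sol \<mu> x * sin_sol \<mu> x) = 1"
proof -
  have "\<mu> * (sin_sol \<mu> x * sin_sol \<mu> x) = (\<mu> / (csqrt \<mu> * csqrt \<mu>)) * (sin (csqrt \<mu> * of_real x))\<^sup>2"
    by (simp add: sin_sol_def power2_eq_square)
  also have "\<dots> = (sin (csqrt \<mu> * of_real x))\<^sup>2" using assms by (simp add: csqrt_mult_self)
  finally show ?thesis
    using sin_cos_squared_add2[of "csqrt \<mu> * of_real x"] by (simp add: cos_sol_def power2_eq_square)
qed

lemma cos_sol_deriv: "(cos_sol \<mu> has_vector_derivative - \<mu> * sin_sol \<mu> x) (at x within S)"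
proof -
  have "((\<lambda>z. cos (csqrt \<mu> * z)) has_field_derivative - sin (csqrt \<mu> * of_real x) * csqrt \<mu>) (at (of_real x))"
    by (auto intro!: derivative_eq_intros)
  then have "((\<lambda>x. cos (csqrt \<mu> * of_real x)) has_vector_derivative - sin (csqrt \<mu> * of_real x) * csqrt \<mu>) (at x within S)"
    by (rule has_vector_derivative_real_field)
  moreover have "- sin (csqrt \<mu> * of_real x) * csqrt \<mu> = - \<mu> * sin_sol \<mu> x"
  proof -
    have "\<mu> * sin_sol \<mu> x = (csqrt \<mu> * csqrt \<mu>) * sin_sol \<mu> x" by (simp add: csqrt_mult_self)
    then show ?thesis by (simp add: sin_sol_def)
  qed
  ultimately show ?thesis by (simp add: cos_sol_def[abs_def])
qed

lemma sin_sol_deriv: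
  assumes "\<mu> \<noteq> 0"
  shows "(sin_sol \<mu> has_vector_derivative cos_sol \<mu> x) (at x within S)"
proof -
  have "((\<lambda>z. sin (csqrt \<mu> * z) / csqrt \<mu>) has_field_derivative cos (csqrt \<mu> * of_real x)) (at (of_real x))"
    using assms by (auto intro!: derivative_eq_intros)
  then show ?thesis
    unfolding sin_sol_def[abs_def] cos_sol_def by (rule has_vector_derivative_real_field)
qed

lemma edge_fun_deriv:
  assumes "\<mu> \<noteq> 0"
  shows "(edge_fun \<mu> a b has_vector_derivative edge_deriv \<mu> a b x) (at x within S)"
  unfolding edge_fun_def[abs_def] edge_deriv_def
  by (rule has_vector_derivative_eq_rhs, (rule has_vector_derivative_add has_vector_derivative_mult_right cos_sol_deriv sin_sol_deriv assms)+)
    (simp add: algebra_simps)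

lemma edge_deriv_deriv:
  assumes "\<mu> \<noteq> 0"
  shows "(edge_deriv \<mu> a b has_vector_derivative - \<mu> * edge_fun \<mu> a b x) (at x within S)"
  unfolding edge_deriv_def[abs_def] edge_fun_def
  by (rule has_vector_derivative_eq_rhs, (rule has_vector_derivative_diff has_vector_derivative_mult_right cos_sol_deriv sin_sol_deriv assms)+)
    (simp add: algebra_simps)

lemma edge_solution_iff:
  assumes "\<mu> \<noteq> 0" "l > 0"
  shows "edge_solution l \<mu> u \<longleftrightarrow> (\<exists>a b. \<forall>x\<in>{0..l}. u x = edge_fun \<mu> a b x)"
proof
  assume "edge_solution l \<mu> u"
  then obtain u1 u2 where u: "\<And>x. x \<in> {0..l} \<Longrightarrow> (u has_vector_derivative u1 x) (at x within {0..l})"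
    "\<And>x. x \<in> {0..l} \<Longrightarrow> (u1 has_vector_derivative u2 x) (at x within {0..l})"
    "\<And>x. x \<in> {0..l} \<Longrightarrow> u2 x = - \<mu> * u x"
    unfolding edge_solution_def by (metis minus_mult_left minus_minus)
  \<comment> \<open>variation of constants: the coefficients of u in the fundamental system are constant\<close>
  let ?a = "\<lambda>x. u x * cos_sol \<mu> x - u1 x * sin_sol \<mu> x"
  let ?b = "\<lambda>x. u x * (\<mu> * sin_sol \<mu> x) + u1 x * cos_sol \<mu> x"
  have const: "?a x = ?a 0" "?b x = ?b 0" if x: "x \<in> {0..l}" for x
  proof -
    have d: "(?a has_vector_derivative 0) (at y within {0..l})"
      "(?b has_vector_derivative 0) (at y within {0..l})" if "y \<in> {0..l}" for y
    proof -
      show "(?a has_vector_derivative 0) (at y within {0..l})"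
        by (rule has_vector_derivative_eq_rhs, (rule has_vector_derivative_diff has_vector_derivative_mult cos_sol_deriv sin_sol_deriv u(1,2) that assms)+)
          (simp add: u(3)[OF that] algebra_simps)
      show "(?b has_vector_derivative 0) (at y within {0..l})"
        by (rule has_vector_derivative_eq_rhs, (rule has_vector_derivative_add has_vector_derivative_mult_right has_vector_derivative_mult cos_sol_deriv sin_sol_deriv u(1,2) that assms)+)
          (simp add: u(3)[OF that] algebra_simps)
    qed
    have "g x = g 0" if "\<And>y. y \<in> {0..l} \<Longrightarrow> (g has_vector_derivative 0) (at y within {0..l})"
      for g :: "real \<Rightarrow> complex"
    proof -
      have "\<exists>c. \<forall>y\<in>{0..l}. g y = c"
        using that by (intro has_derivative_zero_constant) (auto simp: has_vector_derivative_def)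
      then show ?thesis using x assms(2) by auto
    qed
    from this[of ?a, OF d(1)] this[of ?b, OF d(2)] show "?a x = ?a 0" "?b x = ?b 0" by simp_all
  qed
  have "u x = edge_fun \<mu> (u 0) (u1 0) x" if x: "x \<in> {0..l}" for x
  proof -
    have "u x = u x * (cos_sol \<mu> x * cos_sol \<mu> x + \<mu> * (sin_sol \<mu> x * sin_sol \<mu> x))"
      using cos_sin_sol_sq[OF assms(1)] by simp
    also have "\<dots> = ?a x * cos_sol \<mu> x + ?b x * sin_sol \<mu> x" by (simp add: algebra_simps)
    also have "\<dots> = edge_fun \<mu> (u 0) (u1 0) x" using const[OF x] by (simp add: edge_fun_def)
    finally show ?thesis .
  qed
  then show "\<exists>a b. \<forall>x\<in>{0..l}. u x = edge_fun \<mu> a b x" by blast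
next
  assume "\<exists>a b. \<forall>x\<in>{0..l}. u x = edge_fun \<mu> a b x"
  then obtain a b where u: "\<And>x. x \<in> {0..l} \<Longrightarrow> u x = edge_fun \<mu> a b x" by blast
  have "(u has_vector_derivative edge_deriv \<mu> a b x) (at x within {0..l})" if "x \<in> {0..l}" for x
    using has_vector_derivative_transform[OF that _ edge_fun_deriv[OF assms(1)]] u by metis
  moreover have "(edge_deriv \<mu> a b has_vector_derivative - \<mu> * edge_fun \<mu> a b x) (at x within {0..l})" for x
    by (rule edge_deriv_deriv[OF assms(1)])
  ultimately show "edge_solution l \<mu> u"
    unfolding edge_solution_def using u
    by (intro exI[of _ "edge_deriv \<mu> a b"] exI[of _ "\<lambda>x. - \<mu> * edge_fun \<mu> a b x"]) auto
qed

text \<open>The coefficient b is read off as the derivative at 0, which spares the search for a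
  point where \<open>sin_sol\<close> is nonzero.\<close>

lemma edge_fun_zero:
  assumes "\<mu> \<noteq> 0" "l > 0" and 0: "\<And>x. x \<in> {0..l} \<Longrightarrow> edge_fun \<mu> a b x = 0"
  shows "a = 0" "b = 0"
proof -
  show "a = 0" using 0[of 0] assms(2) by simp
  have "((\<lambda>x. 0) has_vector_derivative edge_deriv \<mu> a b 0) (at 0 within {0..l})"
    by (rule has_vector_derivative_transform[OF _ _ edge_fun_deriv[OF assms(1)]]) (use 0 assms in auto)
  then have "vector_derivative (\<lambda>x. 0::complex) (at 0 within {0..l}) = edge_deriv \<mu> a b 0"
    using assms(2) by (intro vector_derivative_within_closed_interval) auto
  moreover have "vector_derivative (\<lambda>x. 0::complex) (at 0 within {0..l}) = 0"
    using assms(2) by (intro vector_derivative_within_closed_interval) (auto intro: has_vector_derivative_const)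
  ultimately show "b = 0" by simp
qed

lemma edge_fun_continuous:
  assumes "\<mu> \<noteq> 0"
  shows "continuous_on S (edge_fun \<mu> a b)"
  by (rule continuous_on_vector_derivative) (rule edge_fun_deriv[OF assms])

text \<open>The Wronskian u' v - u v' of the two solutions has derivative (nu - mu) u v; integrate
  it over the edge.\<close>

lemma edge_green:
  assumes "\<mu> \<noteq> 0" "\<nu> \<noteq> 0" "l > 0"
  shows "(\<nu> - \<mu>) * integral {0..l} (\<lambda>x. edge_fun \<mu> a b x * edge_fun \<nu> c d x) =
    (edge_deriv \<mu> a b l * edge_fun \<nu> c d l - edge_fun \<mu> a b l * edge_deriv \<nu> c d l) - (b * c - a * d)"
proof -
  let ?W = "\<lambda>x. edge_deriv \<mu> a b x * edge_fun \<nu> c d x - edge_fun \<mu> a b x * edge_deriv \<nu> c d x"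
  have "((\<lambda>x. (\<nu> - \<mu>) * (edge_fun \<mu> a b x * edge_fun \<nu> c d x)) has_integral ?W l - ?W 0) {0..l}"
  proof (rule fundamental_theorem_of_calculus)
    fix x
    show "(?W has_vector_derivative (\<nu> - \<mu>) * (edge_fun \<mu> a b x * edge_fun \<nu> c d x)) (at x within {0..l})"
      by (rule has_vector_derivative_eq_rhs, (rule has_vector_derivative_diff has_vector_derivative_mult edge_fun_deriv edge_deriv_deriv assms)+)
        (simp add: algebra_simps)
  qed (use assms in simp)
  then have "integral {0..l} (\<lambda>x. (\<nu> - \<mu>) * (edge_fun \<mu> a b x * edge_fun \<nu> c d x)) = ?W l - ?W 0"
    by (rule integral_unique)
  then show ?thesis by simp
qed

lemma edge_square_integral:
  assumes "\<mu> \<noteq> 0" "l > 0"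
  shows "integral {0..l} (\<lambda>x. edge_fun \<mu> a b x * cnj (edge_fun \<mu> a b x)) =
      of_real (integral {0..l} (\<lambda>x. (norm (edge_fun \<mu> a b x))\<^sup>2))"
    and "integral {0..l} (\<lambda>x. (norm (edge_fun \<mu> a b x))\<^sup>2) \<ge> 0"
    and "integral {0..l} (\<lambda>x. (norm (edge_fun \<mu> a b x))\<^sup>2) = 0 \<Longrightarrow> a = 0 \<and> b = 0"
proof -
  have cont: "continuous_on {0..l} (\<lambda>x. (norm (edge_fun \<mu> a b x))\<^sup>2)"
    by (intro continuous_intros edge_fun_continuous assms)
  then have "((\<lambda>x. (norm (edge_fun \<mu> a b x))\<^sup>2) has_integral
      integral {0..l} (\<lambda>x. (norm (edge_fun \<mu> a b x))\<^sup>2)) {0..l}"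
    by (intro integrable_integral integrable_continuous_real)
  then have "((\<lambda>x. of_real ((norm (edge_fun \<mu> a b x))\<^sup>2) :: complex) has_integral
      of_real (integral {0..l} (\<lambda>x. (norm (edge_fun \<mu> a b x))\<^sup>2))) {0..l}"
    by (rule has_integral_of_real)
  moreover have "(of_real ((norm (edge_fun \<mu> a b x))\<^sup>2) :: complex) =
    edge_fun \<mu> a b x * cnj (edge_fun \<mu> a b x)" for x
    by (metis complex_norm_square)
  ultimately show "integral {0..l} (\<lambda>x. edge_fun \<mu> a b x * cnj (edge_fun \<mu> a b x)) =
      of_real (integral {0..l} (\<lambda>x. (norm (edge_fun \<mu> a b x))\<^sup>2))"
    by (simp add: integral_unique)
  show "integral {0..l} (\<lambda>x. (norm (edge_fun \<mu> a b x))\<^sup>2) \<ge> 0"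
    using cont by (intro integral_nonneg integrable_continuous_real) auto
  assume "integral {0..l} (\<lambda>x. (norm (edge_fun \<mu> a b x))\<^sup>2) = 0"
  then have "\<forall>x\<in>{0..l}. (norm (edge_fun \<mu> a b x))\<^sup>2 = 0"
    using integral_eq_0_iff[OF cont assms(2)] by simp
  then show "a = 0 \<and> b = 0" using edge_fun_zero[OF assms, of a b] by simp
qed

text \<open>Off the closed negative real axis the principal square root is holomorphic and commutes
  with conjugation; this is why holomorphy and conjugation are considered for Re mu > 0.\<close>

lemma Re_pos_nonpos: "Re \<mu> > 0 \<Longrightarrow> \<mu> \<notin> \<real>\<^sub>\<le>\<^sub>0"
  by (auto simp: complex_nonpos_Reals_iff)

lemma cnj_edge_fun:
  assumes "Re \<mu> > 0"
  shows "cnj (edge_fun \<mu> a b x) = edge_fun (cnj \<mu>) (cnj a) (cnj b) x"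
    and "cnj (edge_deriv \<mu> a b x) = edge_deriv (cnj \<mu>) (cnj a) (cnj b) x"
  using cnj_csqrt[OF Re_pos_nonpos[OF assms]]
  by (simp_all add: edge_fun_def edge_deriv_def cos_sol_def sin_sol_def cnj_cos cnj_sin)

lemma cos_sol_holomorphic: "(\<lambda>\<mu>. cos_sol \<mu> x) holomorphic_on {\<mu>. Re \<mu> > 0}"
  unfolding cos_sol_def by (intro holomorphic_intros) (auto simp: Re_pos_nonpos)

lemma sin_sol_holomorphic: "(\<lambda>\<mu>. sin_sol \<mu> x) holomorphic_on {\<mu>. Re \<mu> > 0}"
  unfolding sin_sol_def by (intro holomorphic_intros) (auto simp: Re_pos_nonpos)

text \<open>Serves the continuity in mu of integrals over an edge
  (\<open>pair_continuous\<close>).\<close>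

lemma cos_sin_sol_jointly_continuous:
  "continuous_on ({\<mu>. Re \<mu> > 0} \<times> S) (\<lambda>(\<mu>, x). cos_sol \<mu> x)"
  "continuous_on ({\<mu>. Re \<mu> > 0} \<times> S) (\<lambda>(\<mu>, x). sin_sol \<mu> x)"
proof -
  have c: "continuous_on ({\<mu>. Re \<mu> > 0} \<times> S) (\<lambda>z. csqrt (fst z))"
    by (rule continuous_on_compose2[OF continuous_on_csqrt])
      (auto intro!: continuous_intros simp: Re_pos_nonpos)
  show "continuous_on ({\<mu>. Re \<mu> > 0} \<times> S) (\<lambda>(\<mu>, x). cos_sol \<mu> x)"
    "continuous_on ({\<mu>. Re \<mu> > 0} \<times> S) (\<lambda>(\<mu>, x). sin_sol \<mu> x)"
    unfolding cos_sol_def sin_sol_def split_def by (intro continuous_intros c; auto)+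
qed

subsection \<open>Solutions on the graph\<close>

locale kirchhoff_graph =
  fixes V :: "'v set" and E :: "'e set" and org trm :: "'e \<Rightarrow> 'v" and L :: "'e \<Rightarrow> real"
  assumes graph: "metric_graph V E org trm L"
    and no_isolated: "\<forall>v\<in>V. \<exists>e\<in>E. org e = v \<or> trm e = v"
begin

lemma finite_V: "finite V" and finite_E: "finite E"
  and org_in: "e \<in> E \<Longrightarrow> org e \<in> V" and trm_in: "e \<in> E \<Longrightarrow> trm e \<in> V"
  and L_pos: "e \<in> E \<Longrightarrow> L e > 0"
  using graph by (auto simp: metric_graph_def)

text \<open>A solution is encoded by a vector x indexed by vertices and edges: x (Inl v) is its value
  at the vertex v, x (Inr e) its derivative at the origin of the edge e.\<close>

definition edge_value :: "complex \<Rightarrow> ('v + 'e \<Rightarrow> complex) \<Rightarrow> 'e \<Rightarrow> real \<Rightarrow> complex" where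
  "edge_value \<mu> x e = edge_fun \<mu> (x (Inl (org e))) (x (Inr e))"

definition end_deriv :: "complex \<Rightarrow> ('v + 'e \<Rightarrow> complex) \<Rightarrow> 'e \<Rightarrow> complex" where
  "end_deriv \<mu> x e = edge_deriv \<mu> (x (Inl (org e))) (x (Inr e)) (L e)"

definition graph_fun :: "complex \<Rightarrow> ('v + 'e \<Rightarrow> complex) \<Rightarrow> 'e \<Rightarrow> real \<Rightarrow> complex" where
  "graph_fun \<mu> x = (\<lambda>e t. if e \<in> E \<and> t \<in> {0..L e} then edge_value \<mu> x e t else 0)"

text \<open>Continuity at the origin of an edge is built into \<open>edge_value\<close>; the
  terminal end remains as a condition.\<close>

definition matched :: "complex \<Rightarrow> ('v + 'e \<Rightarrow> complex) \<Rightarrow> bool" where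
  "matched \<mu> x \<longleftrightarrow> (\<forall>e\<in>E. edge_value \<mu> x e (L e) = x (Inl (trm e)))"

definition flux :: "complex \<Rightarrow> ('v + 'e \<Rightarrow> complex) \<Rightarrow> 'v \<Rightarrow> complex" where
  "flux \<mu> x v = (\<Sum>e\<in>{e\<in>E. trm e = v}. end_deriv \<mu> x e) - (\<Sum>e\<in>{e\<in>E. org e = v}. x (Inr e))"

text \<open>Bilinear, without a conjugate: this makes it symmetric and fits Green's identity at two
  different spectral parameters. Positivity is recovered by inserting
  \<open>cnj_coords\<close>.\<close>

definition pair :: "complex \<Rightarrow> ('v + 'e \<Rightarrow> complex) \<Rightarrow> complex \<Rightarrow> ('v + 'e \<Rightarrow> complex) \<Rightarrow> complex" where
  "pair \<mu> x \<nu> y = (\<Sum>e\<in>E. integral {0..L e} (\<lambda>t. edge_value \<mu> x e t * edge_value \<nu> y e t))"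

lemma edge_value_0 [simp]: "edge_value \<mu> x e 0 = x (Inl (org e))"
  by (simp add: edge_value_def)

lemma graph_solutions_iff:
  assumes "\<mu> \<noteq> 0"
  shows "f \<in> graph_solutions V E org trm L \<mu> \<longleftrightarrow> (\<exists>x. matched \<mu> x \<and> f = graph_fun \<mu> x)"
proof
  assume "f \<in> graph_solutions V E org trm L \<mu>"
  then have supp: "supported_on_graph E L f" and sol: "\<And>e. e \<in> E \<Longrightarrow> edge_solution (L e) \<mu> (f e)"
    and cont: "continuous_at_vertices E org trm L f" by (auto simp: graph_solutions_def)
  from cont obtain \<phi> where \<phi>: "\<And>e. e \<in> E \<Longrightarrow> f e 0 = \<phi> (org e)" "\<And>e. e \<in> E \<Longrightarrow> f e (L e) = \<phi> (trm e)"
    by (auto simp: continuous_at_vertices_def)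
  have "\<exists>b. \<forall>t\<in>{0..L e}. f e t = edge_fun \<mu> (\<phi> (org e)) b t" if e: "e \<in> E" for e
  proof -
    obtain a b where ab: "\<forall>t\<in>{0..L e}. f e t = edge_fun \<mu> a b t"
      using sol[OF e] edge_solution_iff[OF assms L_pos[OF e]] by blast
    then have "a = \<phi> (org e)" using \<phi>(1)[OF e] L_pos[OF e] by force
    with ab show ?thesis by blast
  qed
  then obtain \<beta> where \<beta>: "\<And>e t. e \<in> E \<Longrightarrow> t \<in> {0..L e} \<Longrightarrow> f e t = edge_fun \<mu> (\<phi> (org e)) (\<beta> e) t"
    by metis
  define x where "x = (\<lambda>i. case i of Inl v \<Rightarrow> \<phi> v | Inr e \<Rightarrow> \<beta> e)"
  have edge_value: "f e t = edge_value \<mu> x e t" if "e \<in> E" "t \<in> {0..L e}" for e t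
    using \<beta>[OF that] by (simp add: edge_value_def x_def)
  have "matched \<mu> x"
    unfolding matched_def using edge_value \<phi>(2) L_pos by (force simp: x_def)
  moreover have "f = graph_fun \<mu> x"
    using supp edge_value unfolding supported_on_graph_def graph_fun_def by (intro ext) auto
  ultimately show "\<exists>x. matched \<mu> x \<and> f = graph_fun \<mu> x" by blast
next
  assume "\<exists>x. matched \<mu> x \<and> f = graph_fun \<mu> x"
  then obtain x where x: "matched \<mu> x" "f = graph_fun \<mu> x" by blast
  have "supported_on_graph E L f" by (auto simp: supported_on_graph_def x graph_fun_def)
  moreover have "edge_solution (L e) \<mu> (f e)" if "e \<in> E" for e
    unfolding edge_solution_iff[OF assms L_pos[OF that]]
    using that by (auto simp: x graph_fun_def edge_value_def)
  moreover have "f e 0 = x (Inl (org e)) \<and> f e (L e) = x (Inl (trm e))" if "e \<in> E" for e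
    using x L_pos[OF that] that by (auto simp: graph_fun_def matched_def)
  then have "continuous_at_vertices E org trm L f"
    unfolding continuous_at_vertices_def by (intro exI[of _ "\<lambda>v. x (Inl v)"]) blast
  ultimately show "f \<in> graph_solutions V E org trm L \<mu>" by (simp add: graph_solutions_def)
qed

lemma normal_derivative_gf:
  assumes "\<mu> \<noteq> 0"
  shows "normal_derivative E org trm L (graph_fun \<mu> x) v = flux \<mu> x v"
proof -
  have "vector_derivative (graph_fun \<mu> x e) (at t within {0..L e}) =
      edge_deriv \<mu> (x (Inl (org e))) (x (Inr e)) t" if "e \<in> E" "t \<in> {0..L e}" for e t
  proof (rule vector_derivative_within_closed_interval)
    show "(graph_fun \<mu> x e has_vector_derivative edge_deriv \<mu> (x (Inl (org e))) (x (Inr e)) t) (at t within {0..L e})"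
      by (rule has_vector_derivative_transform[OF that(2) _ edge_fun_deriv[OF assms]])
        (use that in \<open>auto simp: graph_fun_def edge_value_def\<close>)
  qed (use that L_pos in auto)
  then show ?thesis
    unfolding normal_derivative_def flux_def
    by (intro arg_cong2[of _ _ _ _ "(-)"] sum.cong) (auto simp: end_deriv_def L_pos less_imp_le)
qed

lemma graph_fun_vertex:
  assumes "matched \<mu> x" "e \<in> E"
  shows "graph_fun \<mu> x e 0 = x (Inl (org e))" "graph_fun \<mu> x e (L e) = x (Inl (trm e))"
  using assms L_pos[OF assms(2)] by (auto simp: graph_fun_def matched_def)

text \<open>An edge at v makes the described common value unique.\<close>

lemma vertex_value_gf:
  assumes "matched \<mu> x" "v \<in> V"
  shows "vertex_value E org trm L (graph_fun \<mu> x) v = x (Inl v)"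
  unfolding vertex_value_def
proof (rule the_equality)
  show "\<forall>e\<in>E. (org e = v \<longrightarrow> graph_fun \<mu> x e 0 = x (Inl v)) \<and> (trm e = v \<longrightarrow> graph_fun \<mu> x e (L e) = x (Inl v))"
    using graph_fun_vertex[OF assms(1)] by auto
next
  fix c assume "\<forall>e\<in>E. (org e = v \<longrightarrow> graph_fun \<mu> x e 0 = c) \<and> (trm e = v \<longrightarrow> graph_fun \<mu> x e (L e) = c)"
  then show "c = x (Inl v)" using no_isolated assms(2) graph_fun_vertex[OF assms(1)] by metis
qed

lemma coords_eq_0:
  assumes "matched \<mu> x" and 0: "\<And>e. e \<in> E \<Longrightarrow> x (Inl (org e)) = 0 \<and> x (Inr e) = 0"
  shows "(\<forall>v\<in>V. x (Inl v) = 0) \<and> (\<forall>e\<in>E. x (Inr e) = 0)"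
proof -
  have "x (Inl (trm e)) = 0" if e: "e \<in> E" for e
    using bspec[OF assms(1)[unfolded matched_def] e] 0[OF e] by (simp add: edge_value_def edge_fun_def)
  then show ?thesis using 0 no_isolated by metis
qed

lemma graph_fun_eq_0:
  assumes "\<mu> \<noteq> 0" "matched \<mu> x" "\<And>e t. graph_fun \<mu> x e t = 0"
  shows "(\<forall>v\<in>V. x (Inl v) = 0) \<and> (\<forall>e\<in>E. x (Inr e) = 0)"
proof (rule coords_eq_0[OF assms(2)])
  fix e assume e: "e \<in> E"
  then have "edge_fun \<mu> (x (Inl (org e))) (x (Inr e)) t = 0" if "t \<in> {0..L e}" for t
    using assms(3)[of e t] that by (simp add: graph_fun_def edge_value_def)
  then show "x (Inl (org e)) = 0 \<and> x (Inr e) = 0"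
    using edge_fun_zero[OF assms(1) L_pos[OF e]] by blast
qed

lemma sum_at_vertex:
  assumes "\<And>e. e \<in> E \<Longrightarrow> p e \<in> V"
  shows "(\<Sum>v\<in>V. (\<Sum>e\<in>{e\<in>E. p e = v}. h e) * k v) = (\<Sum>e\<in>E. h e * (k (p e) :: complex))"
proof -
  have "(\<Sum>v\<in>V. (\<Sum>e\<in>{e\<in>E. p e = v}. h e) * k v) = (\<Sum>v\<in>V. \<Sum>e\<in>{e\<in>E. p e = v}. h e * k (p e))"
    unfolding sum_distrib_right by (intro sum.cong) auto
  also have "\<dots> = (\<Sum>e\<in>E. h e * k (p e))"
    using assms by (intro sum.group finite_V finite_E) auto
  finally show ?thesis .
qed

text \<open>Add Green's identity over the edges; by continuity the boundary terms at a vertex share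
  one value and regroup into fluxes.\<close>

lemma green:
  assumes "\<mu> \<noteq> 0" "\<nu> \<noteq> 0" "matched \<mu> x" "matched \<nu> y"
  shows "(\<nu> - \<mu>) * pair \<mu> x \<nu> y = (\<Sum>v\<in>V. flux \<mu> x v * y (Inl v) - x (Inl v) * flux \<nu> y v)"
proof -
  have "(\<nu> - \<mu>) * pair \<mu> x \<nu> y = (\<Sum>e\<in>E. (end_deriv \<mu> x e * y (Inl (trm e)) - x (Inl (trm e)) * end_deriv \<nu> y e)
      - (x (Inr e) * y (Inl (org e)) - x (Inl (org e)) * y (Inr e)))"
    unfolding pair_def sum_distrib_left
    using assms(3,4) by (intro sum.cong refl)
      (simp add: edge_value_def end_deriv_def matched_def edge_green[OF assms(1,2) L_pos])
  also have "\<dots> = (\<Sum>e\<in>E. end_deriv \<mu> x e * y (Inl (trm e))) - (\<Sum>e\<in>E. end_deriv \<nu> y e * x (Inl (trm e)))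
      - (\<Sum>e\<in>E. x (Inr e) * y (Inl (org e))) + (\<Sum>e\<in>E. y (Inr e) * x (Inl (org e)))"
    by (simp add: sum.distrib sum_subtractf algebra_simps)
  also have "\<dots> = (\<Sum>v\<in>V. flux \<mu> x v * y (Inl v) - x (Inl v) * flux \<nu> y v)"
    using sum_at_vertex[of trm "end_deriv \<mu> x" "\<lambda>v. y (Inl v)", OF trm_in]
      sum_at_vertex[of trm "end_deriv \<nu> y" "\<lambda>v. x (Inl v)", OF trm_in]
      sum_at_vertex[of org "\<lambda>e. x (Inr e)" "\<lambda>v. y (Inl v)", OF org_in]
      sum_at_vertex[of org "\<lambda>e. y (Inr e)" "\<lambda>v. x (Inl v)", OF org_in]
    by (simp add: flux_def sum.distrib sum_subtractf left_diff_distrib right_diff_distrib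
        mult.commute[of "x (Inl _)" "_ - _"] mult.commute[of "x (Inl _)" "sum _ _"])
  finally show ?thesis .
qed

definition cnj_coords :: "('v + 'e \<Rightarrow> complex) \<Rightarrow> 'v + 'e \<Rightarrow> complex" where
  "cnj_coords x = (\<lambda>i. cnj (x i))"

lemma cnj_coords:
  assumes "Re \<mu> > 0"
  shows "edge_value (cnj \<mu>) (cnj_coords x) e t = cnj (edge_value \<mu> x e t)"
    and "flux (cnj \<mu>) (cnj_coords x) v = cnj (flux \<mu> x v)"
    and "matched \<mu> x \<Longrightarrow> matched (cnj \<mu>) (cnj_coords x)"
proof -
  show 1: "edge_value (cnj \<mu>) (cnj_coords x) e t = cnj (edge_value \<mu> x e t)" for e t
    by (simp add: edge_value_def cnj_coords_def cnj_edge_fun[OF assms])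
  show "flux (cnj \<mu>) (cnj_coords x) v = cnj (flux \<mu> x v)"
    by (simp add: flux_def end_deriv_def cnj_coords_def cnj_edge_fun[OF assms])
  show "matched (cnj \<mu>) (cnj_coords x)" if "matched \<mu> x"
    using that by (auto simp: matched_def 1) (simp add: cnj_coords_def)
qed

text \<open>Paired with its conjugate, a solution gives the sum over the edges of its squared L2
  norms.\<close>

lemma pair_definite:
  assumes "Re \<mu> > 0" "matched \<mu> x" "pair \<mu> x (cnj \<mu>) (cnj_coords x) = 0"
  shows "(\<forall>v\<in>V. x (Inl v) = 0) \<and> (\<forall>e\<in>E. x (Inr e) = 0)"
proof (rule coords_eq_0[OF assms(2)])
  have \<mu>: "\<mu> \<noteq> 0" using assms(1) by auto
  let ?S = "\<lambda>e. integral {0..L e} (\<lambda>t. (norm (edge_fun \<mu> (x (Inl (org e))) (x (Inr e)) t))\<^sup>2)"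
  have "pair \<mu> x (cnj \<mu>) (cnj_coords x) = of_real (\<Sum>e\<in>E. ?S e)"
    unfolding pair_def cnj_coords(1)[OF assms(1)] of_real_sum
    by (intro sum.cong refl) (simp add: edge_value_def edge_square_integral(1)[OF \<mu> L_pos])
  then have "complex_of_real (\<Sum>e\<in>E. ?S e) = 0" by (rule trans[OF sym assms(3)])
  then have "(\<Sum>e\<in>E. ?S e) = 0" by (simp only: of_real_eq_0_iff)
  then have "?S e = 0" if "e \<in> E" for e
    using that edge_square_integral(2)[OF \<mu> L_pos]
    by (subst (asm) sum_nonneg_eq_0_iff[OF finite_E]) auto
  then show "x (Inl (org e)) = 0 \<and> x (Inr e) = 0" if "e \<in> E" for e
    using edge_square_integral(3)[OF \<mu> L_pos[OF that]] that by blast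
qed

text \<open>The classical argument that a symmetric operator has no nonreal eigenvalue: apply
  Green's identity to x and its conjugate.\<close>

lemma nonreal_injective:
  assumes "Re \<mu> > 0" "Im \<mu> \<noteq> 0" "matched \<mu> x" "\<And>v. v \<in> V \<Longrightarrow> flux \<mu> x v = 0"
  shows "(\<forall>v\<in>V. x (Inl v) = 0) \<and> (\<forall>e\<in>E. x (Inr e) = 0)"
proof (rule pair_definite[OF assms(1,3)])
  have "(cnj \<mu> - \<mu>) * pair \<mu> x (cnj \<mu>) (cnj_coords x) = 0"
    using assms cnj_coords[OF assms(1), of x] by (subst green) auto
  moreover have "cnj \<mu> - \<mu> \<noteq> 0" using assms(2) by (simp add: complex_eq_iff)
  ultimately show "pair \<mu> x (cnj \<mu>) (cnj_coords x) = 0" by simp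
qed

lemma linear_combination:
  assumes "finite A"
  shows "edge_value \<mu> (\<lambda>i. \<Sum>l\<in>A. y l * x l i) e t = (\<Sum>l\<in>A. y l * edge_value \<mu> (x l) e t)"
    and "flux \<mu> (\<lambda>i. \<Sum>l\<in>A. y l * x l i) v = (\<Sum>l\<in>A. y l * flux \<mu> (x l) v)"
    and "graph_fun \<mu> (\<lambda>i. \<Sum>l\<in>A. y l * x l i) e t = (\<Sum>l\<in>A. y l * graph_fun \<mu> (x l) e t)"
proof -
  show 1: "edge_value \<mu> (\<lambda>i. \<Sum>l\<in>A. y l * x l i) e t = (\<Sum>l\<in>A. y l * edge_value \<mu> (x l) e t)" for e t
    by (simp add: edge_value_def edge_fun_def sum_distrib_left sum_distrib_right sum.distrib algebra_simps)
  show "graph_fun \<mu> (\<lambda>i. \<Sum>l\<in>A. y l * x l i) e t = (\<Sum>l\<in>A. y l * graph_fun \<mu> (x l) e t)"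
    unfolding graph_fun_def 1 by (cases "e \<in> E \<and> t \<in> {0..L e}") (simp_all only: if_True if_False simp_thms mult_zero_right sum.neutral_const)
  have end_deriv: "end_deriv \<mu> (\<lambda>i. \<Sum>l\<in>A. y l * x l i) e = (\<Sum>l\<in>A. y l * end_deriv \<mu> (x l) e)" for e
    by (simp add: end_deriv_def edge_deriv_def sum_distrib_left sum_distrib_right sum_subtractf algebra_simps)
  have "(\<Sum>e\<in>F. \<Sum>l\<in>A. y l * h l e) = (\<Sum>l\<in>A. y l * (\<Sum>e\<in>F. h l e))" for F and h :: "_ \<Rightarrow> 'e \<Rightarrow> complex"
    by (subst sum.swap) (simp add: sum_distrib_left)
  then show "flux \<mu> (\<lambda>i. \<Sum>l\<in>A. y l * x l i) v = (\<Sum>l\<in>A. y l * flux \<mu> (x l) v)"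
    by (simp add: flux_def end_deriv sum_subtractf right_diff_distrib)
qed

lemma matched_combination:
  assumes "finite A" "\<And>l. l \<in> A \<Longrightarrow> matched \<mu> (x l)"
  shows "matched \<mu> (\<lambda>i. \<Sum>l\<in>A. y l * x l i)"
  using assms by (auto simp: matched_def linear_combination)

lemma pair_combination:
  assumes "finite A" "\<mu> \<noteq> 0" "\<nu> \<noteq> 0"
  shows "pair \<mu> (\<lambda>i. \<Sum>l\<in>A. y l * x l i) \<nu> z = (\<Sum>l\<in>A. y l * pair \<mu> (x l) \<nu> z)"
proof -
  have int: "(\<lambda>t. edge_value \<mu> (x l) e t * edge_value \<nu> z e t) integrable_on {0..L e}" for l e
    unfolding edge_value_def by (intro integrable_continuous_real continuous_intros edge_fun_continuous assms)
  have "integral {0..L e} (\<lambda>t. edge_value \<mu> (\<lambda>i. \<Sum>l\<in>A. y l * x l i) e t * edge_value \<nu> z e t) =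
      (\<Sum>l\<in>A. y l * integral {0..L e} (\<lambda>t. edge_value \<mu> (x l) e t * edge_value \<nu> z e t))" for e
  proof -
    have "integral {0..L e} (\<lambda>t. edge_value \<mu> (\<lambda>i. \<Sum>l\<in>A. y l * x l i) e t * edge_value \<nu> z e t) =
        integral {0..L e} (\<lambda>t. \<Sum>l\<in>A. y l * (edge_value \<mu> (x l) e t * edge_value \<nu> z e t))"
      by (simp add: linear_combination[OF assms(1)] sum_distrib_right mult.assoc)
    also have "\<dots> = (\<Sum>l\<in>A. integral {0..L e} (\<lambda>t. y l * (edge_value \<mu> (x l) e t * edge_value \<nu> z e t)))"
      using int by (intro integral_sum assms integrable_on_mult_right)
    finally show ?thesis by simp
  qed
  then show ?thesis
    unfolding pair_def by (simp add: sum_distrib_left) (rule sum.swap)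
qed

lemma pair_commute: "pair \<mu> x \<nu> y = pair \<nu> y \<mu> x"
  by (simp add: pair_def mult.commute)

end

subsection \<open>Poles of the resolvent\<close>

lemma holomorphic_det:
  assumes carr: "\<And>\<mu>. M \<mu> \<in> carrier_mat n n"
    and hol: "\<And>i j. i < n \<Longrightarrow> j < n \<Longrightarrow> (\<lambda>\<mu>. M \<mu> $$ (i, j)) holomorphic_on S"
  shows "(\<lambda>\<mu>. Determinant.det (M \<mu>)) holomorphic_on S"
proof -
  have "(\<lambda>\<mu>. \<Sum>p\<in>{p. p permutes {0..<n}}. signof p * (\<Prod>i = 0..<n. M \<mu> $$ (i, p i))) holomorphic_on S"
  proof (intro holomorphic_intros hol)
    fix p i assume "p \<in> {p. p permutes {0..<n}}" "i \<in> {0..<n}"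
    then show "i < n" "p i < n" using permutes_in_image[of p "{0..<n}" i] by auto
  qed
  then show ?thesis unfolding det_def'[OF carr] by simp
qed

text \<open>Cramer's rule over an arbitrary finite index set, after an enumeration h: d is the
  determinant and B the adjugate. The adjugate is polynomial in the entries and so stays holomorphic
  where A is singular.\<close>

lemma holomorphic_adjugate:
  fixes A :: "complex \<Rightarrow> 'i \<Rightarrow> 'i \<Rightarrow> complex"
  assumes I: "finite I"
    and hol: "\<And>i j. i \<in> I \<Longrightarrow> j \<in> I \<Longrightarrow> (\<lambda>\<mu>. A \<mu> i j) holomorphic_on S"
  obtains d B where "d holomorphic_on S"
    "\<And>i j. i \<in> I \<Longrightarrow> j \<in> I \<Longrightarrow> (\<lambda>\<mu>. B \<mu> i j) holomorphic_on S"
    "\<And>\<mu> i j. i \<in> I \<Longrightarrow> j \<in> I \<Longrightarrow> (\<Sum>k\<in>I. A \<mu> i k * B \<mu> k j) = (if i = j then d \<mu> else 0)"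
    "\<And>\<mu> i j. i \<in> I \<Longrightarrow> j \<in> I \<Longrightarrow> (\<Sum>k\<in>I. B \<mu> i k * A \<mu> k j) = (if i = j then d \<mu> else 0)"
    "\<And>\<mu>. d \<mu> = 0 \<Longrightarrow> \<exists>x. (\<exists>i\<in>I. x i \<noteq> 0) \<and> (\<forall>i\<in>I. (\<Sum>k\<in>I. A \<mu> i k * x k) = 0)"
proof -
  define n where "n = card I"
  obtain h where h: "bij_betw h {0..<n} I" using ex_bij_betw_nat_finite[OF I] by (auto simp: n_def)
  define g where "g = the_inv_into {0..<n} h"
  have g: "g i < n" "h (g i) = i" if "i \<in> I" for i
    using bij_betwE[OF bij_betw_the_inv_into[OF h]] f_the_inv_into_f_bij_betw[OF h] that
    by (auto simp: g_def)
  have gh: "g (h a) = a" "h a \<in> I" if "a < n" for a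
    using h that by (auto simp: g_def bij_betw_def the_inv_into_f_f)
  have sum_I: "(\<Sum>k\<in>I. f k) = (\<Sum>a<n. f (h a))" for f :: "'i \<Rightarrow> complex"
    using sum.reindex_bij_betw[OF h, of f] by (simp add: atLeast0LessThan)
  define M where "M = (\<lambda>\<mu>. mat n n (\<lambda>(a, b). A \<mu> (h a) (h b)))"
  have M: "M \<mu> \<in> carrier_mat n n" for \<mu> by (simp add: M_def)
  have M_idx: "M \<mu> $$ (a, b) = A \<mu> (h a) (h b)" if "a < n" "b < n" for \<mu> a b
    using that by (simp add: M_def)
  define d where "d = (\<lambda>\<mu>. Determinant.det (M \<mu>))"
  define B where "B = (\<lambda>\<mu> i j. adj_mat (M \<mu>) $$ (g i, g j))"
  have mult_idx: "(P * Q) $$ (a, b) = (\<Sum>c<n. P $$ (a, c) * Q $$ (c, b))"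
    if "P \<in> carrier_mat n n" "Q \<in> carrier_mat n n" "a < n" "b < n" for P Q :: "complex mat" and a b
    using that by (simp add: times_mat_def scalar_prod_def atLeast0LessThan)
  have adj: "adj_mat (M \<mu>) \<in> carrier_mat n n" for \<mu> using adj_mat(1)[OF M] .
  show ?thesis
  proof (rule that[of d B])
    show "d holomorphic_on S" unfolding d_def
      by (intro holomorphic_det[of M n] M) (use hol gh M_idx in auto)
    show "(\<lambda>\<mu>. B \<mu> i j) holomorphic_on S" if "i \<in> I" "j \<in> I" for i j
    proof -
      have "(\<lambda>\<mu>. (- 1) ^ (g j + g i) * Determinant.det (mat_delete (M \<mu>) (g j) (g i))) holomorphic_on S"
      proof (intro holomorphic_intros holomorphic_det[of _ "n - 1"])
        show "mat_delete (M \<mu>) (g j) (g i) \<in> carrier_mat (n - 1) (n - 1)" for \<mu>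
          using mat_delete_carrier[OF M] .
        fix a b assume ab: "a < n - 1" "b < n - 1"
        \<comment> \<open>Deleting row g j and column g i shifts the later indices by one; a' and b'
          are the indices in the full matrix.\<close>
        define a' where "a' = (if a < g j then a else Suc a)"
        define b' where "b' = (if b < g i then b else Suc b)"
        have "a' < n" "b' < n" using ab by (auto simp: a'_def b'_def)
        then have "(\<lambda>\<mu>. M \<mu> $$ (a', b')) holomorphic_on S"
          using hol gh M_idx by auto
        moreover have "mat_delete (M \<mu>) (g j) (g i) $$ (a, b) = M \<mu> $$ (a', b')" for \<mu>
          using ab M[of \<mu>] unfolding mat_delete_def by (simp add: a'_def b'_def)
        ultimately show "(\<lambda>\<mu>. mat_delete (M \<mu>) (g j) (g i) $$ (a, b)) holomorphic_on S" by simp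
      qed
      moreover have "B \<mu> i j = (- 1) ^ (g j + g i) * Determinant.det (mat_delete (M \<mu>) (g j) (g i))" for \<mu>
        using g that M[of \<mu>] by (simp add: B_def adj_mat_def cofactor_def)
      ultimately show ?thesis by simp
    qed
    show "(\<Sum>k\<in>I. A \<mu> i k * B \<mu> k j) = (if i = j then d \<mu> else 0)" if ij: "i \<in> I" "j \<in> I" for \<mu> i j
    proof -
      have "(\<Sum>k\<in>I. A \<mu> i k * B \<mu> k j) = (M \<mu> * adj_mat (M \<mu>)) $$ (g i, g j)"
        unfolding sum_I using g ij by (simp add: mult_idx[OF M adj] M_idx B_def gh)
      also have "\<dots> = (if i = j then d \<mu> else 0)"
        unfolding adj_mat(2)[OF M] using g ij by (simp add: d_def) metis
      finally show ?thesis .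
    qed
    show "(\<Sum>k\<in>I. B \<mu> i k * A \<mu> k j) = (if i = j then d \<mu> else 0)" if ij: "i \<in> I" "j \<in> I" for \<mu> i j
    proof -
      have "(\<Sum>k\<in>I. B \<mu> i k * A \<mu> k j) = (adj_mat (M \<mu>) * M \<mu>) $$ (g i, g j)"
        unfolding sum_I using g ij by (simp add: mult_idx[OF adj M] M_idx B_def gh)
      also have "\<dots> = (if i = j then d \<mu> else 0)"
        unfolding adj_mat(3)[OF M] using g ij by (simp add: d_def) metis
      finally show ?thesis .
    qed
    show "\<exists>x. (\<exists>i\<in>I. x i \<noteq> 0) \<and> (\<forall>i\<in>I. (\<Sum>k\<in>I. A \<mu> i k * x k) = 0)" if d0: "d \<mu> = 0" for \<mu>
    proof -
      obtain v where v: "v \<in> carrier_vec n" "v \<noteq> 0\<^sub>v n" "M \<mu> *\<^sub>v v = 0\<^sub>v n"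
        using det_0_iff_vec_prod_zero[OF M, of \<mu>] d0 by (auto simp: d_def)
      obtain a where a: "a < n" "v $ a \<noteq> 0"
        using v(1,2) by (metis carrier_vecD eq_vecI index_zero_vec(1) index_zero_vec(2))
      have "(\<Sum>k\<in>I. A \<mu> i k * v $ g k) = 0" if i: "i \<in> I" for i
      proof -
        have "(\<Sum>k\<in>I. A \<mu> i k * v $ g k) = (M \<mu> *\<^sub>v v) $ g i"
          unfolding sum_I using g[OF i] M[of \<mu>] v(1)
          by (simp add: scalar_prod_def M_idx gh atLeast0LessThan)
        then show ?thesis using v(3) g[OF i] by simp
      qed
      moreover have "v $ g (h a) \<noteq> 0" "h a \<in> I" using a gh by auto
      ultimately show ?thesis by (intro exI[of _ "\<lambda>k. v $ g k"]) blast
    qed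
  qed
qed

text \<open>Carries identities that are first known only for mu different from lam over to lam
  itself.\<close>

lemma continuous_limit_unique:
  fixes f g :: "complex \<Rightarrow> complex"
  assumes "continuous_on (ball a r) f" "continuous_on (ball a r) g" "r > 0"
    and eq: "\<And>z. z \<in> ball a r - {a} \<Longrightarrow> f z = g z"
  shows "f a = g a"
proof -
  have a: "a \<in> ball a r" using assms(3) by simp
  have "(f \<longlongrightarrow> f a) (at a)" "(g \<longlongrightarrow> g a) (at a)"
    using assms(1,2) a continuous_on_eq_continuous_at[OF open_ball] by (metis continuous_at)+
  moreover have "eventually (\<lambda>z. f z = g z) (at a)"
    using eq assms(3) by (auto simp: eventually_at_topological intro!: exI[of _ "ball a r"])
  ultimately have "(g \<longlongrightarrow> f a) (at a)" "(g \<longlongrightarrow> g a) (at a)"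
    using tendsto_cong by blast+
  then show ?thesis by (rule tendsto_unique[OF at_neq_bot])
qed

section \<open>The boundary value problem as a holomorphic linear system\<close>

context kirchhoff_graph
begin

definition idx :: "('v + 'e) set" where
  "idx = Inl ` V \<union> Inr ` E"

text \<open>Left sides of the linear system: a flux equation for each vertex and a continuity
  equation for the terminal end of each edge. Equations and unknowns share the index set
  \<open>idx\<close>, so the system is square.\<close>

definition row :: "complex \<Rightarrow> ('v + 'e \<Rightarrow> complex) \<Rightarrow> 'v + 'e \<Rightarrow> complex" where
  "row \<mu> x i = (case i of Inl v \<Rightarrow> flux \<mu> x v | Inr e \<Rightarrow> edge_value \<mu> x e (L e) - x (Inl (trm e)))"

definition entry :: "complex \<Rightarrow> 'v + 'e \<Rightarrow> 'v + 'e \<Rightarrow> complex" where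
  "entry \<mu> i j = row \<mu> (\<lambda>k. if k = j then 1 else 0) i"

lemma finite_idx: "finite idx"
  using finite_V finite_E by (simp add: idx_def)

lemma edge_value_cong:
  assumes "e \<in> E" "\<And>i. i \<in> idx \<Longrightarrow> x i = y i"
  shows "edge_value \<mu> x e t = edge_value \<mu> y e t" "end_deriv \<mu> x e = end_deriv \<mu> y e" "x (Inl (trm e)) = y (Inl (trm e))"
  using assms org_in trm_in by (auto simp: edge_value_def end_deriv_def idx_def)

lemma row_cong:
  assumes "i \<in> idx" "\<And>i. i \<in> idx \<Longrightarrow> x i = y i"
  shows "row \<mu> x i = row \<mu> y i"
proof (cases i)
  case (Inl v)
  have "flux \<mu> x v = flux \<mu> y v"
    unfolding flux_def using assms(2)
    by (intro arg_cong2[of _ _ _ _ "(-)"] sum.cong edge_value_cong(2)) (auto simp: idx_def)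
  then show ?thesis by (simp add: row_def Inl)
next
  case (Inr e)
  then have "e \<in> E" using assms(1) by (auto simp: idx_def)
  then show ?thesis using edge_value_cong(1)[OF \<open>e \<in> E\<close> assms(2)] edge_value_cong(3)[OF \<open>e \<in> E\<close> assms(2)] by (simp add: row_def Inr)
qed

lemma graph_fun_cong:
  assumes "\<And>i. i \<in> idx \<Longrightarrow> x i = y i"
  shows "graph_fun \<mu> x = graph_fun \<mu> y"
  unfolding graph_fun_def using edge_value_cong(1)[OF _ assms] by (intro ext) auto

lemma row_combination:
  assumes "finite A"
  shows "row \<mu> (\<lambda>i. \<Sum>l\<in>A. y l * x l i) i = (\<Sum>l\<in>A. y l * row \<mu> (x l) i)"
  by (cases i) (simp_all add: row_def linear_combination[OF assms] sum_subtractf right_diff_distrib)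

lemma row_scale: "row \<mu> (\<lambda>i. c * x i) i = c * row \<mu> x i"
  using row_combination[of "{()}" \<mu> "\<lambda>_. c" "\<lambda>_. x" i] by simp

lemma row_entry:
  assumes "i \<in> idx"
  shows "row \<mu> x i = (\<Sum>j\<in>idx. entry \<mu> i j * x j)"
proof -
  have "(\<Sum>j\<in>idx. x j * (if k = j then 1 else 0)) = x k" if "k \<in> idx" for k
  proof -
    have "(\<Sum>j\<in>idx. x j * (if k = j then 1 else 0)) = (\<Sum>j\<in>idx. if k = j then x j else 0)"
      by (intro sum.cong) auto
    then show ?thesis using that finite_idx by simp
  qed
  then have "row \<mu> x i = row \<mu> (\<lambda>k. \<Sum>j\<in>idx. x j * (if k = j then 1 else 0)) i"
    by (intro row_cong assms) simp
  then show ?thesis by (simp only: row_combination[OF finite_idx] entry_def mult.commute)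
qed

lemma row_eq_0_iff:
  "(\<forall>i\<in>idx. row \<mu> x i = 0) \<longleftrightarrow> matched \<mu> x \<and> (\<forall>v\<in>V. flux \<mu> x v = 0)"
  by (auto simp: idx_def row_def matched_def ball_Un)

lemma entry_holomorphic: "(\<lambda>\<mu>. entry \<mu> i j) holomorphic_on {\<mu>. Re \<mu> > 0}"
  unfolding entry_def row_def flux_def edge_value_def end_deriv_def edge_fun_def edge_deriv_def
  by (cases i) (auto intro!: holomorphic_intros cos_sol_holomorphic sin_sol_holomorphic)

definition kernel :: "complex \<Rightarrow> ('v + 'e \<Rightarrow> complex) \<Rightarrow> bool" where
  "kernel \<mu> x \<longleftrightarrow> matched \<mu> x \<and> (\<forall>v\<in>V. flux \<mu> x v = 0)"

lemma pair_continuous: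
  assumes U: "U \<subseteq> {\<mu>. Re \<mu> > 0}" and \<nu>: "\<nu> \<noteq> 0"
    and H: "\<And>i. i \<in> idx \<Longrightarrow> continuous_on U (\<lambda>\<mu>. H \<mu> i)"
  shows "continuous_on U (\<lambda>\<mu>. pair \<mu> (H \<mu>) \<nu> y)"
  unfolding pair_def
proof (intro continuous_on_sum)
  fix e assume e: "e \<in> E"
  have H': "continuous_on (U \<times> cbox 0 (L e)) (\<lambda>z. H (fst z) i)" if "i \<in> idx" for i
    by (rule continuous_on_compose2[OF H[OF that]]) (auto intro!: continuous_intros)
  have cos_sol: "continuous_on (U \<times> cbox 0 (L e)) (\<lambda>z. cos_sol (fst z) (snd z))"
    "continuous_on (U \<times> cbox 0 (L e)) (\<lambda>z. sin_sol (fst z) (snd z))"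
    using cos_sin_sol_jointly_continuous[of "cbox 0 (L e)"] U
    by (auto simp: split_def intro: continuous_on_subset)
  have y: "continuous_on (U \<times> cbox 0 (L e)) (\<lambda>z. edge_value \<nu> y e (snd z))"
    unfolding edge_value_def
    by (rule continuous_on_compose2[OF edge_fun_continuous[OF \<nu>, of UNIV]]) (auto intro!: continuous_intros)
  have i: "Inl (org e) \<in> idx" "Inr e \<in> idx" using e org_in by (auto simp: idx_def)
  have "continuous_on (U \<times> cbox 0 (L e)) (\<lambda>(\<mu>, t). edge_value \<mu> (H \<mu>) e t * edge_value \<nu> y e t)"
    unfolding split_def
    by (subst edge_value_def) (auto simp only: edge_fun_def intro!: continuous_on_add continuous_on_mult H' i cos_sol y)
  then have "continuous_on U (\<lambda>\<mu>. integral (cbox 0 (L e)) (\<lambda>t. edge_value \<mu> (H \<mu>) e t * edge_value \<nu> y e t))"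
    by (rule integral_continuous_on_param)
  then show "continuous_on U (\<lambda>\<mu>. integral {0..L e} (\<lambda>t. edge_value \<mu> (H \<mu>) e t * edge_value \<nu> y e t))" by simp
qed

lemma row_continuous:
  assumes U: "U \<subseteq> {\<mu>. Re \<mu> > 0}" and i: "i \<in> idx"
    and H: "\<And>i. i \<in> idx \<Longrightarrow> continuous_on U (\<lambda>\<mu>. H \<mu> i)"
  shows "continuous_on U (\<lambda>\<mu>. row \<mu> (H \<mu>) i)"
proof -
  have "continuous_on U (\<lambda>\<mu>. entry \<mu> i j)" for j
    using holomorphic_on_imp_continuous_on[OF entry_holomorphic] U continuous_on_subset by blast
  then show ?thesis unfolding row_entry[OF i] using H by (intro continuous_intros) auto
qed

text \<open>H divided by the p-th power of \<mu> - \<kappa> is the solution with unit flux at w and zero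
  flux at the other vertices.\<close>

definition resolvent_numerator :: "real \<Rightarrow> real \<Rightarrow> 'v \<Rightarrow> nat \<Rightarrow> (complex \<Rightarrow> 'v + 'e \<Rightarrow> complex) \<Rightarrow> bool" where
  "resolvent_numerator \<kappa> r w p H \<longleftrightarrow> (\<forall>i\<in>idx. (\<lambda>\<mu>. H \<mu> i) holomorphic_on ball (of_real \<kappa>) r) \<and>
    (\<forall>\<mu>\<in>ball (of_real \<kappa>) r - {of_real \<kappa>}. \<forall>i\<in>idx.
       row \<mu> (H \<mu>) i = (if i = Inl w then (\<mu> - of_real \<kappa>) ^ p else 0))"

context
  fixes \<kappa> r :: real
  assumes \<kappa>: "\<kappa> > 0" and r: "r > 0" and ball: "ball (of_real \<kappa>) r \<subseteq> {\<mu>. Re \<mu> > 0}"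
begin

lemma numerator_continuous:
  assumes "resolvent_numerator \<kappa> r w p H" "i \<in> idx"
  shows "continuous_on (ball (of_real \<kappa>) r) (\<lambda>\<mu>. H \<mu> i)"
  using assms by (auto simp: resolvent_numerator_def intro: holomorphic_on_imp_continuous_on)

text \<open>Let mu tend to \<kappa> in the defining equations; for p = 0 the power on the right
  stays 1.\<close>

lemma numerator_at:
  assumes "resolvent_numerator \<kappa> r w p H" "i \<in> idx"
  shows "row (of_real \<kappa>) (H (of_real \<kappa>)) i = (if i = Inl w \<and> p = 0 then 1 else 0)"
proof -
  have "row (of_real \<kappa>) (H (of_real \<kappa>)) i = (if i = Inl w then (of_real \<kappa> - of_real \<kappa>) ^ p else (0::complex))"
  proof (rule continuous_limit_unique[where f = "\<lambda>\<mu>. row \<mu> (H \<mu>) i" and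
        g = "\<lambda>\<mu>. if i = Inl w then (\<mu> - of_real \<kappa>) ^ p else 0"])
    show "continuous_on (ball (of_real \<kappa>) r) (\<lambda>\<mu>. row \<mu> (H \<mu>) i)"
      by (intro row_continuous ball assms(2) numerator_continuous[OF assms(1)])
    show "continuous_on (ball (of_real \<kappa>) r) (\<lambda>\<mu>. if i = Inl w then (\<mu> - of_real \<kappa>) ^ p else 0 :: complex)"
      by (cases "i = Inl w") (auto intro!: continuous_intros)
  qed (use assms r in \<open>auto simp: resolvent_numerator_def\<close>)
  then show ?thesis by (cases p) auto
qed

text \<open>The value at \<kappa> is the Laurent coefficient of order -p of the solution with unit
  flux at w.\<close>

lemma numerator_kernel:
  assumes "resolvent_numerator \<kappa> r w p H" "p > 0"
  shows "kernel (of_real \<kappa>) (H (of_real \<kappa>))"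
  using numerator_at[OF assms(1)] assms(2) row_eq_0_iff[of "of_real \<kappa>" "H (of_real \<kappa>)"]
  by (simp add: kernel_def)

text \<open>Green's identity between H at mu and y at \<kappa> has the right side (mu - \<kappa>)^p
  y(w). Divide by \<kappa> - mu, the source of the minus sign, and let mu tend to \<kappa>. So for p
  > 1 the leading coefficient pairs to zero with the whole eigenspace, and for p = 1 it represents
  minus the evaluation at w.\<close>

lemma numerator_pair:
  assumes H: "resolvent_numerator \<kappa> r w p H" and p: "p > 0" and w: "w \<in> V" and y: "kernel (of_real \<kappa>) y"
  shows "pair (of_real \<kappa>) (H (of_real \<kappa>)) (of_real \<kappa>) y = (if p = 1 then - y (Inl w) else 0)"
proof -
  have \<kappa>0: "complex_of_real \<kappa> \<noteq> 0" using \<kappa> by simp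
  have "pair (of_real \<kappa>) (H (of_real \<kappa>)) (of_real \<kappa>) y = - ((of_real \<kappa> - of_real \<kappa>) ^ (p - 1) * y (Inl w))"
  proof (rule continuous_limit_unique[where f = "\<lambda>\<mu>. pair \<mu> (H \<mu>) (of_real \<kappa>) y" and
        g = "\<lambda>\<mu>. - ((\<mu> - of_real \<kappa>) ^ (p - 1) * y (Inl w))", OF _ _ r])
    show "continuous_on (ball (of_real \<kappa>) r) (\<lambda>\<mu>. pair \<mu> (H \<mu>) (of_real \<kappa>) y)"
      by (intro pair_continuous ball \<kappa>0 numerator_continuous[OF H])
    show "continuous_on (ball (of_real \<kappa>) r) (\<lambda>\<mu>. - ((\<mu> - of_real \<kappa>) ^ (p - 1) * y (Inl w)))"
      by (intro continuous_intros)
  next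
    fix \<mu> assume \<mu>: "\<mu> \<in> ball (complex_of_real \<kappa>) r - {of_real \<kappa>}"
    then have "Re \<mu> > 0" using ball by blast
    then have \<mu>0: "\<mu> \<noteq> 0" by auto
    have rows: "row \<mu> (H \<mu>) i = (if i = Inl w then (\<mu> - of_real \<kappa>) ^ p else 0)" if "i \<in> idx" for i
      using H \<mu> that by (auto simp: resolvent_numerator_def)
    have m: "matched \<mu> (H \<mu>)"
      unfolding matched_def
    proof
      fix e assume "e \<in> E"
      then show "edge_value \<mu> (H \<mu>) e (L e) = H \<mu> (Inl (trm e))"
        using rows[of "Inr e"] by (simp add: idx_def row_def)
    qed
    have fl: "flux \<mu> (H \<mu>) v = (if v = w then (\<mu> - of_real \<kappa>) ^ p else 0)" if "v \<in> V" for v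
      using rows[of "Inl v"] that by (simp add: idx_def row_def)
    have "(of_real \<kappa> - \<mu>) * pair \<mu> (H \<mu>) (of_real \<kappa>) y =
        (\<Sum>v\<in>V. flux \<mu> (H \<mu>) v * y (Inl v) - H \<mu> (Inl v) * flux (of_real \<kappa>) y v)"
      using y m by (intro green \<mu>0 \<kappa>0) (auto simp: kernel_def)
    also have "\<dots> = (\<Sum>v\<in>V. if v = w then (\<mu> - of_real \<kappa>) ^ p * y (Inl w) else 0)"
      using y by (intro sum.cong refl) (auto simp: fl kernel_def)
    also have "\<dots> = (\<mu> - of_real \<kappa>) ^ p * y (Inl w)" using w finite_V by simp
    also have "\<dots> = (\<mu> - of_real \<kappa>) * ((\<mu> - of_real \<kappa>) ^ (p - 1) * y (Inl w))"
      using p by (simp add: power_eq_if)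
    also have "\<dots> = (of_real \<kappa> - \<mu>) * - ((\<mu> - of_real \<kappa>) ^ (p - 1) * y (Inl w))"
      by (simp add: algebra_simps)
    finally show "pair \<mu> (H \<mu>) (of_real \<kappa>) y = - ((\<mu> - of_real \<kappa>) ^ (p - 1) * y (Inl w))"
      by (rule mult_left_cancel[THEN iffD1, rotated]) (use \<mu> in auto)
  qed
  then show ?thesis using p by (cases "p = 1") (auto simp: power_0_left)
qed

lemma kernel_cnj:
  assumes "kernel (of_real \<kappa>) x"
  shows "kernel (of_real \<kappa>) (cnj_coords x)"
  using assms cnj_coords(2,3)[of "of_real \<kappa>" x] \<kappa> by (simp add: kernel_def)

lemma kernel_definite:
  assumes "kernel (of_real \<kappa>) x" "pair (of_real \<kappa>) x (of_real \<kappa>) (cnj_coords x) = 0" "i \<in> idx"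
  shows "x i = 0"
  using pair_definite[of "of_real \<kappa>" x] assms \<kappa> by (auto simp: kernel_def idx_def)

text \<open>By \<open>numerator_pair\<close> the leading coefficient pairs to zero with its own
  conjugate, hence vanishes, and a factor mu - \<kappa> can be divided out.\<close>

lemma numerator_reduce:
  assumes H: "resolvent_numerator \<kappa> r w (Suc (Suc p)) H" and w: "w \<in> V"
  shows "\<exists>K. resolvent_numerator \<kappa> r w (Suc p) K"
proof -
  have k: "kernel (of_real \<kappa>) (H (of_real \<kappa>))" using numerator_kernel[OF H] by simp
  have "pair (of_real \<kappa>) (H (of_real \<kappa>)) (of_real \<kappa>) (cnj_coords (H (of_real \<kappa>))) = 0"
    using numerator_pair[OF H _ w kernel_cnj[OF k]] by simp
  then have 0: "H (of_real \<kappa>) i = 0" if "i \<in> idx" for i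
    using kernel_definite[OF k] that by blast
  \<comment> \<open>The difference quotient, its removable singularity filled by the
    derivative.\<close>
  define K where "K = (\<lambda>\<mu> i. if \<mu> = of_real \<kappa> then deriv (\<lambda>\<mu>. H \<mu> i) (of_real \<kappa>)
    else (H \<mu> i - H (of_real \<kappa>) i) / (\<mu> - of_real \<kappa>))"
  have "(\<lambda>\<mu>. K \<mu> i) holomorphic_on ball (of_real \<kappa>) r" if "i \<in> idx" for i
    unfolding K_def using H that r by (intro pole_lemma) (auto simp: resolvent_numerator_def)
  moreover have "row \<mu> (K \<mu>) i = (if i = Inl w then (\<mu> - of_real \<kappa>) ^ Suc p else 0)"
    if \<mu>: "\<mu> \<in> ball (of_real \<kappa>) r - {of_real \<kappa>}" and i: "i \<in> idx" for \<mu> i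
  proof -
    have "row \<mu> (K \<mu>) i = row \<mu> (\<lambda>i. inverse (\<mu> - of_real \<kappa>) * H \<mu> i) i"
      using \<mu> by (intro row_cong i) (auto simp: K_def 0 field_simps)
    also have "\<dots> = inverse (\<mu> - of_real \<kappa>) * row \<mu> (H \<mu>) i" by (rule row_scale)
    also have "row \<mu> (H \<mu>) i = (if i = Inl w then (\<mu> - of_real \<kappa>) ^ Suc (Suc p) else 0)"
      using H \<mu> i unfolding resolvent_numerator_def by blast
    finally show ?thesis using \<mu> by (simp add: mult.assoc[symmetric])
  qed
  ultimately show ?thesis unfolding resolvent_numerator_def by blast
qed

lemma numerator_reduce_all:
  assumes "resolvent_numerator \<kappa> r w (Suc p) H" "w \<in> V"
  shows "\<exists>K. resolvent_numerator \<kappa> r w 1 K"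
  using assms(1)
proof (induction p arbitrary: H)
  case (Suc p)
  then show ?case using numerator_reduce assms(2) by blast
qed auto

text \<open>Guarantees a positive exponent also when the determinant does not vanish at \<kappa>, so
  that regular points are covered by the same argument.\<close>

lemma numerator_shift:
  assumes "resolvent_numerator \<kappa> r w p H"
  shows "resolvent_numerator \<kappa> r w (Suc p) (\<lambda>\<mu> i. (\<mu> - of_real \<kappa>) * H \<mu> i)"
  using assms unfolding resolvent_numerator_def row_scale
  by (auto intro!: holomorphic_intros)

end

section \<open>Residue of the Titchmarsh-Weyl matrix\<close>

lemma kernel_combination:
  assumes "finite A" "\<And>l. l \<in> A \<Longrightarrow> kernel \<mu> (x l)"
  shows "kernel \<mu> (\<lambda>i. \<Sum>l\<in>A. y l * x l i)"
  using assms by (simp add: kernel_def matched_combination linear_combination)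

lemma tw_solution_iff:
  assumes "\<mu> \<noteq> 0" "w \<in> V"
  shows "tw_solution V E org trm L w \<mu> f \<longleftrightarrow>
    (\<exists>x. f = graph_fun \<mu> x \<and> (\<forall>i\<in>idx. row \<mu> x i = (if i = Inl w then 1 else 0)))"
proof -
  have "(\<forall>i\<in>idx. row \<mu> x i = (if i = Inl w then 1 else 0)) \<longleftrightarrow>
      matched \<mu> x \<and> flux \<mu> x w = 1 \<and> (\<forall>v\<in>V - {w}. flux \<mu> x v = 0)" for x
    using assms(2) by (auto simp: idx_def row_def matched_def ball_Un)
  then show ?thesis
    by (auto simp: tw_solution_def graph_solutions_iff[OF assms(1)] normal_derivative_gf[OF assms(1)])
qed

text \<open>The residue is described through its kernel: y lies in it iff y annihilates the boundary
  values of all eigenfunctions. This is enough for the rank and avoids an orthonormal basis of the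
  eigenspace.\<close>

lemma residue_structure:
  assumes \<kappa>: "\<kappa> > 0" and vs: "set vs \<subseteq> V"
  defines "m \<equiv> length vs"
  obtains r H where "r > 0"
    "\<And>k l. k < m \<Longrightarrow> l < m \<Longrightarrow> (\<lambda>\<mu>. H \<mu> k l) holomorphic_on ball (complex_of_real \<kappa>) r"
    "\<And>\<mu> k l. k < m \<Longrightarrow> l < m \<Longrightarrow> \<mu> \<in> ball (of_real \<kappa>) r - {of_real \<kappa>} \<Longrightarrow>
       tw_matrix V E org trm L vs \<mu> $$ (k, l) = H \<mu> k l / (\<mu> - of_real \<kappa>)"
    "\<And>y. (\<forall>k<m. (\<Sum>l<m. H (of_real \<kappa>) k l * y l) = 0) \<longleftrightarrow>
       (\<forall>x. kernel (of_real \<kappa>) x \<longrightarrow> (\<Sum>l<m. x (Inl (vs ! l)) * y l) = 0)"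
proof -
  let ?S = "{\<mu>. Re \<mu> > 0}" and ?\<kappa> = "complex_of_real \<kappa>"
  have S: "open ?S" "connected ?S" "?\<kappa> \<in> ?S"
    using \<kappa> by (auto simp: open_halfspace_Re_gt convex_halfspace_Re_gt convex_connected)
  obtain d B where d: "d holomorphic_on ?S"
    and B: "\<And>i j. i \<in> idx \<Longrightarrow> j \<in> idx \<Longrightarrow> (\<lambda>\<mu>. B \<mu> i j) holomorphic_on ?S"
    and right: "\<And>\<mu> i j. i \<in> idx \<Longrightarrow> j \<in> idx \<Longrightarrow> (\<Sum>k\<in>idx. entry \<mu> i k * B \<mu> k j) = (if i = j then d \<mu> else 0)"
    and left: "\<And>\<mu> i j. i \<in> idx \<Longrightarrow> j \<in> idx \<Longrightarrow> (\<Sum>k\<in>idx. B \<mu> i k * entry \<mu> k j) = (if i = j then d \<mu> else 0)"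
    and sing: "\<And>\<mu>. d \<mu> = 0 \<Longrightarrow> \<exists>x. (\<exists>i\<in>idx. x i \<noteq> 0) \<and> (\<forall>i\<in>idx. (\<Sum>k\<in>idx. entry \<mu> i k * x k) = 0)"
    by (rule holomorphic_adjugate[where A = entry and S = ?S, OF finite_idx entry_holomorphic]) (rule that)
  \<comment> \<open>At a nonreal point of the half plane \<open>nonreal_injective\<close> makes the
    system injective, so d does not vanish identically.\<close>
  have d1: "d (Complex \<kappa> 1) \<noteq> 0"
  proof
    assume "d (Complex \<kappa> 1) = 0"
    then obtain x where x: "\<exists>i\<in>idx. x i \<noteq> 0" "\<forall>i\<in>idx. row (Complex \<kappa> 1) x i = 0"
      using sing row_entry by metis
    then have "matched (Complex \<kappa> 1) x" "\<And>v. v \<in> V \<Longrightarrow> flux (Complex \<kappa> 1) x v = 0"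
      using row_eq_0_iff by blast+
    then show False using nonreal_injective[of "Complex \<kappa> 1" x] x(1) \<kappa> by (auto simp: idx_def)
  qed
  \<comment> \<open>Split off the zero of d at \<kappa>: d is (mu - \<kappa>)^p times the zero-free
    h, with p = 0 if d does not vanish there.\<close>
  obtain r h p where r: "r > 0" "ball ?\<kappa> r \<subseteq> ?S" "h holomorphic_on ball ?\<kappa> r"
    and h: "\<And>\<mu>. \<mu> \<in> ball ?\<kappa> r \<Longrightarrow> h \<mu> \<noteq> 0" "\<And>\<mu>. \<mu> \<in> ball ?\<kappa> r \<Longrightarrow> d \<mu> = (\<mu> - ?\<kappa>) ^ p * h \<mu>"
  proof (cases "d ?\<kappa> = 0")
    case True
    have "Complex \<kappa> 1 \<in> ?S" using \<kappa> by simp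
    then have "\<not> d constant_on ?S"
      using d1 S(3) True unfolding constant_on_def by metis
    then show ?thesis
      by (rule holomorphic_factor_zero_nonconstant[OF d S True]) (rule that)
  next
    case False
    have "continuous_on ?S d" using d by (rule holomorphic_on_imp_continuous_on)
    then have "open {\<mu> \<in> ?S. d \<mu> \<in> - {0}}"
      using S(1) by (intro continuous_open_preimage[unfolded vimage_def Int_def, simplified]) auto
    moreover have "?\<kappa> \<in> {\<mu> \<in> ?S. d \<mu> \<in> - {0}}" using S(3) False by simp
    ultimately obtain r where "r > 0" "ball ?\<kappa> r \<subseteq> {\<mu> \<in> ?S. d \<mu> \<in> - {0}}"
      using openE by blast
    then have "r > 0" "ball ?\<kappa> r \<subseteq> ?S" "\<And>\<mu>. \<mu> \<in> ball ?\<kappa> r \<Longrightarrow> d \<mu> \<noteq> 0" by blast+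
    then show ?thesis using that[of r d 0] d holomorphic_on_subset by auto
  qed
  have "\<exists>K. resolvent_numerator \<kappa> r w 1 K" if w: "w \<in> V" for w
  proof -
    have iw: "Inl w \<in> idx" using w by (simp add: idx_def)
    \<comment> \<open>The column of the adjugate B belonging to w solves the system with right side
      d at w; division by h turns this into (mu - \<kappa>)^p.\<close>
    have "resolvent_numerator \<kappa> r w p (\<lambda>\<mu> i. B \<mu> i (Inl w) / h \<mu>)"
      unfolding resolvent_numerator_def
    proof (intro conjI ballI)
      fix i assume "i \<in> idx"
      then have "(\<lambda>\<mu>. B \<mu> i (Inl w)) holomorphic_on ball ?\<kappa> r"
        using B iw r(2) holomorphic_on_subset by blast
      then show "(\<lambda>\<mu>. B \<mu> i (Inl w) / h \<mu>) holomorphic_on ball ?\<kappa> r"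
        using r(3) h(1) by (intro holomorphic_intros)
    next
      fix \<mu> i assume \<mu>: "\<mu> \<in> ball ?\<kappa> r - {?\<kappa>}" and i: "i \<in> idx"
      have "row \<mu> (\<lambda>i. B \<mu> i (Inl w) / h \<mu>) i = (\<Sum>k\<in>idx. entry \<mu> i k * B \<mu> k (Inl w)) / h \<mu>"
        unfolding row_entry[OF i] by (simp add: sum_divide_distrib)
      then show "row \<mu> (\<lambda>i. B \<mu> i (Inl w) / h \<mu>) i = (if i = Inl w then (\<mu> - ?\<kappa>) ^ p else 0)"
        using right[OF i iw] h[of \<mu>] \<mu> by simp
    qed
    from numerator_reduce_all[OF \<kappa> r(1,2) numerator_shift[OF \<kappa> r(1,2) this] w]
    show ?thesis .
  qed
  then obtain K where K: "\<And>w. w \<in> V \<Longrightarrow> resolvent_numerator \<kappa> r w 1 (K w)" by metis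
  define H where "H = (\<lambda>\<mu> k l. K (vs ! l) \<mu> (Inl (vs ! k)))"
  have vsV: "vs ! k \<in> V" if "k < m" for k using that vs nth_mem by (auto simp: m_def)
  have vsI: "Inl (vs ! k) \<in> idx" if "k < m" for k using vsV[OF that] by (simp add: idx_def)
  \<comment> \<open>The left adjugate gives uniqueness of solutions wherever d is nonzero, as the
    definite description in \<open>tw_matrix\<close> demands.\<close>
  have inv: "d \<mu> * x i = (\<Sum>k\<in>idx. B \<mu> i k * row \<mu> x k)" if i: "i \<in> idx" for \<mu> x i
  proof -
    have "(\<Sum>k\<in>idx. B \<mu> i k * row \<mu> x k) = (\<Sum>k\<in>idx. \<Sum>j\<in>idx. B \<mu> i k * entry \<mu> k j * x j)"
      by (intro sum.cong refl) (simp add: row_entry sum_distrib_left mult.assoc)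
    also have "\<dots> = (\<Sum>j\<in>idx. (\<Sum>k\<in>idx. B \<mu> i k * entry \<mu> k j) * x j)"
      by (subst sum.swap) (simp add: sum_distrib_right)
    also have "\<dots> = (\<Sum>j\<in>idx. if i = j then d \<mu> * x j else 0)"
      by (intro sum.cong refl) (simp add: left[OF i])
    also have "\<dots> = d \<mu> * x i" using i finite_idx by simp
    finally show ?thesis by simp
  qed
  show ?thesis
  proof (rule that[of r H])
    show "r > 0" by (rule r)
    show "(\<lambda>\<mu>. H \<mu> k l) holomorphic_on ball ?\<kappa> r" if "k < m" "l < m" for k l
      using K[OF vsV[OF that(2)]] vsI[OF that(1)] by (simp add: H_def resolvent_numerator_def)
  next
    fix \<mu> k l assume kl: "k < m" "l < m" and \<mu>: "\<mu> \<in> ball ?\<kappa> r - {?\<kappa>}"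
    have "Re \<mu> > 0" using \<mu> r(2) by blast
    then have \<mu>0: "\<mu> \<noteq> 0" by auto
    have d0: "d \<mu> \<noteq> 0" using h[of \<mu>] \<mu> by auto
    let ?w = "vs ! l"
    define x where "x = (\<lambda>i. inverse (\<mu> - ?\<kappa>) * K ?w \<mu> i)"
    have x: "row \<mu> x i = (if i = Inl ?w then 1 else 0)" if "i \<in> idx" for i
      using K[OF vsV[OF kl(2)]] \<mu> that by (simp add: x_def row_scale resolvent_numerator_def)
    have "(THE f. tw_solution V E org trm L ?w \<mu> f) = graph_fun \<mu> x"
    proof (rule the_equality)
      show "tw_solution V E org trm L ?w \<mu> (graph_fun \<mu> x)"
        using x unfolding tw_solution_iff[OF \<mu>0 vsV[OF kl(2)]] by blast
    next
      fix f assume "tw_solution V E org trm L ?w \<mu> f"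
      then obtain z where z: "f = graph_fun \<mu> z" "\<forall>i\<in>idx. row \<mu> z i = (if i = Inl ?w then 1 else 0)"
        unfolding tw_solution_iff[OF \<mu>0 vsV[OF kl(2)]] by blast
      have "d \<mu> * z i = d \<mu> * x i" if "i \<in> idx" for i
        unfolding inv[OF that] using z(2) x by (intro sum.cong) auto
      then have "z i = x i" if "i \<in> idx" for i using d0 that by simp
      then show "f = graph_fun \<mu> x" unfolding z(1) by (rule graph_fun_cong)
    qed
    moreover have "matched \<mu> x"
      unfolding matched_def
    proof
      fix e assume "e \<in> E"
      then show "edge_value \<mu> x e (L e) = x (Inl (trm e))"
        using x[of "Inr e"] by (simp add: idx_def row_def)
    qed
    ultimately have "vertex_value E org trm L (THE f. tw_solution V E org trm L ?w \<mu> f) (vs ! k) = x (Inl (vs ! k))"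
      using vertex_value_gf[OF _ vsV[OF kl(1)]] by simp
    then show "tw_matrix V E org trm L vs \<mu> $$ (k, l) = H \<mu> k l / (\<mu> - ?\<kappa>)"
      using kl by (simp add: tw_matrix_def m_def H_def x_def divide_inverse mult.commute)
  next
    fix y :: "nat \<Rightarrow> complex"
    define \<Phi> where "\<Phi> = (\<lambda>l. K (vs ! l) ?\<kappa>)"
    have ker: "kernel ?\<kappa> (\<Phi> l)" if "l < m" for l
      using numerator_kernel[OF \<kappa> r(1,2) K[OF vsV[OF that]]] by (simp add: \<Phi>_def)
    \<comment> \<open>On the eigenspace \<open>\<Phi> l\<close> represents minus the evaluation at
      the l-th vertex. With the symmetry of \<open>pair\<close>, this makes the residue matrix
      symmetric.\<close>
    have rep: "pair ?\<kappa> (\<Phi> l) ?\<kappa> x = - x (Inl (vs ! l))" if "l < m" "kernel ?\<kappa> x" for l x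
      using numerator_pair[OF \<kappa> r(1,2) K[OF vsV[OF that(1)]] _ vsV[OF that(1)] that(2)] by (simp add: \<Phi>_def)
    have sym: "\<Phi> k (Inl (vs ! l)) = \<Phi> l (Inl (vs ! k))" if "k < m" "l < m" for k l
      using rep[OF that(2) ker[OF that(1)]] rep[OF that(1) ker[OF that(2)]] pair_commute by simp
    have \<kappa>0: "?\<kappa> \<noteq> 0" using \<kappa> by simp
    define \<psi> where "\<psi> = (\<lambda>i. \<Sum>l\<in>{..<m}. y l * \<Phi> l i)"
    have \<psi>: "kernel ?\<kappa> \<psi>" unfolding \<psi>_def using ker by (intro kernel_combination) auto
    have pair_\<psi>: "pair ?\<kappa> \<psi> ?\<kappa> x = - (\<Sum>l<m. x (Inl (vs ! l)) * y l)" if "kernel ?\<kappa> x" for x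
      unfolding \<psi>_def pair_combination[OF finite_lessThan \<kappa>0 \<kappa>0]
      using rep that by (simp add: sum_negf[symmetric] mult.commute)
    show "(\<forall>k<m. (\<Sum>l<m. H ?\<kappa> k l * y l) = 0) \<longleftrightarrow>
       (\<forall>x. kernel ?\<kappa> x \<longrightarrow> (\<Sum>l<m. x (Inl (vs ! l)) * y l) = 0)"
    proof
      \<comment> \<open>If y is in the kernel of the residue, \<psi> vanishes at all vertices of vs.
        As a combination of the representers it then pairs to zero with its own conjugate, so \<psi>
        = 0.\<close>
      assume "\<forall>k<m. (\<Sum>l<m. H ?\<kappa> k l * y l) = 0"
      then have "\<psi> (Inl (vs ! k)) = 0" if "k < m" for k
        using that by (simp add: \<psi>_def \<Phi>_def H_def mult.commute)
      then have "pair ?\<kappa> \<psi> ?\<kappa> (cnj_coords \<psi>) = 0"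
        using pair_\<psi>[OF kernel_cnj[OF \<kappa> r(1,2) \<psi>]] by (simp add: cnj_coords_def)
      then have \<psi>0: "\<psi> i = 0" if "i \<in> idx" for i using kernel_definite[OF \<kappa> r(1,2) \<psi>] that by blast
      have "edge_value ?\<kappa> \<psi> e t = 0" if "e \<in> E" for e t
        using edge_value_cong(1)[OF that, of \<psi> "\<lambda>_. 0"] \<psi>0 by (simp add: edge_value_def edge_fun_def)
      then have "pair ?\<kappa> \<psi> ?\<kappa> x = 0" for x by (simp add: pair_def)
      then show "\<forall>x. kernel ?\<kappa> x \<longrightarrow> (\<Sum>l<m. x (Inl (vs ! l)) * y l) = 0" using pair_\<psi> by simp
    next
      assume *: "\<forall>x. kernel ?\<kappa> x \<longrightarrow> (\<Sum>l<m. x (Inl (vs ! l)) * y l) = 0"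
      show "\<forall>k<m. (\<Sum>l<m. H ?\<kappa> k l * y l) = 0"
      proof (intro allI impI)
        fix k assume k: "k < m"
        have "(\<Sum>l<m. H ?\<kappa> k l * y l) = (\<Sum>l<m. \<Phi> k (Inl (vs ! l)) * y l)"
          using sym[OF k] by (intro sum.cong) (auto simp: H_def \<Phi>_def)
        then show "(\<Sum>l<m. H ?\<kappa> k l * y l) = 0" using * ker[OF k] by simp
      qed
    qed
  qed
qed

end

subsection \<open>Residue matrix and eigenfunctions vanishing on the boundary set\<close>

text \<open>The integrand is the contour integrand over \<open>circlepath\<close> divided by 2 pi i.
  Hence the value does not depend on the radius, which makes the description in
  \<open>mat_residue\<close> unique.\<close>

lemma circle_residue_eq_residue:
  assumes hol: "g holomorphic_on ball a r' - {a}" and r: "0 < r" "r < r'"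
  shows "circle_residue g a r = residue g a"
proof -
  have "cball a r \<subseteq> ball a r'" using r by auto
  then have "(g has_contour_integral 2 * pi * \<i> * residue g a) (circlepath a r)"
    using hol r by (intro base_residue[of "ball a r'"]) auto
  then have "((\<lambda>s. g (circlepath a r s) * vector_derivative (circlepath a r) (at s within {0..1}))
      has_integral 2 * pi * \<i> * residue g a) {0..1}"
    by (simp add: has_contour_integral_def)
  then have "((\<lambda>s. 2 * pi * \<i> * (g (a + complex_of_real r * exp (2 * pi * \<i> * complex_of_real s)) *
      complex_of_real r * exp (2 * pi * \<i> * complex_of_real s))) has_integral 2 * pi * \<i> * residue g a) {0..1}"
  proof (rule has_integral_eq[rotated])
    fix s :: real assume "s \<in> {0..1}"
    then have "vector_derivative (circlepath a r) (at s within {0..1}) =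
        2 * pi * \<i> * r * exp (2 * of_real pi * \<i> * s)"
      by (intro vector_derivative_circlepath01) auto
    then show "g (circlepath a r s) * vector_derivative (circlepath a r) (at s within {0..1}) =
        2 * pi * \<i> * (g (a + complex_of_real r * exp (2 * pi * \<i> * complex_of_real s)) *
        complex_of_real r * exp (2 * pi * \<i> * complex_of_real s))"
      by (simp add: circlepath mult_ac)
  qed
  then have "2 * pi * \<i> * circle_residue g a r = 2 * pi * \<i> * residue g a"
    unfolding circle_residue_def by (simp add: integral_unique flip: integral_mult_right)
  then show ?thesis by simp
qed

text \<open>The residue of H / (mu - a) is the value of H at a. If that value is zero, the entry is
  a difference quotient and converges to the derivative; otherwise it tends to infinity.\<close>

lemma simple_pole_matrix:
  assumes r: "r > 0"
    and H: "\<And>k l. k < m \<Longrightarrow> l < m \<Longrightarrow> (\<lambda>\<mu>. H \<mu> k l) holomorphic_on ball a r"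
    and R: "\<And>\<mu> k l. k < m \<Longrightarrow> l < m \<Longrightarrow> \<mu> \<in> ball a r - {a} \<Longrightarrow> R \<mu> $$ (k, l) = H \<mu> k l / (\<mu> - a)"
  shows "mat_residue m a R = mat m m (\<lambda>(k, l). H a k l)"
    and "mat_is_pole m a R \<longleftrightarrow> (\<exists>k<m. \<exists>l<m. H a k l \<noteq> 0)"
proof -
  have a: "a \<in> ball a r" using r by simp
  have edge_value: "eventually (\<lambda>\<mu>. R \<mu> $$ (k, l) = H \<mu> k l / (\<mu> - a)) (at a)" if "k < m" "l < m" for k l
    using R[OF that] r unfolding eventually_at_topological
    by (intro exI[of _ "ball a r"]) auto
  have res: "residue (\<lambda>\<mu>. R \<mu> $$ (k, l)) a = H a k l" if "k < m" "l < m" for k l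
    using residue_cong[OF edge_value[OF that] refl] residue_simple[OF open_ball a H[OF that]] by simp
  show "mat_residue m a R = mat m m (\<lambda>(k, l). H a k l)"
    unfolding mat_residue_def
  proof (rule the_equality)
    have hol: "(\<lambda>\<mu>. R \<mu> $$ (k, l)) holomorphic_on ball a r - {a}" if kl: "k < m" "l < m" for k l
    proof -
      have "(\<lambda>\<mu>. H \<mu> k l / (\<mu> - a)) holomorphic_on ball a r - {a}"
        using holomorphic_on_subset[OF H[OF kl], of "ball a r - {a}"] by (intro holomorphic_intros) auto
      then show ?thesis using R[OF kl] by (subst holomorphic_cong[OF refl]) auto
    qed
    moreover have "mat m m (\<lambda>(k, l). H a k l) $$ (k, l) = circle_residue (\<lambda>\<mu>. R \<mu> $$ (k, l)) a (r / 2)"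
      if "k < m" "l < m" for k l
      using circle_residue_eq_residue[OF hol[OF that], of "r / 2"] res[OF that] that r by simp
    ultimately show "mat m m (\<lambda>(k, l). H a k l) \<in> carrier_mat m m \<and> (\<exists>s r'. 0 < s \<and> s < r' \<and>
      (\<forall>k<m. \<forall>l<m. (\<lambda>\<mu>. R \<mu> $$ (k, l)) holomorphic_on (ball a r' - {a})) \<and>
      (\<forall>k<m. \<forall>l<m. mat m m (\<lambda>(k, l). H a k l) $$ (k, l) = circle_residue (\<lambda>\<mu>. R \<mu> $$ (k, l)) a s))"
      using r by (intro conjI exI[of _ "r / 2"] exI[of _ r]) auto
  next
    fix A assume "A \<in> carrier_mat m m \<and> (\<exists>s r'. 0 < s \<and> s < r' \<and>
      (\<forall>k<m. \<forall>l<m. (\<lambda>\<mu>. R \<mu> $$ (k, l)) holomorphic_on (ball a r' - {a})) \<and>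
      (\<forall>k<m. \<forall>l<m. A $$ (k, l) = circle_residue (\<lambda>\<mu>. R \<mu> $$ (k, l)) a s))"
    then obtain s r' where A: "A \<in> carrier_mat m m" "0 < s" "s < r'"
      "\<And>k l. k < m \<Longrightarrow> l < m \<Longrightarrow> (\<lambda>\<mu>. R \<mu> $$ (k, l)) holomorphic_on (ball a r' - {a})"
      "\<And>k l. k < m \<Longrightarrow> l < m \<Longrightarrow> A $$ (k, l) = circle_residue (\<lambda>\<mu>. R \<mu> $$ (k, l)) a s" by blast
    have "A $$ (k, l) = H a k l" if "k < m" "l < m" for k l
      using A(5)[OF that] circle_residue_eq_residue[OF A(4)[OF that] A(2,3)] res[OF that] by simp
    then show "A = mat m m (\<lambda>(k, l). H a k l)" using A(1) by (intro eq_matI) auto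
  qed
  have "filterlim (\<lambda>\<mu>. R \<mu> $$ (k, l)) at_infinity (at a) \<longleftrightarrow> H a k l \<noteq> 0" if kl: "k < m" "l < m" for k l
  proof -
    have "filterlim (\<lambda>\<mu>. R \<mu> $$ (k, l)) at_infinity (at a) \<longleftrightarrow>
        filterlim (\<lambda>\<mu>. H \<mu> k l / (\<mu> - a)) at_infinity (at a)"
      by (rule filterlim_cong[OF refl refl edge_value[OF kl]])
    also have "\<dots> \<longleftrightarrow> H a k l \<noteq> 0"
    proof
      assume lim: "filterlim (\<lambda>\<mu>. H \<mu> k l / (\<mu> - a)) at_infinity (at a)"
      show "H a k l \<noteq> 0"
      proof
        assume 0: "H a k l = 0"
        obtain D where "((\<lambda>\<mu>. H \<mu> k l) has_field_derivative D) (at a)"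
          using holomorphic_on_imp_differentiable_at[OF H[OF kl] open_ball a]
          by (auto simp: field_differentiable_def)
        then have "((\<lambda>\<mu>. H \<mu> k l / (\<mu> - a)) \<longlongrightarrow> D) (at a)"
          using 0 by (simp add: has_field_derivative_iff)
        then show False using lim not_tendsto_and_filterlim_at_infinity[OF at_neq_bot] by blast
      qed
    next
      assume ne: "H a k l \<noteq> 0"
      have "continuous_on (ball a r) (\<lambda>\<mu>. H \<mu> k l)"
        using H[OF kl] by (rule holomorphic_on_imp_continuous_on)
      then have "((\<lambda>\<mu>. H \<mu> k l) \<longlongrightarrow> H a k l) (at a)"
        using a continuous_on_eq_continuous_at[OF open_ball] by (metis continuous_at)
      moreover have "filterlim (\<lambda>\<mu>. \<mu> - a) (at 0) (at a)"
        by (auto simp: filterlim_at intro!: tendsto_eq_intros eventually_at_filter[THEN iffD2])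
      ultimately show "filterlim (\<lambda>\<mu>. H \<mu> k l / (\<mu> - a)) at_infinity (at a)"
        using ne by (rule filterlim_divide_at_infinity)
    qed
    finally show ?thesis .
  qed
  then show "mat_is_pole m a R \<longleftrightarrow> (\<exists>k<m. \<exists>l<m. H a k l \<noteq> 0)"
    unfolding mat_is_pole_def by blast
qed

lemma dim_supported_functions:
  fixes I :: "'i set"
  assumes I: "finite I"
  defines "Y \<equiv> {y :: 'i \<Rightarrow> complex. \<forall>i. i \<notin> I \<longrightarrow> y i = 0}"
  shows "vector_space.dim (\<lambda>(c::complex) y i. c * y i) Y = card I"
    and "Modules.module.subspace (\<lambda>(c::complex) y i. c * y i) Y"
    and "\<exists>B. finite B \<and> Y \<subseteq> Modules.module.span (\<lambda>(c::complex) y i. c * y i) B"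
proof -
  interpret vector_space "\<lambda>(c::complex) (y :: 'i \<Rightarrow> complex) i. c * y i"
    by (rule vector_space_fun)
  let ?u = "\<lambda>j i. if i = j then 1 else (0::complex)"
  have app: "(\<Sum>j\<in>J. (\<lambda>i. c j * ?u j i)) i = (\<Sum>j\<in>J. c j * ?u j i)" for c J i
    by (induction J rule: infinite_finite_induct) auto
  have val: "(\<Sum>j\<in>I. (\<lambda>i. c j * ?u j i)) i = (if i \<in> I then c i else 0)" for c i
  proof -
    have "(\<Sum>j\<in>I. c j * ?u j i) = (\<Sum>j\<in>I. if i = j then c j else 0)" by (intro sum.cong) auto
    then show ?thesis unfolding app using I by simp
  qed
  have Y: "Y = {\<Sum>j\<in>I. (\<lambda>i. c j * ?u j i) | c. True}"
  proof (intro equalityI subsetI)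
    fix y assume "y \<in> Y"
    then have "y = (\<Sum>j\<in>I. (\<lambda>i. y j * ?u j i))" unfolding fun_eq_iff val by (auto simp: Y_def)
    then show "y \<in> {\<Sum>j\<in>I. (\<lambda>i. c j * ?u j i) | c. True}" by blast
  next
    fix y assume "y \<in> {\<Sum>j\<in>I. (\<lambda>i. c j * ?u j i) | c. True}"
    then show "y \<in> Y" using val by (auto simp: Y_def)
  qed
  show "subspace Y" unfolding Y by (rule subspace_family)
  show "dim Y = card I" unfolding Y
  proof (rule dim_family[OF I])
    fix c i assume "(\<Sum>j\<in>I. (\<lambda>i. c j * ?u j i)) = 0" "i \<in> I"
    then show "c i = 0" using val[of c i] by simp
  qed
  show "\<exists>B. finite B \<and> Y \<subseteq> span B"
    unfolding Y using span_family[OF I, of _ ?u] I by (intro exI[of _ "?u ` I"]) auto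
qed

lemma vector_space_edge_fun: "vector_space (\<lambda>(c::complex) f. (\<lambda>(e::'e) (x::real). c * f e x))"
  by unfold_locales (auto simp: algebra_simps fun_eq_iff)

section \<open>Unique continuation for eigenfunctions vanishing on the boundary set\<close>

context kirchhoff_graph
begin

text \<open>S collects the edges on which the eigenfunction vanishes identically. Its complement
  spans no vertex of degree one and so lies in the core; hence a vertex without an edge of S is a
  proper core vertex and belongs to B.\<close>

lemma vanishing_at_vertices:
  assumes \<mu>: "\<mu> \<noteq> 0" and ker: "kernel \<mu> x"
    and boundary: "boundary_vertices V E org trm \<subseteq> B" and core: "proper_core_vertices V E org trm \<subseteq> B"
    and B: "\<And>v. v \<in> B \<Longrightarrow> x (Inl v) = 0" and v: "v \<in> V"
  shows "x (Inl v) = 0"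
proof -
  define S where "S = {e \<in> E. x (Inl (org e)) = 0 \<and> x (Inr e) = 0}"
  have matched: "edge_value \<mu> x e (L e) = x (Inl (trm e))" if "e \<in> E" for e
    using ker that by (simp add: kernel_def matched_def)
  have S: "x (Inl (org e)) = 0" "x (Inl (trm e)) = 0" "x (Inr e) = 0" "end_deriv \<mu> x e = 0" if "e \<in> S" for e
    using that matched[of e] by (auto simp: S_def edge_value_def end_deriv_def edge_fun_def edge_deriv_def)
  \<comment> \<open>The Cauchy data at the terminal end determine those at the origin, because the
    Wronskian is 1.\<close>
  have solve: "e \<in> S" if e: "e \<in> E" and 0: "x (Inl (trm e)) = 0" "end_deriv \<mu> x e = 0" for e
  proof -
    let ?a = "x (Inl (org e))" and ?b = "x (Inr e)" and ?c = "cos_sol \<mu> (L e)" and ?s = "sin_sol \<mu> (L e)"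
    have 1: "?a * ?c + ?b * ?s = 0" using matched[OF e] 0 by (simp add: edge_value_def edge_fun_def)
    have 2: "?b * ?c - \<mu> * ?a * ?s = 0" using 0 by (simp add: end_deriv_def edge_deriv_def)
    have "?a * (?c * ?c + \<mu> * (?s * ?s)) = ?c * (?a * ?c + ?b * ?s) - ?s * (?b * ?c - \<mu> * ?a * ?s)"
      "?b * (?c * ?c + \<mu> * (?s * ?s)) = ?c * (?b * ?c - \<mu> * ?a * ?s) + \<mu> * ?s * (?a * ?c + ?b * ?s)"
      by (simp_all add: algebra_simps)
    then have "?a = 0" "?b = 0" unfolding cos_sin_sol_sq[OF \<mu>] 1 2 by simp_all
    then show ?thesis using e by (simp add: S_def)
  qed
  have "degree (E - S) org trm w \<noteq> 1" for w
  proof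
    assume deg: "degree (E - S) org trm w = 1"
    let ?O = "{e \<in> E - S. org e = w}" and ?T = "{e \<in> E - S. trm e = w}"
    have fin: "finite ?O" "finite ?T" using finite_E by auto
    have one: "card ?O + card ?T = 1" using deg by (simp add: degree_def)
    from one have "card ?O = 1 \<and> card ?T = 0 \<or> card ?T = 1 \<and> card ?O = 0" by arith
    then have cases: "card ?O = 1 \<and> ?T = {} \<or> card ?T = 1 \<and> ?O = {}"
      unfolding card_0_eq[OF fin(1)] card_0_eq[OF fin(2)] .
    have w: "w \<in> V"
    proof -
      have "card ?O \<noteq> 0 \<or> card ?T \<noteq> 0" using one by arith
      then have "?O \<noteq> {} \<or> ?T \<noteq> {}" unfolding card_0_eq[OF fin(1)] card_0_eq[OF fin(2)] .
      then show ?thesis using org_in trm_in by blast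
    qed
    \<comment> \<open>An edge of S at w carries the value 0 there; without one, w has degree one in
      the whole graph and lies in B.\<close>
    have w0: "x (Inl w) = 0"
    proof (cases "\<exists>e\<in>S. org e = w \<or> trm e = w")
      case True
      then show ?thesis using S by auto
    next
      case False
      then have "{e \<in> E. org e = w} = ?O" "{e \<in> E. trm e = w} = ?T" by auto
      then have "degree E org trm w = 1" using deg by (simp add: degree_def)
      then show ?thesis using boundary B w by (auto simp: boundary_vertices_def)
    qed
    have "(\<Sum>e\<in>{e\<in>E. trm e = w}. end_deriv \<mu> x e) = (\<Sum>e\<in>?T. end_deriv \<mu> x e)"
      "(\<Sum>e\<in>{e\<in>E. org e = w}. x (Inr e)) = (\<Sum>e\<in>?O. x (Inr e))"
      using S finite_E by (auto intro!: sum.mono_neutral_right)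
    moreover have "flux \<mu> x w = 0" using ker w by (simp add: kernel_def)
    ultimately have fl: "(\<Sum>e\<in>?T. end_deriv \<mu> x e) = (\<Sum>e\<in>?O. x (Inr e))" by (simp add: flux_def)
    \<comment> \<open>The Kirchhoff condition leaves one derivative, that of the only edge outside S
      at w, which is therefore zero. With value and derivative zero at w this edge would belong to
      S.\<close>
    from cases show False
    proof (elim disjE conjE)
      assume 1: "card ?O = 1" "?T = {}"
      then obtain e where e: "?O = {e}" by (auto simp: card_1_singleton_iff)
      have "x (Inr e) = 0" using fl unfolding 1(2) e by simp
      moreover have "e \<in> E - S" "org e = w" using e by auto
      ultimately show False using w0 by (simp add: S_def)
    next
      assume 2: "card ?T = 1" "?O = {}"
      then obtain e where e: "?T = {e}" by (auto simp: card_1_singleton_iff)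
      have "end_deriv \<mu> x e = 0" using fl unfolding 2(2) e by simp
      moreover have "e \<in> E - S" "trm e = w" using e by auto
      ultimately show False using w0 solve[of e] by simp
    qed
  qed
  then have F: "E - S \<subseteq> core_edges E org trm" unfolding core_edges_def by blast
  show ?thesis
  proof (cases "\<exists>e\<in>S. org e = v \<or> trm e = v")
    case True
    then show ?thesis using S by auto
  next
    case False
    then have "\<forall>e\<in>E. org e = v \<or> trm e = v \<longrightarrow> e \<in> core_edges E org trm" using F by blast
    then have "v \<in> proper_core_vertices V E org trm"
      using v no_isolated unfolding proper_core_vertices_def by blast
    then show ?thesis using core B by blast
  qed
qed

end

subsection \<open>Dimension of the eigenspace\<close>

context kirchhoff_graph
begin

lemma eigenspace_eq:
  assumes "\<mu> \<noteq> 0"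
  shows "kirchhoff_eigenspace V E org trm L \<mu> = {graph_fun \<mu> x | x. kernel \<mu> x}"
  using graph_solutions_iff[OF assms] normal_derivative_gf[OF assms]
  by (auto simp: kirchhoff_eigenspace_def kernel_def)

lemma graph_fun_add: "graph_fun \<mu> (\<lambda>i. x i + y i) = graph_fun \<mu> x + graph_fun \<mu> y"
  by (auto simp: graph_fun_def edge_value_def edge_fun_def fun_eq_iff algebra_simps)

lemma graph_fun_scale: "graph_fun \<mu> (\<lambda>i. c * x i) = (\<lambda>e t. c * graph_fun \<mu> x e t)"
  by (auto simp: graph_fun_def edge_value_def edge_fun_def fun_eq_iff algebra_simps)

lemma kernel_add: "kernel \<mu> x \<Longrightarrow> kernel \<mu> y \<Longrightarrow> kernel \<mu> (\<lambda>i. x i + y i)"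
  using kernel_combination[of "UNIV :: bool set" \<mu> "\<lambda>b. if b then x else y" "\<lambda>_. 1"]
  by (simp add: UNIV_bool add.commute)

lemma kernel_scale: "kernel \<mu> x \<Longrightarrow> kernel \<mu> (\<lambda>i. c * x i)"
  using kernel_combination[of "{()}" \<mu> "\<lambda>_. x" "\<lambda>_. c"] by simp

text \<open>The finite spanning set consists of the images of the unit coordinate vectors, which are
  in general not eigenfunctions themselves.\<close>

lemma eigenspace_subspace:
  assumes "\<mu> \<noteq> 0"
  defines "sc \<equiv> (\<lambda>(c::complex) f. (\<lambda>(e::'e) (t::real). c * f e t))"
  shows "Modules.module.subspace sc {graph_fun \<mu> x | x. kernel \<mu> x}"
    and "\<exists>B. finite B \<and> {graph_fun \<mu> x | x. kernel \<mu> x} \<subseteq> Modules.module.span sc B"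
proof -
  interpret vector_space sc unfolding sc_def by (rule vector_space_edge_fun)
  show "subspace {graph_fun \<mu> x | x. kernel \<mu> x}"
    unfolding subspace_def
  proof (intro conjI ballI allI)
    have "kernel \<mu> (\<lambda>_. 0)" by (simp add: kernel_def matched_def flux_def edge_value_def end_deriv_def edge_fun_def edge_deriv_def)
    moreover have "graph_fun \<mu> (\<lambda>_. 0) = 0" by (auto simp: graph_fun_def edge_value_def edge_fun_def fun_eq_iff)
    ultimately show "0 \<in> {graph_fun \<mu> x | x. kernel \<mu> x}" by (metis (mono_tags, lifting) mem_Collect_eq)
  next
    fix f g assume "f \<in> {graph_fun \<mu> x | x. kernel \<mu> x}" "g \<in> {graph_fun \<mu> x | x. kernel \<mu> x}"
    then show "f + g \<in> {graph_fun \<mu> x | x. kernel \<mu> x}" using graph_fun_add[of \<mu>] kernel_add[of \<mu>] by (clarsimp) metis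
  next
    fix c f assume "f \<in> {graph_fun \<mu> x | x. kernel \<mu> x}"
    then show "sc c f \<in> {graph_fun \<mu> x | x. kernel \<mu> x}"
      unfolding sc_def using graph_fun_scale[of \<mu>] kernel_scale[of \<mu>] by (clarsimp) metis
  qed
  have "graph_fun \<mu> x \<in> span ((\<lambda>j. graph_fun \<mu> (\<lambda>i. if i = j then 1 else 0)) ` idx)" for x
  proof -
    have app: "(\<Sum>j\<in>J. sc (c j) (h j)) e t = (\<Sum>j\<in>J. c j * h j e t)" for J c h e t
      by (induction J rule: infinite_finite_induct) (auto simp: sc_def)
    have "(\<Sum>j\<in>idx. x j * (if k = j then 1 else 0)) = x k" if "k \<in> idx" for k
    proof -
      have "(\<Sum>j\<in>idx. x j * (if k = j then 1 else 0)) = (\<Sum>j\<in>idx. if k = j then x j else 0)"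
        by (intro sum.cong) auto
      then show ?thesis using that finite_idx by simp
    qed
    then have "graph_fun \<mu> x = graph_fun \<mu> (\<lambda>k. \<Sum>j\<in>idx. x j * (if k = j then 1 else 0))"
      by (intro graph_fun_cong) simp
    also have "\<dots> = (\<Sum>j\<in>idx. sc (x j) (graph_fun \<mu> (\<lambda>i. if i = j then 1 else 0)))"
      by (intro ext) (simp only: app linear_combination(3)[OF finite_idx])
    finally show ?thesis using span_family[OF finite_idx] by simp
  qed
  then show "\<exists>B. finite B \<and> {graph_fun \<mu> x | x. kernel \<mu> x} \<subseteq> span B"
    using finite_idx by (intro exI[of _ "(\<lambda>j. graph_fun \<mu> (\<lambda>i. if i = j then 1 else 0)) ` idx"]) auto
qed

text \<open>Apply \<open>bilinear_rank_eq\<close> to the eigenspace and the coefficient vectors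
  supported on J, paired by evaluation at vertices. Independence of the columns in J makes the right
  kernel zero; because they span, the left kernel consists of the eigenfunctions that vanish on all
  of \<open>set vs\<close>.\<close>

lemma dim_eigenspace_residue:
  assumes \<kappa>: "\<kappa> > 0" and vs: "set vs \<subseteq> V" and J: "J \<subseteq> {..<length vs}"
    and A: "\<And>y. (\<forall>k<length vs. (\<Sum>l<length vs. A k l * y l) = 0) \<longleftrightarrow>
       (\<forall>x. kernel (complex_of_real \<kappa>) x \<longrightarrow> (\<Sum>l<length vs. x (Inl (vs ! l)) * y l) = 0)"
    and ind: "\<And>y j. \<forall>i<length vs. (\<Sum>j\<in>J. A i j * y j) = 0 \<Longrightarrow> j \<in> J \<Longrightarrow> y j = 0"
    and spanning: "\<And>l. l < length vs \<Longrightarrow> \<exists>a. \<forall>i<length vs. A i l = (\<Sum>j\<in>J. A i j * a j)"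
  shows "cdim {graph_fun \<kappa> x | x. kernel \<kappa> x} =
    card J + cdim {graph_fun \<kappa> x | x. kernel \<kappa> x \<and> (\<forall>v\<in>set vs. x (Inl v) = 0)}"
proof -
  let ?m = "length vs" and ?\<kappa> = "complex_of_real \<kappa>"
  let ?sc = "\<lambda>(c::complex) f. (\<lambda>(e::'e) (t::real). c * f e t)"
  let ?sin_sol = "\<lambda>(c::complex) (y :: nat \<Rightarrow> complex) i. c * y i"
  interpret p: vector_space_pair ?sc ?sin_sol
    unfolding vector_space_pair_def using vector_space_edge_fun vector_space_fun by blast
  have \<kappa>0: "?\<kappa> \<noteq> 0" using \<kappa> by simp
  let ?K = "{graph_fun ?\<kappa> x | x. kernel ?\<kappa> x}"
  let ?Y = "{y :: nat \<Rightarrow> complex. \<forall>i. i \<notin> J \<longrightarrow> y i = 0}"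
  have finJ: "finite J" using J finite_subset by blast
  have vsV: "vs ! k \<in> V" if "k < ?m" for k using that vs nth_mem by auto
  define b where "b = (\<lambda>f (y :: nat \<Rightarrow> complex). \<Sum>l\<in>J. vertex_value E org trm L f (vs ! l) * y l)"
  have b: "b (graph_fun ?\<kappa> x) y = (\<Sum>l\<in>J. x (Inl (vs ! l)) * y l)" if "kernel ?\<kappa> x" for x y
    unfolding b_def using that J vsV vertex_value_gf[of ?\<kappa> x] by (intro sum.cong) (auto simp: kernel_def)
  have extend: "(\<Sum>l\<in>J. g l * y l) = (\<Sum>l<?m. g l * (if l \<in> J then y l else 0))" for g y :: "nat \<Rightarrow> complex"
    using J by (intro sum.mono_neutral_cong_left) auto
  obtain BX where BX: "finite BX" "?K \<subseteq> p.vs1.span BX" using eigenspace_subspace(2)[OF \<kappa>0] by blast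
  obtain BY where BY: "finite BY" "?Y \<subseteq> p.vs2.span BY" using dim_supported_functions(3)[OF finJ] by blast
  have "p.vs1.dim ?K + p.vs2.dim {y \<in> ?Y. \<forall>f\<in>?K. b f y = 0} =
      p.vs2.dim ?Y + p.vs1.dim {f \<in> ?K. \<forall>y\<in>?Y. b f y = 0}"
  proof (rule p.bilinear_rank_eq[OF eigenspace_subspace(1)[OF \<kappa>0] BX dim_supported_functions(2)[OF finJ] BY])
    fix f g y assume "f \<in> ?K" "g \<in> ?K"
    then obtain x z where "kernel ?\<kappa> x" "kernel ?\<kappa> z" "f = graph_fun ?\<kappa> x" "g = graph_fun ?\<kappa> z" by blast
    then show "b (f + g) y = b f y + b g y"
      using kernel_add[of ?\<kappa> x z] by (simp add: graph_fun_add[symmetric] b algebra_simps sum.distrib)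
  next
    fix c f y assume "f \<in> ?K"
    then obtain x where "kernel ?\<kappa> x" "f = graph_fun ?\<kappa> x" by blast
    then show "b (\<lambda>e t. c * f e t) y = c * b f y"
      using kernel_scale[of ?\<kappa> x c] by (simp add: graph_fun_scale[symmetric] b sum_distrib_left mult.assoc)
  qed (simp_all add: b_def algebra_simps sum.distrib sum_distrib_left)
  moreover have "{y \<in> ?Y. \<forall>f\<in>?K. b f y = 0} = {0}"
  proof (intro equalityI subsetI)
    fix y assume "y \<in> {y \<in> ?Y. \<forall>f\<in>?K. b f y = 0}"
    then have y: "\<And>i. i \<notin> J \<Longrightarrow> y i = 0" "\<And>x. kernel ?\<kappa> x \<Longrightarrow> (\<Sum>l\<in>J. x (Inl (vs ! l)) * y l) = 0"
      using b by auto
    have "(\<Sum>l\<in>J. A k l * y l) = 0" if "k < ?m" for k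
      unfolding extend using A[of "\<lambda>l. if l \<in> J then y l else 0"] y(2) that unfolding extend by blast
    then have "y j = 0" if "j \<in> J" for j using ind that by blast
    then show "y \<in> {0}" using y(1) by (auto simp: fun_eq_iff)
  qed (auto simp: b_def)
  moreover have "{f \<in> ?K. \<forall>y\<in>?Y. b f y = 0} = {graph_fun ?\<kappa> x | x. kernel ?\<kappa> x \<and> (\<forall>v\<in>set vs. x (Inl v) = 0)}"
  proof (intro equalityI subsetI)
    fix f assume "f \<in> {f \<in> ?K. \<forall>y\<in>?Y. b f y = 0}"
    then obtain x where x: "f = graph_fun ?\<kappa> x" "kernel ?\<kappa> x" "\<And>y. y \<in> ?Y \<Longrightarrow> b (graph_fun ?\<kappa> x) y = 0" by blast
    have xJ: "x (Inl (vs ! j)) = 0" if "j \<in> J" for j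
    proof -
      have "(\<Sum>l\<in>J. x (Inl (vs ! l)) * (if l = j then 1 else 0)) = 0"
        using x(3)[of "\<lambda>l. if l = j then 1 else 0"] that unfolding b[OF x(2)] by auto
      moreover have "(\<Sum>l\<in>J. x (Inl (vs ! l)) * (if l = j then 1 else 0)) = (\<Sum>l\<in>{j}. x (Inl (vs ! l)))"
        using finJ that by (intro sum.mono_neutral_cong_right) auto
      ultimately show ?thesis by simp
    qed
    have "x (Inl (vs ! l)) = 0" if l: "l < ?m" for l
    proof -
      obtain a where a: "\<And>i. i < ?m \<Longrightarrow> A i l = (\<Sum>j\<in>J. A i j * a j)" using spanning[OF l] by blast
      \<comment> \<open>y encodes the relation expressing column l by the columns in J. It lies in
        the kernel of the matrix, so by A the values of an eigenfunction satisfy the same relation,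
        and vanishing at J forces vanishing at l.\<close>
      define y where "y = (\<lambda>j. (if j = l then 1 else 0) - (if j \<in> J then a j else 0))"
      have split: "(\<Sum>j<?m. g j * y j) = g l - (\<Sum>j\<in>J. g j * a j)" for g
      proof -
        have "(\<Sum>j<?m. g j * y j) = (\<Sum>j<?m. if j = l then g j else 0) - (\<Sum>j<?m. g j * (if j \<in> J then a j else 0))"
          unfolding sum_subtractf[symmetric] y_def by (intro sum.cong) (auto simp: algebra_simps)
        then show ?thesis using l by (simp add: extend)
      qed
      have "\<forall>k<?m. (\<Sum>j<?m. A k j * y j) = 0" using a by (simp add: split)
      then have "(\<Sum>j<?m. x (Inl (vs ! j)) * y j) = 0" using A[of y] x(2) by blast
      then show ?thesis using xJ by (simp add: split)
    qed
    then have "\<forall>v\<in>set vs. x (Inl v) = 0" by (metis in_set_conv_nth)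
    then show "f \<in> {graph_fun ?\<kappa> x | x. kernel ?\<kappa> x \<and> (\<forall>v\<in>set vs. x (Inl v) = 0)}" using x by blast
  next
    fix f assume "f \<in> {graph_fun ?\<kappa> x | x. kernel ?\<kappa> x \<and> (\<forall>v\<in>set vs. x (Inl v) = 0)}"
    then obtain x where x: "f = graph_fun ?\<kappa> x" "kernel ?\<kappa> x" "\<forall>v\<in>set vs. x (Inl v) = 0" by blast
    have "x (Inl (vs ! j)) = 0" if "j \<in> J" for j using x(3) J that by auto
    then show "f \<in> {f \<in> ?K. \<forall>y\<in>?Y. b f y = 0}" using x b by auto
  qed
  moreover have "p.vs2.dim {0} = 0"
    using p.vs2.dim_le_card[of "{0}" "{}"] by simp
  ultimately show ?thesis
    using dim_supported_functions(1)[OF finJ] by (simp add: cdim_def)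
qed

text \<open>Apply \<open>bilinear_rank_eq\<close> to the sines on the edges of G_lam and the
  functions on its vertices, paired by summing flux times value. The left kernel is cut out by the
  Kirchhoff conditions; the right kernel consists of the potentials, counted by
  \<open>dim_potentials\<close>. The value 1 off G_lam makes sg a sign function on all
  edges.\<close>

lemma dim_dirichlet_eigenspace:
  assumes \<kappa>: "\<kappa> > 0"
  defines "El \<equiv> lambda_edges E L \<kappa>"
    and "sg \<equiv> (\<lambda>e. if e \<in> lambda_edges E L \<kappa> then cos_sol \<kappa> (L e) else 1)"
  assumes sg: "signed_graph sg" and sn0: "\<And>e. e \<in> E \<Longrightarrow> sin_sol \<kappa> (L e) = 0 \<longleftrightarrow> e \<in> El"
  shows "card El + card {C \<in> components (span_vertices El org trm) El org trm. signed_graph.balanced org trm sg El C} =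
    card (span_vertices El org trm) + cdim {graph_fun \<kappa> x | x. kernel \<kappa> x \<and> (\<forall>v\<in>V. x (Inl v) = 0)}"
proof -
  let ?\<kappa> = "complex_of_real \<kappa>"
  let ?sc = "\<lambda>(c::complex) f. (\<lambda>(e::'e) (t::real). c * f e t)"
  let ?sv = "\<lambda>(c::complex) (y :: 'v \<Rightarrow> complex) i. c * y i"
  interpret p: vector_space_pair ?sc ?sv
    unfolding vector_space_pair_def using vector_space_edge_fun vector_space_fun by blast
  interpret signed_graph org trm sg by (rule sg)
  have \<kappa>0: "?\<kappa> \<noteq> 0" using \<kappa> by simp
  define W where "W = span_vertices El org trm"
  have ElE: "El \<subseteq> E" by (auto simp: El_def lambda_edges_def)
  have finEl: "finite El" using ElE finite_E finite_subset by blast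
  have finW: "finite W" using finEl by (simp add: W_def span_vertices_def)
  have WV: "W \<subseteq> V" using ElE org_in trm_in by (auto simp: W_def span_vertices_def)
  have ends: "org e \<in> W" "trm e \<in> W" if "e \<in> El" for e using that by (auto simp: W_def span_vertices_def)
  have sgEl: "sg e = cos_sol ?\<kappa> (L e)" if "e \<in> El" for e using that by (simp add: sg_def El_def)
  \<comment> \<open>Coordinates of the combination of sines with initial slopes c on G_lam; it
    vanishes at all vertices.\<close>
  define X where "X = (\<lambda>c. case_sum (\<lambda>v. 0) (\<lambda>e. if e \<in> El then c e else (0::complex)) :: 'v + 'e \<Rightarrow> complex)"
  have X: "X c (Inl v) = 0" "X c (Inr e) = (if e \<in> El then c e else 0)" for c v e by (simp_all add: X_def)
  have X_matched: "matched ?\<kappa> (X c)" for c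
    unfolding matched_def by (auto simp: edge_value_def edge_fun_def X sn0)
  have X_ed: "end_deriv ?\<kappa> (X c) e = (if e \<in> El then c e * sg e else 0)" for c e
    by (auto simp: end_deriv_def edge_deriv_def X sgEl)
  have X_flux: "(\<Sum>v\<in>V. flux ?\<kappa> (X c) v * y v) = (\<Sum>e\<in>El. c e * (sg e * y (trm e) - y (org e)))" for c y
  proof -
    have "(\<Sum>v\<in>V. flux ?\<kappa> (X c) v * y v) =
        (\<Sum>e\<in>E. end_deriv ?\<kappa> (X c) e * y (trm e)) - (\<Sum>e\<in>E. X c (Inr e) * y (org e))"
      using sum_at_vertex[of trm "end_deriv ?\<kappa> (X c)" y, OF trm_in]
        sum_at_vertex[of org "\<lambda>e. X c (Inr e)" y, OF org_in]
      by (simp add: flux_def left_diff_distrib sum_subtractf)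
    also have "\<dots> = (\<Sum>e\<in>E. if e \<in> El then c e * (sg e * y (trm e) - y (org e)) else 0)"
      unfolding sum_subtractf[symmetric] by (intro sum.cong) (auto simp: X_ed X algebra_simps)
    also have "\<dots> = (\<Sum>e\<in>El. c e * (sg e * y (trm e) - y (org e)))"
      using ElE finite_E by (intro sum.mono_neutral_cong_right) auto
    finally show ?thesis .
  qed
  define u where "u = (\<lambda>e. graph_fun ?\<kappa> (X (\<lambda>e'. if e' = e then 1 else 0)))"
  have app: "(\<Sum>j\<in>J. (\<lambda>e t. c j * h j e t)) e t = (\<Sum>j\<in>J. c j * h j e t)"
    for J :: "'e set" and c :: "'e \<Rightarrow> complex" and h e and t :: real
    by (induction J rule: infinite_finite_induct) auto
  have comb: "(\<Sum>e\<in>El. (\<lambda>e' t. c e * u e e' t)) = graph_fun ?\<kappa> (X c)" for c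
  proof -
    have "(\<Sum>e\<in>El. (\<lambda>e' t. c e * u e e' t)) =
        graph_fun ?\<kappa> (\<lambda>i. \<Sum>e\<in>El. c e * X (\<lambda>e'. if e' = e then 1 else 0) i)"
      by (intro ext) (simp only: app linear_combination(3)[OF finEl] u_def)
    also have "(\<lambda>i. \<Sum>e\<in>El. c e * X (\<lambda>e'. if e' = e then 1 else 0) i) = X c"
    proof
      fix i show "(\<Sum>e\<in>El. c e * X (\<lambda>e'. if e' = e then 1 else 0) i) = X c i"
      proof (cases i)
        case (Inr a)
        have "(\<Sum>e\<in>El. c e * X (\<lambda>e'. if e' = e then 1 else 0) i) = (\<Sum>e\<in>El. if a = e then c e else 0)"
          by (intro sum.cong) (auto simp: X Inr)
        then show ?thesis using finEl by (simp add: X Inr)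
      qed (simp add: X)
    qed
    finally show ?thesis .
  qed
  define D where "D = {\<Sum>e\<in>El. (\<lambda>e' t. c e * u e e' t) | c. True}"
  have D: "D = {graph_fun ?\<kappa> (X c) | c. True}" unfolding D_def comb ..
  have dimD: "p.vs1.dim D = card El"
    unfolding D_def
  proof (rule p.vs1.dim_family[OF finEl])
    fix c e assume "(\<Sum>e\<in>El. (\<lambda>e' t. c e * u e e' t)) = 0" and e: "e \<in> El"
    then have "graph_fun ?\<kappa> (X c) e' t = 0" for e' t unfolding comb by simp
    then have "X c (Inr e) = 0" using graph_fun_eq_0[OF \<kappa>0 X_matched] e ElE by blast
    then show "c e = 0" using e by (simp add: X)
  qed
  have subD: "p.vs1.subspace D" unfolding D_def by (rule p.vs1.subspace_family)
  have spanD: "D \<subseteq> p.vs1.span (u ` El)"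
    unfolding D_def using p.vs1.span_family[OF finEl, of _ u] by auto
  let ?Y = "{y :: 'v \<Rightarrow> complex. \<forall>v. v \<notin> W \<longrightarrow> y v = 0}"
  obtain BY where BY: "finite BY" "?Y \<subseteq> p.vs2.span BY" using dim_supported_functions(3)[OF finW] by blast
  define b where "b = (\<lambda>f (y :: 'v \<Rightarrow> complex). \<Sum>v\<in>V. normal_derivative E org trm L f v * y v)"
  have b: "b (graph_fun ?\<kappa> (X c)) y = (\<Sum>e\<in>El. c e * (sg e * y (trm e) - y (org e)))" for c y
    unfolding b_def normal_derivative_gf[OF \<kappa>0] by (rule X_flux)
  have X_add: "graph_fun ?\<kappa> (X c) + graph_fun ?\<kappa> (X d) = graph_fun ?\<kappa> (X (\<lambda>e. c e + d e))" for c d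
    unfolding graph_fun_add[symmetric] by (rule arg_cong[of _ _ "graph_fun ?\<kappa>"]) (auto simp: X_def fun_eq_iff split: sum.split)
  have X_scale: "(\<lambda>e t. k * graph_fun ?\<kappa> (X c) e t) = graph_fun ?\<kappa> (X (\<lambda>e. k * c e))" for c k
    unfolding graph_fun_scale[symmetric] by (rule arg_cong[of _ _ "graph_fun ?\<kappa>"]) (auto simp: X_def fun_eq_iff split: sum.split)
  have "p.vs1.dim D + p.vs2.dim {y \<in> ?Y. \<forall>f\<in>D. b f y = 0} =
      p.vs2.dim ?Y + p.vs1.dim {f \<in> D. \<forall>y\<in>?Y. b f y = 0}"
  proof (rule p.bilinear_rank_eq[OF subD _ spanD dim_supported_functions(2)[OF finW] BY])
    fix f g y assume "f \<in> D" "g \<in> D"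
    then obtain c d where "f = graph_fun ?\<kappa> (X c)" "g = graph_fun ?\<kappa> (X d)" unfolding D by blast
    then show "b (f + g) y = b f y + b g y"
      by (simp add: X_add b distrib_right sum.distrib)
  next
    fix k f y assume "f \<in> D"
    then obtain c where "f = graph_fun ?\<kappa> (X c)" unfolding D by blast
    then show "b (\<lambda>e t. k * f e t) y = k * b f y"
      by (simp add: X_scale b sum_distrib_left mult.assoc)
  qed (use finEl in \<open>simp_all add: b_def algebra_simps sum.distrib sum_distrib_left\<close>)
  moreover have "{y \<in> ?Y. \<forall>f\<in>D. b f y = 0} = {y. (\<forall>v. v \<notin> W \<longrightarrow> y v = 0) \<and> potential El y}"
  proof (intro equalityI subsetI)
    fix y assume y: "y \<in> {y \<in> ?Y. \<forall>f\<in>D. b f y = 0}"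
    have "sg e * y (trm e) - y (org e) = 0" if e: "e \<in> El" for e
    proof -
      have "graph_fun ?\<kappa> (X (\<lambda>a. if a = e then 1 else 0)) \<in> D" unfolding D by blast
      then have "b (graph_fun ?\<kappa> (X (\<lambda>a. if a = e then 1 else 0))) y = 0" using y by blast
      then have "(\<Sum>a\<in>El. (if a = e then 1 else 0) * (sg a * y (trm a) - y (org a))) = 0"
        unfolding b .
      moreover have "(\<Sum>a\<in>El. (if a = e then 1 else 0) * (sg a * y (trm a) - y (org a))) =
          (\<Sum>a\<in>{e}. sg a * y (trm a) - y (org a))"
        using finEl e by (intro sum.mono_neutral_cong_right) auto
      ultimately show ?thesis by simp
    qed
    then have "potential El y" by (simp add: potential_def)
    then show "y \<in> {y. (\<forall>v. v \<notin> W \<longrightarrow> y v = 0) \<and> potential El y}" using y by simp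
  next
    fix y assume y: "y \<in> {y. (\<forall>v. v \<notin> W \<longrightarrow> y v = 0) \<and> potential El y}"
    then have "b (graph_fun ?\<kappa> (X c)) y = 0" for c
      unfolding b by (intro sum.neutral) (auto simp: potential_def)
    then show "y \<in> {y \<in> ?Y. \<forall>f\<in>D. b f y = 0}" using y by (auto simp: D)
  qed
  moreover have "{f \<in> D. \<forall>y\<in>?Y. b f y = 0} = {graph_fun ?\<kappa> x | x. kernel ?\<kappa> x \<and> (\<forall>v\<in>V. x (Inl v) = 0)}"
  proof (intro equalityI subsetI)
    fix f assume "f \<in> {f \<in> D. \<forall>y\<in>?Y. b f y = 0}"
    then obtain c where c: "f = graph_fun ?\<kappa> (X c)" "\<And>y. y \<in> ?Y \<Longrightarrow> b (graph_fun ?\<kappa> (X c)) y = 0" unfolding D by blast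
    have "flux ?\<kappa> (X c) v = 0" if v: "v \<in> V" for v
    proof (cases "v \<in> W")
      case True
      have "(\<Sum>w\<in>V. flux ?\<kappa> (X c) w * (if w = v then 1 else 0)) = 0"
        using c(2)[of "\<lambda>w. if w = v then 1 else 0"] True
        unfolding b_def normal_derivative_gf[OF \<kappa>0] by auto
      moreover have "(\<Sum>w\<in>V. flux ?\<kappa> (X c) w * (if w = v then 1 else 0)) = (\<Sum>w\<in>{v}. flux ?\<kappa> (X c) w)"
        using finite_V v by (intro sum.mono_neutral_cong_right) auto
      ultimately show ?thesis by simp
    next
      \<comment> \<open>A vertex outside W meets only edges on which the function is zero.\<close>
      case False
      then have "(\<Sum>e\<in>{e \<in> E. trm e = v}. end_deriv ?\<kappa> (X c) e) = 0"
        "(\<Sum>e\<in>{e \<in> E. org e = v}. X c (Inr e)) = 0"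
        using ends by (auto simp: X_ed X intro!: sum.neutral)
      then show ?thesis by (simp add: flux_def)
    qed
    then have "kernel ?\<kappa> (X c)" using X_matched by (simp add: kernel_def)
    then show "f \<in> {graph_fun ?\<kappa> x | x. kernel ?\<kappa> x \<and> (\<forall>v\<in>V. x (Inl v) = 0)}"
      unfolding c(1) by (intro CollectI exI[of _ "X c"]) (simp add: X)
  next
    fix f assume "f \<in> {graph_fun ?\<kappa> x | x. kernel ?\<kappa> x \<and> (\<forall>v\<in>V. x (Inl v) = 0)}"
    then obtain x where x: "f = graph_fun ?\<kappa> x" "kernel ?\<kappa> x" "\<forall>v\<in>V. x (Inl v) = 0" by blast
    \<comment> \<open>Off G_lam \<open>sin_sol\<close> is nonzero at the end of the edge, so the
      zero value there forces the slope to vanish.\<close>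
    have "x (Inr e) = 0" if e: "e \<in> E" "e \<notin> El" for e
    proof -
      have "edge_value ?\<kappa> x e (L e) = x (Inl (trm e))" using x(2) e by (simp add: kernel_def matched_def)
      then show ?thesis using x(3) org_in trm_in e sn0[OF e(1)] by (simp add: edge_value_def edge_fun_def)
    qed
    then have "x i = X (\<lambda>e. x (Inr e)) i" if "i \<in> idx" for i
      using that x(3) by (auto simp: idx_def X)
    then have f: "f = graph_fun ?\<kappa> (X (\<lambda>e. x (Inr e)))" unfolding x(1) by (rule graph_fun_cong)
    have "normal_derivative E org trm L f v = 0" if "v \<in> V" for v
      using x(2) that by (simp add: x(1) normal_derivative_gf[OF \<kappa>0] kernel_def)
    then show "f \<in> {f \<in> D. \<forall>y\<in>?Y. b f y = 0}" using f by (auto simp: D b_def)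
  qed
  ultimately show ?thesis
    using dimD dim_supported_functions(1)[OF finW] dim_potentials[OF finEl]
    by (simp add: cdim_def W_def)
qed

end

section \<open>Signs, cycle lengths and Betti numbers\<close>

lemma cos_sin_sol_of_real:
  assumes "\<kappa> > 0"
  shows "cos_sol (of_real \<kappa>) x = of_real (cos (sqrt \<kappa> * x))"
    and "sin_sol (of_real \<kappa>) x = of_real (sin (sqrt \<kappa> * x) / sqrt \<kappa>)"
proof -
  have "csqrt (of_real \<kappa>) = of_real (sqrt \<kappa>)" using assms by simp
  then show "cos_sol (of_real \<kappa>) x = of_real (cos (sqrt \<kappa> * x))"
    "sin_sol (of_real \<kappa>) x = of_real (sin (sqrt \<kappa> * x) / sqrt \<kappa>)"
    by (simp_all add: cos_sol_def sin_sol_def flip: of_real_mult cos_of_real sin_of_real)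
qed

lemma cos_sin_sol_multiple:
  assumes "\<kappa> > 0" "x = real k * (pi / sqrt \<kappa>)"
  shows "cos_sol (of_real \<kappa>) x = (- 1) ^ k" "sin_sol (of_real \<kappa>) x = 0"
proof -
  have "sqrt \<kappa> * x = real k * pi" using assms by simp
  then show "cos_sol (of_real \<kappa>) x = (- 1) ^ k" "sin_sol (of_real \<kappa>) x = 0"
    by (simp_all add: cos_sin_sol_of_real[OF assms(1)])
qed

lemma sin_sol_eq_0D:
  assumes "\<kappa> > 0" "x > 0" "sin_sol (of_real \<kappa>) x = 0"
  shows "\<exists>k::nat. x = real k * (pi / sqrt \<kappa>)"
proof -
  have "sin (sqrt \<kappa> * x) = 0" using assms by (simp add: cos_sin_sol_of_real)
  then obtain i :: int where i: "sqrt \<kappa> * x = of_int i * pi" using sin_zero_iff_int2 by blast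
  have "sqrt \<kappa> * x > 0" using assms by simp
  then have "i > 0" unfolding i by (simp add: zero_less_mult_iff)
  then have "x = real (nat i) * (pi / sqrt \<kappa>)" using i assms by (simp add: field_simps)
  then show ?thesis by blast
qed

text \<open>An edge of length k * pi / sqrt \<kappa> contributes the sign (-1)^k, so the product of
  the signs records the parity of the total length in this unit.\<close>

lemma odd_length_iff:
  assumes \<kappa>: "\<kappa> > 0" and es: "set es \<subseteq> lambda_edges E L \<kappa>"
    and s: "\<And>e. e \<in> lambda_edges E L \<kappa> \<Longrightarrow> s e = cos_sol (of_real \<kappa>) (L e)"
  shows "odd_length (pi / sqrt \<kappa>) (cycle_length L es) \<longleftrightarrow> prod_list (map s es) = - 1"
proof -
  have "\<exists>n. cycle_length L es = real n * (pi / sqrt \<kappa>) \<and> prod_list (map s es) = (- 1) ^ n"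
    using es
  proof (induction es)
    case Nil
    show ?case by (intro exI[of _ 0]) (simp add: cycle_length_def)
  next
    case (Cons e es)
    then obtain n where n: "cycle_length L es = real n * (pi / sqrt \<kappa>)" "prod_list (map s es) = (- 1) ^ n" by auto
    have e: "e \<in> lambda_edges E L \<kappa>" using Cons.prems by simp
    then obtain k where k: "L e = real k * (pi / sqrt \<kappa>)" by (auto simp: lambda_edges_def)
    have "cycle_length L (e # es) = real (k + n) * (pi / sqrt \<kappa>)"
      using n(1) k by (simp add: cycle_length_def algebra_simps add_divide_distrib)
    moreover have "prod_list (map s (e # es)) = (- 1) ^ (k + n)"
      using n(2) s[OF e] cos_sin_sol_multiple(1)[OF \<kappa> k] by (simp add: power_add)
    ultimately show ?case by blast
  qed
  then obtain n where n: "cycle_length L es = real n * (pi / sqrt \<kappa>)" "prod_list (map s es) = (- 1) ^ n" by blast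
  have "odd_length (pi / sqrt \<kappa>) (cycle_length L es) \<longleftrightarrow> odd n"
    using \<kappa> by (auto simp: odd_length_def n(1))
  also have "\<dots> \<longleftrightarrow> prod_list (map s es) = - 1"
    unfolding n(2) by (cases "even n") (auto simp: one_neq_neg_one)
  finally show ?thesis .
qed

text \<open>The finite spanning set matters: an infinite-dimensional space also has dimension 0,
  since infinite bases have cardinality 0.\<close>

lemma cdim_eq_0_iff:
  assumes sub: "Modules.module.subspace (\<lambda>(c::complex) f. (\<lambda>e x. c * f e x)) S"
    and fin: "finite B" "S \<subseteq> Modules.module.span (\<lambda>(c::complex) f. (\<lambda>e x. c * f e x)) B"
  shows "cdim S = 0 \<longleftrightarrow> (\<forall>f\<in>S. f = 0)"
proof -
  interpret vector_space "\<lambda>(c::complex) f. (\<lambda>(e::'a) (x::real). c * f e x)" by (rule vector_space_edge_fun)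
  obtain C where C: "C \<subseteq> S" "S \<subseteq> span C" "card C = dim S" "finite C"
    using finite_basis_exists[OF fin] by metis
  show ?thesis
  proof
    assume "cdim S = 0"
    then have "C = {}" using C by (simp add: cdim_def)
    then show "\<forall>f\<in>S. f = 0" using C(2) by auto
  next
    assume "\<forall>f\<in>S. f = 0"
    then have "S \<subseteq> span {}" by auto
    then show "cdim S = 0" using dim_le_card[of S "{}"] by (simp add: cdim_def)
  qed
qed

text \<open>The balanced components are those without an odd cycle, so their number is
  \<open>beta0\<close> minus \<open>beta0_odd\<close>; inserting this into
  \<open>dim_dirichlet_eigenspace\<close> produces the Betti numbers.\<close>

lemma (in kirchhoff_graph) dim_dirichlet_betti:
  assumes \<kappa>: "\<kappa> > 0"
  defines "El \<equiv> lambda_edges E L \<kappa>"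
  defines "W \<equiv> span_vertices El org trm"
  shows "int (cdim {graph_fun \<kappa> x | x. kernel \<kappa> x \<and> (\<forall>v\<in>V. x (Inl v) = 0)}) =
    beta1 W El org trm - int (beta0_odd W El org trm L (pi / sqrt \<kappa>))"
proof -
  define s where "s = (\<lambda>e. if e \<in> El then cos_sol (of_real \<kappa>) (L e) else 1)"
  have El: "\<exists>k::nat. L e = real k * (pi / sqrt \<kappa>)" if "e \<in> El" for e
    using that by (auto simp: El_def lambda_edges_def)
  interpret signed_graph org trm s
  proof
    fix e show "s e = 1 \<or> s e = - 1"
    proof (cases "e \<in> El")
      case True
      then obtain k :: nat where "L e = real k * (pi / sqrt \<kappa>)" using El by blast
      then have "s e = (- 1) ^ k" using cos_sin_sol_multiple(1)[OF \<kappa>] True by (simp add: s_def)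
      then show ?thesis by (cases "even k") auto
    qed (simp add: s_def)
  qed
  have sn0: "sin_sol (of_real \<kappa>) (L e) = 0 \<longleftrightarrow> e \<in> El" if "e \<in> E" for e
    using sin_sol_eq_0D[OF \<kappa> L_pos[OF that]] El cos_sin_sol_multiple(2)[OF \<kappa>] that
    by (auto simp: El_def lambda_edges_def)
  have dims: "card El + card {C \<in> components W El org trm. balanced El C} =
      card W + cdim {graph_fun \<kappa> x | x. kernel \<kappa> x \<and> (\<forall>v\<in>V. x (Inl v) = 0)}"
    using dim_dirichlet_eigenspace[OF \<kappa>] signed_graph_axioms sn0
    unfolding s_def W_def El_def by blast
  have "finite El" using finite_E by (simp add: El_def lambda_edges_def)
  then have "finite W" by (simp add: W_def span_vertices_def)
  moreover have "Id_on W \<union> (adj_rel El org trm)\<^sup>+ \<subseteq> W \<times> W"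
    using equiv_components[of El org trm] by (simp add: W_def equiv_def)
  ultimately have fin: "finite (components W El org trm)"
    unfolding components_def by (rule finite_quotient)
  have odd: "(\<exists>es ws. is_cycle El org trm es ws \<and> set ws \<subseteq> C \<and> odd_length (pi / sqrt \<kappa>) (cycle_length L es))
      \<longleftrightarrow> \<not> balanced El C" for C
  proof -
    have "odd_length (pi / sqrt \<kappa>) (cycle_length L es) \<longleftrightarrow> prod_list (map s es) \<noteq> 1"
      if "is_cycle El org trm es ws" for es ws
    proof -
      have "odd_length (pi / sqrt \<kappa>) (cycle_length L es) \<longleftrightarrow> prod_list (map s es) = - 1"
        using that by (intro odd_length_iff[OF \<kappa>]) (auto simp: is_cycle_def El_def s_def)
      then show ?thesis using prod_sign[of es] by auto
    qed
    then show ?thesis unfolding balanced_def by blast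
  qed
  have "components W El org trm = {C \<in> components W El org trm. balanced El C} \<union>
      {C \<in> components W El org trm. \<not> balanced El C}" by blast
  then have "beta0 W El org trm = card ({C \<in> components W El org trm. balanced El C} \<union>
      {C \<in> components W El org trm. \<not> balanced El C})" by (simp add: beta0_def)
  also have "\<dots> = card {C \<in> components W El org trm. balanced El C} + beta0_odd W El org trm L (pi / sqrt \<kappa>)"
    unfolding beta0_odd_def odd using fin by (intro card_Un_disjoint) auto
  finally show ?thesis using dims by (simp add: beta1_def)
qed

section \<open>Combination of the two dimension counts\<close>

theorem theorem4p6:
  fixes V :: "'v set" and E :: "'e set" and org trm :: "'e \<Rightarrow> 'v" and L :: "'e \<Rightarrow> real"
    and vs :: "'v list" and lam :: real
  assumes graph: "metric_graph V E org trm L"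
    and no_isolated: "\<forall>v\<in>V. \<exists>e\<in>E. org e = v \<or> trm e = v"
    and B_distinct: "distinct vs" and B_sub: "set vs \<subseteq> V"
    and B_boundary: "boundary_vertices V E org trm \<subseteq> set vs"
    and B_core: "proper_core_vertices V E org trm \<subseteq> set vs"
    and lam_pos: "lam > 0"
  defines "El \<equiv> lambda_edges E L lam"
    and "M \<equiv> tw_matrix V E org trm L vs"
    and "m \<equiv> length vs"
  defines "b1 \<equiv> beta1 (span_vertices El org trm) El org trm"
    and "b0odd \<equiv> int (beta0_odd (span_vertices El org trm) El org trm L (pi / sqrt lam))"
    and "kd \<equiv> int (cdim (kirchhoff_eigenspace V E org trm L (complex_of_real lam)))"
    and "rk \<equiv> int (mat_rank (mat_residue m (complex_of_real lam) M))"
  shows "(b1 = b0odd \<longrightarrow>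
            (is_kirchhoff_eigenvalue V E org trm L (complex_of_real lam) \<longleftrightarrow>
               mat_is_pole m (complex_of_real lam) M) \<and>
            kd = rk)
       \<and> (b1 > b0odd \<longrightarrow>
            is_kirchhoff_eigenvalue V E org trm L (complex_of_real lam) \<and>
            kd = rk + b1 - b0odd \<and>
            (mat_is_pole m (complex_of_real lam) M \<longleftrightarrow> kd > b1 - b0odd))"
proof -
  interpret kirchhoff_graph V E org trm L using graph no_isolated by unfold_locales
  let ?lam = "complex_of_real lam"
  have lam0: "?lam \<noteq> 0" using lam_pos by simp
  obtain r H where r: "r > 0"
    and H: "\<And>k l. k < m \<Longrightarrow> l < m \<Longrightarrow> (\<lambda>\<mu>. H \<mu> k l) holomorphic_on ball ?lam r"
    and M: "\<And>\<mu> k l. k < m \<Longrightarrow> l < m \<Longrightarrow> \<mu> \<in> ball ?lam r - {?lam} \<Longrightarrow> M \<mu> $$ (k, l) = H \<mu> k l / (\<mu> - ?lam)"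
    and ker: "\<And>y. (\<forall>k<m. (\<Sum>l<m. H ?lam k l * y l) = 0) \<longleftrightarrow>
       (\<forall>x. kernel ?lam x \<longrightarrow> (\<Sum>l<m. x (Inl (vs ! l)) * y l) = 0)"
    by (rule residue_structure[OF lam_pos B_sub, folded M_def m_def]) (rule that)
  define R where "R = mat m m (\<lambda>(k, l). H ?lam k l)"
  have R: "R \<in> carrier_mat m m" "\<And>k l. k < m \<Longrightarrow> l < m \<Longrightarrow> R $$ (k, l) = H ?lam k l"
    by (auto simp: R_def)
  have residue: "mat_residue m ?lam M = R"
    and pole: "mat_is_pole m ?lam M \<longleftrightarrow> (\<exists>k<m. \<exists>l<m. H ?lam k l \<noteq> 0)"
    unfolding R_def by (rule simple_pole_matrix[OF r H M]; assumption)+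
  obtain J where J: "J \<subseteq> {..<m}" "mat_rank R = card J"
    and ind: "\<And>y j. \<forall>i<m. (\<Sum>j\<in>J. R $$ (i, j) * y j) = 0 \<Longrightarrow> j \<in> J \<Longrightarrow> y j = 0"
    and spanning: "\<And>l. l < m \<Longrightarrow> \<exists>a. \<forall>i<m. R $$ (i, l) = (\<Sum>j\<in>J. R $$ (i, j) * a j)"
    by (rule mat_rank_columns[OF R(1)]) (rule that)
  have sum_J: "(\<Sum>j\<in>J. R $$ (i, j) * y j) = (\<Sum>j\<in>J. H ?lam i j * y j)" if "i < m" for i y
    using J(1) R(2) that by (intro sum.cong) auto
  have "cdim {graph_fun ?lam x | x. kernel ?lam x} =
      card J + cdim {graph_fun ?lam x | x. kernel ?lam x \<and> (\<forall>v\<in>set vs. x (Inl v) = 0)}"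
  proof (rule dim_eigenspace_residue[OF lam_pos B_sub, where A = "H ?lam"])
    show "J \<subseteq> {..<length vs}" using J(1) by (simp add: m_def)
    show "y j = 0" if "\<forall>i<length vs. (\<Sum>j\<in>J. H ?lam i j * y j) = 0" "j \<in> J" for y j
      using ind[of y j] that sum_J by (simp add: m_def)
    show "\<exists>a. \<forall>i<length vs. H ?lam i l = (\<Sum>j\<in>J. H ?lam i j * a j)" if "l < length vs" for l
      using spanning[of l] that sum_J R(2) by (simp add: m_def)
  qed (use ker in \<open>simp add: m_def\<close>)
  \<comment> \<open>For eigenfunctions, vanishing on B amounts to vanishing at all vertices; this
    links the two counts.\<close>
  moreover have "kernel ?lam x \<and> (\<forall>v\<in>set vs. x (Inl v) = 0) \<longleftrightarrow>
      kernel ?lam x \<and> (\<forall>v\<in>V. x (Inl v) = 0)" for x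
    using vanishing_at_vertices[OF lam0 _ B_boundary B_core, of x] B_sub by blast
  ultimately have "kd = int (card J) + (b1 - b0odd)"
    using dim_dirichlet_betti[OF lam_pos]
    by (simp add: kd_def eigenspace_eq[OF lam0] b1_def b0odd_def El_def)
  \<comment> \<open>This formula covers both cases; it remains to see that being an eigenvalue means
    kd > 0 and being a pole means rk > 0.\<close>
  then have kd: "kd = rk + (b1 - b0odd)" by (simp add: rk_def residue J(2))
  obtain B where B: "finite B" "{graph_fun ?lam x | x. kernel ?lam x} \<subseteq> Modules.module.span (\<lambda>c f e t. c * f e t) B"
    using eigenspace_subspace(2)[OF lam0] by blast
  have eig: "is_kirchhoff_eigenvalue V E org trm L ?lam \<longleftrightarrow> kd > 0"
    using cdim_eq_0_iff[OF eigenspace_subspace(1)[OF lam0] B]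
    by (auto simp: is_kirchhoff_eigenvalue_def kd_def eigenspace_eq[OF lam0])
  have "mat_is_pole m ?lam M \<longleftrightarrow> J \<noteq> {}"
  proof
    assume "mat_is_pole m ?lam M"
    then obtain k l where kl: "k < m" "l < m" "R $$ (k, l) \<noteq> 0" using pole R(2) by auto
    then obtain a where "R $$ (k, l) = (\<Sum>j\<in>J. R $$ (k, j) * a j)" using spanning by blast
    then show "J \<noteq> {}" using kl(3) by auto
  next
    assume "J \<noteq> {}"
    then obtain j where j: "j \<in> J" by blast
    show "mat_is_pole m ?lam M"
    proof (rule ccontr)
      assume "\<not> mat_is_pole m ?lam M"
      \<comment> \<open>All entries would be zero, so the coefficients 1 would give a vanishing
        combination of the independent columns in J.\<close>
      then have "(\<Sum>j\<in>J. R $$ (i, j) * 1) = 0" if "i < m" for i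
        using that J(1) R(2) pole by (intro sum.neutral) auto
      then show False using ind[of "\<lambda>_. 1" j] j by simp
    qed
  qed
  moreover have "J \<noteq> {} \<longleftrightarrow> rk > 0"
    using J finite_subset[OF J(1)] by (simp add: rk_def residue card_gt_0_iff)
  moreover have "rk \<ge> 0" by (simp add: rk_def)
  ultimately show ?thesis using kd eig by auto
qed

end
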